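(* Let $\Phi$ be an irreducible root system of classical type ($A_n$, $B_n$, $C_n$ or $D_n$) of rank $n$ in $V=\mathbb{R}\otimes\mathbb{Z}\Phi$, with fixed simple roots $\Pi$ and positive roots $\Phi^+$. Then for every ideal $\mathcal{I}$ of $\Phi^+$, the arrangement of ideal type $\mathcal{A}_\mathcal{I}$ is inductively free with multiset of exponents $\{0^{n-s}, m_1^\mathcal{I}, \ldots, m_s^\mathcal{I}\}$, i.e. its non-zero exponents are the ideal exponents of $\mathcal{I}$.
   Context: For $\beta=\sum_{\alpha\in\Pi}c_\alpha\alpha\in\Phi^+$ the height is $\mathrm{ht}(\beta)=\sum_\alpha c_\alpha$. An ideal of $\Phi^+$ is a subset $\mathcal{I}\subseteq\Phi^+$ such that $\alpha\in\mathcal{I}$, $\beta\in\Phi^+$, $\alpha+\beta\in\Phi^+$ imply $\alpha+\beta\in\mathcal{I}$. Write $\mathcal{I}^c=\Phi^+\setminus\mathcal{I}$, $H_\alpha$ for the hyperplane orthogonal to $\alpha$, and $\mathcal{A}_\mathcal{I}=\{H_\alpha:\alpha\in\mathcal{I}^c\}$. Let $\lambda_i=|\{\alpha\in\mathcal{I}^c:\mathrm{ht}(\alpha)=i\}|$, $s=\lambda_1$; the ideal exponents are $m_i^\mathcal{I}=|\{j:\lambda_j\ge s-i+1\}|$, $i=1,\ldots,s$. A central arrangement $\mathcal{A}$ in $V$ is free if $D(\mathcal{A})=\{\theta\in\mathrm{Der}(S):\theta(Q)\in QS\}$ is a free module over $S=\mathrm{Sym}(V^* )$, $Q=\prod_{H\in\mathcal{A}}\alpha_H$;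 exponents are the degrees of a homogeneous basis. Inductively free arrangements form the smallest class containing all empty arrangements and containing $\mathcal{A}$ whenever some $H_0\in\mathcal{A}$ has $\mathcal{A}'=\mathcal{A}\setminus\{H_0\}$ and $\mathcal{A}''=\{H_0\cap H:H\in\mathcal{A}'\}$ (in $H_0$) inductively free with $\exp\mathcal{A}''\subseteq\exp\mathcal{A}'$. *)

theory Defs
  imports "HOL-Analysis.Analysis" "HOL-Library.Multiset"
begin

definition cartan_int :: "'a::euclidean_space \<Rightarrow> 'a \<Rightarrow> real" where
  "cartan_int \<beta> \<alpha> = 2 * (\<beta> \<bullet> \<alpha>) / (\<alpha> \<bullet> \<alpha>)"

definition root_reflection :: "'a::euclidean_space \<Rightarrow> 'a \<Rightarrow> 'a" where
  "root_reflection \<alpha> x = x - cartan_int x \<alpha> *\<^sub>R \<alpha>"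

text \<open>Reduced crystallographic root systems. The roots span the whole type, so the type plays the
  role of \<open>V\<close> and the rank is \<open>DIM('a)\<close>.\<close>

definition root_system :: "'a::euclidean_space set \<Rightarrow> bool" where
  "root_system \<Phi> \<longleftrightarrow>
     finite \<Phi> \<and> 0 \<notin> \<Phi> \<and> span \<Phi> = UNIV \<and>
     (\<forall>\<alpha>\<in>\<Phi>. root_reflection \<alpha> ` \<Phi> = \<Phi>) \<and>
     (\<forall>\<alpha>\<in>\<Phi>. \<forall>\<beta>\<in>\<Phi>. cartan_int \<beta> \<alpha> \<in> \<int>) \<and>
     (\<forall>\<alpha>\<in>\<Phi>. \<forall>c. c *\<^sub>R \<alpha> \<in> \<Phi> \<longrightarrow> c = 1 \<or> c = -1)"

definition irreducible_root_system :: "'a::euclidean_space set \<Rightarrow> bool" where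
  "irreducible_root_system \<Phi> \<longleftrightarrow>
     root_system \<Phi> \<and> \<Phi> \<noteq> {} \<and>
     \<not> (\<exists>\<Phi>1 \<Phi>2. \<Phi>1 \<noteq> {} \<and> \<Phi>2 \<noteq> {} \<and> \<Phi> = \<Phi>1 \<union> \<Phi>2 \<and> \<Phi>1 \<inter> \<Phi>2 = {} \<and>
          (\<forall>\<alpha>\<in>\<Phi>1. \<forall>\<beta>\<in>\<Phi>2. \<alpha> \<bullet> \<beta> = 0))"

definition simple_roots :: "'a::euclidean_space set \<Rightarrow> 'a set \<Rightarrow> bool" where
  "simple_roots \<Phi> \<Delta> \<longleftrightarrow>
     \<Delta> \<subseteq> \<Phi> \<and> independent \<Delta> \<and> span \<Delta> = UNIV \<and>
     (\<forall>\<beta>\<in>\<Phi>. (\<forall>\<alpha>\<in>\<Delta>. representation \<Delta> \<beta> \<alpha> \<in> \<nat>) \<or> (\<forall>\<alpha>\<in>\<Delta>. - representation \<Delta> \<beta> \<alpha> \<in> \<nat>))"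

definition positive_roots :: "'a::euclidean_space set \<Rightarrow> 'a set \<Rightarrow> 'a set" where
  "positive_roots \<Phi> \<Delta> = {\<beta>\<in>\<Phi>. \<forall>\<alpha>\<in>\<Delta>. representation \<Delta> \<beta> \<alpha> \<ge> 0}"

definition height :: "'a::euclidean_space set \<Rightarrow> 'a \<Rightarrow> real" where
  "height \<Delta> \<beta> = (\<Sum>\<alpha>\<in>\<Delta>. representation \<Delta> \<beta> \<alpha>)"

datatype classical_type = Type_A | Type_B | Type_C | Type_D

text \<open>Cartan matrices with entries \<open>2 (\<alpha>\<^sub>i, \<alpha>\<^sub>j) / (\<alpha>\<^sub>j, \<alpha>\<^sub>j)\<close>, \<open>1 \<le> i, j \<le> n\<close>, in the Bourbaki numbering:
  in type B the root \<open>\<alpha>\<^sub>n\<close> is short, in type C it is long, and in type D the nodes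
  \<open>\<alpha>\<^sub>n\<^sub>-\<^sub>1\<close> and \<open>\<alpha>\<^sub>n\<close> are both joined to \<open>\<alpha>\<^sub>n\<^sub>-\<^sub>2\<close> and not to each other.\<close>

definition type_A_matrix :: "nat \<Rightarrow> nat \<Rightarrow> real" where
  "type_A_matrix i j = (if i = j then 2 else if j = i + 1 \<or> i = j + 1 then -1 else 0)"

fun cartan_matrix :: "classical_type \<Rightarrow> nat \<Rightarrow> nat \<Rightarrow> nat \<Rightarrow> real" where
  "cartan_matrix Type_A n i j = type_A_matrix i j"
| "cartan_matrix Type_B n i j = (if (i, j) = (n - 1, n) then -2 else type_A_matrix i j)"
| "cartan_matrix Type_C n i j = (if (i, j) = (n, n - 1) then -2 else type_A_matrix i j)"
| "cartan_matrix Type_D n i j =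
     (if (i, j) \<in> {(n - 1, n), (n, n - 1)} then 0
      else if (i, j) \<in> {(n - 2, n), (n, n - 2)} then -1
      else type_A_matrix i j)"

text \<open>The usual lower bounds on the rank. The smaller cases only repeat types already covered
  (\<open>B\<^sub>1 = C\<^sub>1 = A\<^sub>1\<close>, \<open>C\<^sub>2 = B\<^sub>2\<close>, \<open>D\<^sub>3 = A\<^sub>3\<close>) or are not irreducible (\<open>D\<^sub>2\<close>).\<close>

fun min_rank :: "classical_type \<Rightarrow> nat" where
  "min_rank Type_A = 1"
| "min_rank Type_B = 2"
| "min_rank Type_C = 3"
| "min_rank Type_D = 4"

definition of_type :: "'a::euclidean_space set \<Rightarrow> classical_type \<Rightarrow> nat \<Rightarrow> bool" where
  "of_type \<Delta> X n \<longleftrightarrow>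
     min_rank X \<le> n \<and>
     (\<exists>a. bij_betw a {1..n} \<Delta> \<and>
          (\<forall>i\<in>{1..n}. \<forall>j\<in>{1..n}. cartan_int (a i) (a j) = cartan_matrix X n i j))"

definition root_ideal :: "'a::euclidean_space set \<Rightarrow> 'a set \<Rightarrow> 'a set \<Rightarrow> bool" where
  "root_ideal \<Phi> \<Delta> I \<longleftrightarrow>
     I \<subseteq> positive_roots \<Phi> \<Delta> \<and>
     (\<forall>\<alpha>\<in>I. \<forall>\<beta>\<in>positive_roots \<Phi> \<Delta>. \<alpha> + \<beta> \<in> positive_roots \<Phi> \<Delta> \<longrightarrow> \<alpha> + \<beta> \<in> I)"

definition ideal_compl :: "'a::euclidean_space set \<Rightarrow> 'a set \<Rightarrow> 'a set \<Rightarrow> 'a set" where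
  "ideal_compl \<Phi> \<Delta> I = positive_roots \<Phi> \<Delta> - I"

definition ideal_arrangement :: "'a::euclidean_space set \<Rightarrow> 'a set \<Rightarrow> 'a set \<Rightarrow> 'a set set" where
  "ideal_arrangement \<Phi> \<Delta> I = (\<lambda>\<alpha>. {x. \<alpha> \<bullet> x = 0}) ` ideal_compl \<Phi> \<Delta> I"

definition height_count :: "'a::euclidean_space set \<Rightarrow> 'a set \<Rightarrow> 'a set \<Rightarrow> nat \<Rightarrow> nat" where
  "height_count \<Phi> \<Delta> I i = card {\<alpha> \<in> ideal_compl \<Phi> \<Delta> I. height \<Delta> \<alpha> = real i}"

definition ideal_exponent :: "'a::euclidean_space set \<Rightarrow> 'a set \<Rightarrow> 'a set \<Rightarrow> nat \<Rightarrow> nat" where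
  "ideal_exponent \<Phi> \<Delta> I i =
     card {j. 1 \<le> j \<and> height_count \<Phi> \<Delta> I j \<ge> height_count \<Phi> \<Delta> I 1 - i + 1}"

text \<open>Restrictions of an arrangement live in one of its hyperplanes, so a central arrangement is a
  finite set of linear hyperplanes of a subspace \<open>W\<close> of the ambient Euclidean space.\<close>

definition central_arrangement :: "'a::euclidean_space set \<Rightarrow> 'a set set \<Rightarrow> bool" where
  "central_arrangement W A \<longleftrightarrow>
     subspace W \<and> finite A \<and> (\<forall>H\<in>A. subspace H \<and> H \<subseteq> W \<and> dim H + 1 = dim W)"

text \<open>Since the reals are infinite, \<open>Sym(W\<^sup>*)\<close> is the ring of real polynomial functions on \<open>W\<close>. A
  function on \<open>W\<close> is represented by its extension by \<open>0\<close>; so the unit is the indicator of \<open>W\<close>, and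
  the ring operations are pointwise.\<close>

definition zero_ext :: "'a set \<Rightarrow> ('a \<Rightarrow> real) \<Rightarrow> 'a \<Rightarrow> real" where
  "zero_ext W f = (\<lambda>x. if x \<in> W then f x else 0)"

definition Sym_dual :: "'a::euclidean_space set \<Rightarrow> ('a \<Rightarrow> real) set" where
  "Sym_dual W = zero_ext W ` {p. real_polynomial_function p}"

text \<open>Derivations are set to \<open>0\<close> outside \<open>Sym(W\<^sup>*)\<close>, so that equality of functions is equality of
  derivations.\<close>

definition Der :: "'a::euclidean_space set \<Rightarrow> (('a \<Rightarrow> real) \<Rightarrow> 'a \<Rightarrow> real) set" where
  "Der W = {\<theta>.
     (\<forall>f\<in>Sym_dual W. \<theta> f \<in> Sym_dual W) \<and>
     (\<forall>f. f \<notin> Sym_dual W \<longrightarrow> \<theta> f = (\<lambda>x. 0)) \<and>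
     (\<forall>f\<in>Sym_dual W. \<forall>g\<in>Sym_dual W. \<theta> (\<lambda>x. f x + g x) = (\<lambda>x. \<theta> f x + \<theta> g x)) \<and>
     (\<forall>c. \<forall>f\<in>Sym_dual W. \<theta> (\<lambda>x. c * f x) = (\<lambda>x. c * \<theta> f x)) \<and>
     (\<forall>f\<in>Sym_dual W. \<forall>g\<in>Sym_dual W. \<theta> (\<lambda>x. f x * g x) = (\<lambda>x. \<theta> f x * g x + f x * \<theta> g x))}"

text \<open>A linear form on \<open>W\<close> with kernel \<open>H\<close> is unique up to a nonzero scalar, so the choice of the
  forms \<open>\<alpha>\<^sub>H\<close> affects neither the ideal generated by \<open>Q\<close> nor \<open>D(A)\<close>.\<close>

definition hyperplane_form :: "'a::euclidean_space set \<Rightarrow> 'a set \<Rightarrow> 'a \<Rightarrow> real" where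
  "hyperplane_form W H = (SOME l. linear l \<and> {x\<in>W. l x = 0} = H)"

definition defining_poly :: "'a::euclidean_space set \<Rightarrow> 'a set set \<Rightarrow> 'a \<Rightarrow> real" where
  "defining_poly W A = zero_ext W (\<lambda>x. \<Prod>H\<in>A. hyperplane_form W H x)"

definition log_derivations ::
    "'a::euclidean_space set \<Rightarrow> 'a set set \<Rightarrow> (('a \<Rightarrow> real) \<Rightarrow> 'a \<Rightarrow> real) set" where
  "log_derivations W A =
     {\<theta>\<in>Der W. \<exists>f\<in>Sym_dual W. \<theta> (defining_poly W A) = (\<lambda>x. defining_poly W A x * f x)}"

definition module_basis ::
    "'a::euclidean_space set \<Rightarrow> (('a \<Rightarrow> real) \<Rightarrow> 'a \<Rightarrow> real) set \<Rightarrow>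
     (('a \<Rightarrow> real) \<Rightarrow> 'a \<Rightarrow> real) list \<Rightarrow> bool" where
  "module_basis W D \<theta>s \<longleftrightarrow>
     set \<theta>s \<subseteq> D \<and>
     (\<forall>\<theta>\<in>D. \<exists>!cs. length cs = length \<theta>s \<and> set cs \<subseteq> Sym_dual W \<and>
        \<theta> = (\<lambda>g x. \<Sum>i<length \<theta>s. (cs ! i) x * (\<theta>s ! i) g x))"

definition homogeneous_poly :: "'a::euclidean_space set \<Rightarrow> nat \<Rightarrow> ('a \<Rightarrow> real) \<Rightarrow> bool" where
  "homogeneous_poly W d f \<longleftrightarrow> f \<in> Sym_dual W \<and> (\<forall>x\<in>W. \<forall>c. f (c *\<^sub>R x) = c ^ d * f x)"

text \<open>Polynomial degree of a derivation: \<open>\<theta> = \<Sum>\<^sub>i f\<^sub>i \<partial>/\<partial>x\<^sub>i\<close> has degree \<open>d\<close> iff every \<open>f\<^sub>i = \<theta>(x\<^sub>i)\<close> is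
  homogeneous of degree \<open>d\<close>, so the derivations \<open>\<partial>/\<partial>x\<^sub>i\<close> have degree \<open>0\<close>. The zero derivation is
  homogeneous of every degree but belongs to no basis.\<close>

definition homogeneous_der ::
    "'a::euclidean_space set \<Rightarrow> nat \<Rightarrow> (('a \<Rightarrow> real) \<Rightarrow> 'a \<Rightarrow> real) \<Rightarrow> bool" where
  "homogeneous_der W d \<theta> \<longleftrightarrow>
     \<theta> \<in> Der W \<and> (\<forall>l. linear l \<longrightarrow> homogeneous_poly W d (\<theta> (zero_ext W l)))"

text \<open>The multiset of degrees does not depend on the homogeneous basis.\<close>

definition free_with_exponents :: "'a::euclidean_space set \<Rightarrow> 'a set set \<Rightarrow> nat multiset \<Rightarrow> bool" where
  "free_with_exponents W A E \<longleftrightarrow>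
     (\<exists>\<theta>s ds. module_basis W (log_derivations W A) \<theta>s \<and>
        list_all2 (homogeneous_der W) ds \<theta>s \<and> E = mset ds)"

inductive inductively_free :: "'a::euclidean_space set \<Rightarrow> 'a set set \<Rightarrow> bool" where
  empty: "subspace W \<Longrightarrow> inductively_free W {}"
| add_hyperplane:
    "\<lbrakk>central_arrangement W A; H0 \<in> A;
      inductively_free W (A - {H0});
      inductively_free H0 ((\<lambda>H. H0 \<inter> H) ` (A - {H0}));
      free_with_exponents W (A - {H0}) E';
      free_with_exponents H0 ((\<lambda>H. H0 \<inter> H) ` (A - {H0})) E'';
      E'' \<subseteq># E'\<rbrakk> \<Longrightarrow> inductively_free W A"

end

theory Submission
  imports Defs
begin

text \<open>
  Write the hyperplanes of \<open>A\<^sub>I\<close> in coordinates \<open>y\<^sub>i - y\<^sub>j\<close>, \<open>y\<^sub>i + y\<^sub>j\<close>, \<open>y\<^sub>i\<close> with \<open>i < j\<close>, and add them row by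
  row, \<open>i\<close> decreasing. A derivation is a polynomial vector field, and it is logarithmic iff the field is
  tangent to every hyperplane. If \<open>H\<close> is added to a free arrangement \<open>A'\<close> with restriction \<open>A''\<close>, every tangent
  field \<open>\<theta>\<close> of \<open>A'\<close> has \<open>\<theta>(\<alpha>\<^sub>H)\<close> divisible on \<open>H\<close> by a product \<open>B\<close> of \<open>|A'| - |A''|\<close> linear forms; one field \<open>\<psi>\<close>
  with \<open>\<psi>(\<alpha>\<^sub>H) = B\<close> on \<open>H\<close> then makes the new arrangement free, with the exponent \<open>deg B\<close> raised by one.

  In types A, B, C the complement of an ideal is such that any two forms of row \<open>i\<close> differ by a multiple of
  a form from a lower row. Hence restricting to a hyperplane of row \<open>i\<close> leaves just the lower rows, \<open>\<psi>\<close> is the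
  product of the forms present in row \<open>i\<close> times \<open>\<partial>/\<partial>y\<^sub>i\<close>, and the exponents are the row lengths. In type D the
  only exception is \<open>y\<^sub>i + y\<^sub>j\<close> when \<open>y\<^sub>i - y\<^sub>j\<close> is present: the restriction gains the hyperplane \<open>y\<^sub>j = 0\<close>, and \<open>\<psi>\<close> is
  built from the field \<open>\<Sum>\<^sub>k (\<Prod>\<^sub>l\<^sub>\<noteq>\<^sub>k y\<^sub>l) \<partial>/\<partial>y\<^sub>k\<close>. Since the heights in a row are consecutive, the exponents are
  the conjugate partition of the height distribution.
\<close>

section \<open>Polynomial functions on a subspace\<close>

text \<open>Restriction moves an arrangement into a hyperplane on which the coordinates are no
  longer independent. The induction therefore ranges over all subspaces \<open>W\<close> at once:
  the forms remain fixed vectors of the ambient space, and \<open>W\<close> only has to contain a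
  family \<open>u\<close> dual to those \<open>e k\<close> that still occur. Passing to the kernel
  of a form of row \<open>b\<close> costs \<open>u b\<close> alone. The \<open>z\<close> dimensions
  not reached by these coordinates contribute exponents 0. The deletion always has exponents
  \<open>add_mset d F\<close> and the restriction \<open>F\<close>, so the inclusion demanded by
  inductive freeness is built in. In type D the restriction with the extra hyperplane is itself not
  of ideal type. It is built by a second addition, of that hyperplane to the lower rows, whose own
  restriction is again of the kind treated row by row. This happens only in rows containing both
  \<open>y\<^sub>b - y\<^sub>n\<close> and \<open>y\<^sub>b + y\<^sub>n\<close>. There all forms
  with a minus are inserted first, and each form with a plus then raises an exponent inherited from
  the lower rows.\<close>

abbreviation rpoly :: "('a::euclidean_space \<Rightarrow> real) \<Rightarrow> bool" where
  "rpoly \<equiv> real_polynomial_function"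

lemmas rpoly_linear = real_polynomial_function.intros(1)
  and rpoly_const = real_polynomial_function.intros(2)
  and rpoly_add = real_polynomial_function.intros(3)
  and rpoly_mult = real_polynomial_function.intros(4)

text \<open>A hyperplane of \<open>W\<close> is given by a vector of the ambient space that need not
  lie in \<open>W\<close>, so that one vector supplies a form on every subspace met in the
  induction.\<close>

definition hyp :: "'a::euclidean_space set \<Rightarrow> 'a \<Rightarrow> 'a set" where
  "hyp W \<alpha> = {x \<in> W. \<alpha> \<bullet> x = 0}"

lemma mem_hyp: "x \<in> hyp W \<alpha> \<longleftrightarrow> x \<in> W \<and> \<alpha> \<bullet> x = 0"
  by (simp add: hyp_def)

lemma subspace_hyp: "subspace W \<Longrightarrow> subspace (hyp W \<alpha>)"
  unfolding hyp_def subspace_def by (auto simp: inner_right_distrib)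

lemma hyp_subset: "hyp W \<alpha> \<subseteq> W"
  by (auto simp: hyp_def)

lemma unit_vector_exists:
  assumes "subspace W" "x \<in> W" "\<alpha> \<bullet> x \<noteq> 0"
  obtains v where "v \<in> W" "\<alpha> \<bullet> v = 1"
  using assms by (intro that[of "(1 / (\<alpha> \<bullet> x)) *\<^sub>R x"]) (auto simp: subspace_scale)

lemma dim_hyp:
  assumes W: "subspace W" and x: "x \<in> W" "\<alpha> \<bullet> x \<noteq> 0"
  shows "dim (hyp W \<alpha>) + 1 = dim W"
proof -
  obtain v where v: "v \<in> W" "\<alpha> \<bullet> v = 1" using unit_vector_exists[OF W x] .
  have H: "subspace (hyp W \<alpha>)" by (rule subspace_hyp[OF W])
  have "v \<notin> span (hyp W \<alpha>)"
    using v by (simp add: span_eq_iff[THEN iffD2, OF H] mem_hyp)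
  then have "dim (insert v (hyp W \<alpha>)) = dim (hyp W \<alpha>) + 1"
    by (simp add: dim_insert)
  moreover have "span (insert v (hyp W \<alpha>)) = W"
  proof
    show "span (insert v (hyp W \<alpha>)) \<subseteq> W"
      by (rule span_minimal) (use v hyp_subset W in auto)
    show "W \<subseteq> span (insert v (hyp W \<alpha>))"
    proof
      fix y assume "y \<in> W"
      then have "y - (\<alpha> \<bullet> y) *\<^sub>R v \<in> hyp W \<alpha>"
        using v W by (simp add: mem_hyp subspace_diff subspace_scale inner_diff_right)
      then show "y \<in> span (insert v (hyp W \<alpha>))"
        by (metis span_base span_breakdown_eq)
    qed
  qed
  ultimately show ?thesis by (metis dim_span)
qed

lemma rpoly_inner: "rpoly (\<lambda>x. \<alpha> \<bullet> x)"
  by (intro rpoly_linear bounded_linear_inner_right)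

lemma rpoly_compose:
  "rpoly p \<Longrightarrow> polynomial_function X \<Longrightarrow> rpoly (\<lambda>x. p (X x))"
  using real_polynomial_function_compose[of X p] by (simp add: o_def)

lemma rpoly_inner_field:
  fixes X :: "'b::euclidean_space \<Rightarrow> 'a::euclidean_space"
  shows "polynomial_function X \<Longrightarrow> rpoly (\<lambda>x. \<alpha> \<bullet> X x)"
  using rpoly_compose[OF rpoly_inner[of \<alpha>], of X] .

lemma polynomial_function_scaleR: 
  "rpoly f \<Longrightarrow> polynomial_function X \<Longrightarrow> polynomial_function (\<lambda>x. f x *\<^sub>R X x)"
  using polynomial_function_mult real_polynomial_function_eq by blast

lemma polynomial_function_project: "polynomial_function (\<lambda>x::'a::euclidean_space. x - (\<alpha> \<bullet> x) *\<^sub>R v)"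
  by (intro polynomial_function_diff polynomial_function_scaleR rpoly_inner) auto

section \<open>Restriction to lines and division by linear forms\<close>

lemma rpoly_line:
  assumes "rpoly p"
  obtains a n where "\<And>t. p (x + t *\<^sub>R y) = (\<Sum>i\<le>n. a i * t ^ (i::nat))"
proof -
  have "polynomial_function (\<lambda>t::real. x + t *\<^sub>R y)"
    by (intro polynomial_function_add polynomial_function_mult) auto
  then have "rpoly (p \<circ> (\<lambda>t. x + t *\<^sub>R y))"
    using assms by (rule real_polynomial_function_compose)
  then obtain a n where "p \<circ> (\<lambda>t. x + t *\<^sub>R y) = (\<lambda>t. \<Sum>i\<le>n. a i * t ^ (i::nat))"
    using real_polynomial_function_imp_sum by blast
  then show ?thesis by (intro that[of a n]) (metis o_apply)
qed

lemma rpoly_finite_zeros_on_line: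
  assumes "rpoly p" "p (x + t0 *\<^sub>R y) \<noteq> 0"
  shows "finite {t. p (x + t *\<^sub>R y) = 0}"
proof -
  obtain a n where a: "\<And>t. p (x + t *\<^sub>R y) = (\<Sum>i\<le>n. a i * t ^ (i::nat))"
    using rpoly_line[OF assms(1)] by blast
  have "\<exists>k\<le>n. a k \<noteq> 0"
    using assms(2) a by (metis (no_types, lifting) atMost_iff mult_zero_left sum.neutral)
  then show ?thesis using polyfun_finite_roots[of a n] a by auto
qed

text \<open>The ring of polynomial functions on a subspace is a domain: restrict both factors to a line
  through two points where they do not vanish.\<close>

lemma rpoly_domain:
  assumes W: "subspace W" and f: "rpoly f" and g: "rpoly g"
    and z: "\<And>x. x \<in> W \<Longrightarrow> f x * g x = 0"
    and x0: "x0 \<in> W" "f x0 \<noteq> 0"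
    and y: "y \<in> W"
  shows "g y = 0"
proof (rule ccontr)
  assume g0: "g y \<noteq> 0"
  define w where "w = y - x0"
  have "finite {t. f (x0 + t *\<^sub>R w) = 0}"
    using rpoly_finite_zeros_on_line[OF f, of x0 0 w] x0 by simp
  moreover have "finite {t. g (x0 + t *\<^sub>R w) = 0}"
    using rpoly_finite_zeros_on_line[OF g, of x0 1 w] g0 by (simp add: w_def)
  moreover have "x0 + t *\<^sub>R w \<in> W" for t
    using W x0 y by (simp add: w_def subspace_add subspace_scale subspace_diff)
  then have "UNIV \<subseteq> {t. f (x0 + t *\<^sub>R w) = 0} \<union> {t. g (x0 + t *\<^sub>R w) = 0}"
    using z by fastforce
  ultimately have "finite (UNIV :: real set)"
    using finite_subset by blast
  then show False using infinite_UNIV_char_0 by blast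
qed

text \<open>Division by a linear form without choosing coordinates: for
  \<open>\<alpha> \<bullet> v = 1\<close> the map is the projection along \<open>v\<close> onto the
  kernel of \<alpha>, so a polynomial vanishing on that kernel is left with the second summand only.
  The quotient is assembled by induction on the polynomial.\<close>

lemma rpoly_diff_project:
  fixes p :: "'a::euclidean_space \<Rightarrow> real"
  assumes "rpoly p"
  shows "\<exists>q. rpoly q \<and> (\<forall>x. p x = p (x - (\<alpha> \<bullet> x) *\<^sub>R v) + (\<alpha> \<bullet> x) * q x)"
  using assms
proof (induction p)
  case (linear f)
  then interpret bounded_linear f .
  show ?case
    by (rule exI[of _ "\<lambda>x. f v"]) (auto simp: diff scale)
next
  case (const c)
  show ?case by (rule exI[of _ "\<lambda>x. 0"]) auto
next
  case (add f g)
  then obtain q r where q: "rpoly q" "rpoly r"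
    and e: "\<And>x. f x = f (x - (\<alpha> \<bullet> x) *\<^sub>R v) + (\<alpha> \<bullet> x) * q x"
    "\<And>x. g x = g (x - (\<alpha> \<bullet> x) *\<^sub>R v) + (\<alpha> \<bullet> x) * r x"
    by blast
  have "f x + g x = f (x - (\<alpha> \<bullet> x) *\<^sub>R v) + g (x - (\<alpha> \<bullet> x) *\<^sub>R v) + (\<alpha> \<bullet> x) * (q x + r x)" for x
    using e(1)[of x] e(2)[of x] by (simp only: distrib_left)
  then show ?case using q
    by (intro exI[of _ "\<lambda>x. q x + r x"] conjI rpoly_add allI)
next
  case (mult f g)
  then obtain q r where q: "rpoly q" "rpoly r"
    and e: "\<And>x. f x = f (x - (\<alpha> \<bullet> x) *\<^sub>R v) + (\<alpha> \<bullet> x) * q x"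
    "\<And>x. g x = g (x - (\<alpha> \<bullet> x) *\<^sub>R v) + (\<alpha> \<bullet> x) * r x"
    by blast
  have "rpoly (\<lambda>x. f (x - (\<alpha> \<bullet> x) *\<^sub>R v))"
    by (rule rpoly_compose[OF mult.hyps(1) polynomial_function_project])
  moreover have "f x * g x = f (x - (\<alpha> \<bullet> x) *\<^sub>R v) * g (x - (\<alpha> \<bullet> x) *\<^sub>R v)
      + (\<alpha> \<bullet> x) * (q x * g x + f (x - (\<alpha> \<bullet> x) *\<^sub>R v) * r x)" for x
  proof -
    define a b where "a = f (x - (\<alpha> \<bullet> x) *\<^sub>R v)" and "b = g (x - (\<alpha> \<bullet> x) *\<^sub>R v)"
    have "f x = a + (\<alpha> \<bullet> x) * q x" "g x = b + (\<alpha> \<bullet> x) * r x"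
      unfolding a_def b_def by (rule e)+
    then show ?thesis unfolding a_def[symmetric] b_def[symmetric] by (simp add: algebra_simps)
  qed
  ultimately show ?case using q mult.hyps
    by (intro exI[of _ "\<lambda>x. q x * g x + f (x - (\<alpha> \<bullet> x) *\<^sub>R v) * r x"] conjI allI
      rpoly_add rpoly_mult)
qed

lemma rpoly_divide_linear:
  fixes W :: "'a::euclidean_space set"
  assumes W: "subspace W" and p: "rpoly p" and x: "x \<in> W" "\<alpha> \<bullet> x \<noteq> 0"
    and z: "\<And>y. y \<in> hyp W \<alpha> \<Longrightarrow> p y = 0"
  obtains q where "rpoly q" "\<And>y. y \<in> W \<Longrightarrow> p y = (\<alpha> \<bullet> y) * q y"
proof -
  obtain v where v: "v \<in> W" "\<alpha> \<bullet> v = 1" using unit_vector_exists[OF W x] .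
  obtain q where q: "rpoly q" "\<And>y. p y = p (y - (\<alpha> \<bullet> y) *\<^sub>R v) + (\<alpha> \<bullet> y) * q y"
    using rpoly_diff_project[OF p, of \<alpha> v] by blast
  have "p (y - (\<alpha> \<bullet> y) *\<^sub>R v) = 0" if "y \<in> W" for y
    using z v W that by (simp add: mem_hyp subspace_diff subspace_scale inner_diff_right)
  then have "p y = (\<alpha> \<bullet> y) * q y" if "y \<in> W" for y
    using q(2)[of y] that by (simp only: add_0)
  then show ?thesis using q(1) that by blast
qed

text \<open>Non-proportionality of two forms is witnessed by a point in one kernel and outside the
  other. Correcting \<open>z\<close> by a multiple of \<open>x\<close>, which \<alpha> does not see,
  exchanges the two roles.\<close>

lemma nonprop_sym:
  assumes "subspace W" "x \<in> W" "\<alpha> \<bullet> x = 0" "\<beta> \<bullet> x \<noteq> 0" "z \<in> W" "\<alpha> \<bullet> z \<noteq> 0"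
  obtains y where "y \<in> W" "\<beta> \<bullet> y = 0" "\<alpha> \<bullet> y \<noteq> 0"
  using assms
  by (intro that[of "z - ((\<beta> \<bullet> z) / (\<beta> \<bullet> x)) *\<^sub>R x"])
    (auto simp: subspace_diff subspace_scale inner_diff_right)

lemma rpoly_prod_inner: "finite F \<Longrightarrow> rpoly (\<lambda>x. \<Prod>\<tau>\<in>F. (\<tau>::'a::euclidean_space) \<bullet> x)"
  by (intro real_polynomial_function_prod rpoly_inner)

lemma prod_inner_not_zero:
  fixes W :: "'a::euclidean_space set"
  assumes W: "subspace W" and F: "finite F" and nz: "\<And>\<tau>. \<tau> \<in> F \<Longrightarrow> \<exists>x\<in>W. \<tau> \<bullet> x \<noteq> 0"
  shows "\<exists>x\<in>W. (\<Prod>\<tau>\<in>F. \<tau> \<bullet> x) \<noteq> 0"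
  using F nz
proof (induction F)
  case empty
  then show ?case using W subspace_0 by auto
next
  case (insert \<tau> F)
  then obtain x where x: "x \<in> W" "(\<Prod>\<tau>\<in>F. \<tau> \<bullet> x) \<noteq> 0" by auto
  obtain y where y: "y \<in> W" "\<tau> \<bullet> y \<noteq> 0" using insert.prems by auto
  show ?case
  proof (rule ccontr)
    assume "\<not> ?thesis"
    then have "(\<Prod>\<tau>\<in>F. \<tau> \<bullet> z) * (\<tau> \<bullet> z) = 0" if "z \<in> W" for z
      using that insert.hyps by auto
    from rpoly_domain[OF W rpoly_prod_inner[OF insert.hyps(1)] rpoly_inner this x y(1)]
    show False using y by simp
  qed
qed

text \<open>Coprimality of \<open>h\<close> to a factor is expressed by a point of its kernel where
  \<open>h\<close> is nonzero. On the kernel of \<open>\<tau>\<close> the product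
  \<open>g * h\<close> vanishes, hence so does \<open>g\<close> by the domain property, and
  \<open>\<tau>\<close> splits off from \<open>g\<close>.\<close>

lemma prod_linear_dvd_cancel:
  assumes W: "subspace W" and F: "finite F" and g: "rpoly g" and h: "rpoly h" and q: "rpoly q"
    and nz: "\<And>\<tau>. \<tau> \<in> F \<Longrightarrow> \<exists>x\<in>W. \<tau> \<bullet> x \<noteq> 0"
    and nd: "\<And>\<tau>. \<tau> \<in> F \<Longrightarrow> \<exists>x\<in>hyp W \<tau>. h x \<noteq> 0"
    and eq: "\<And>x. x \<in> W \<Longrightarrow> g x * h x = (\<Prod>\<tau>\<in>F. \<tau> \<bullet> x) * q x"
  shows "\<exists>g'. rpoly g' \<and> (\<forall>x\<in>W. g x = (\<Prod>\<tau>\<in>F. \<tau> \<bullet> x) * g' x)"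
  using F nz nd g eq
proof (induction F arbitrary: g)
  case empty
  then show ?case by auto
next
  case (insert \<tau> F)
  obtain x0 where x0: "x0 \<in> hyp W \<tau>" "h x0 \<noteq> 0" using insert.prems by blast
  obtain z where z: "z \<in> W" "\<tau> \<bullet> z \<noteq> 0" using insert.prems(1)[of \<tau>] by auto
  have "g y = 0" if "y \<in> hyp W \<tau>" for y
  proof (rule rpoly_domain[OF subspace_hyp[OF W] h insert.prems(3) _ x0 that])
    fix x assume "x \<in> hyp W \<tau>"
    then show "h x * g x = 0"
      using insert.prems(4)[of x] insert.hyps by (auto simp: mem_hyp mult.commute)
  qed
  then obtain g1 where g1: "rpoly g1" "\<And>y. y \<in> W \<Longrightarrow> g y = (\<tau> \<bullet> y) * g1 y"
    using rpoly_divide_linear[OF W insert.prems(3) z] by blast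
  have "g1 x * h x - (\<Prod>\<tau>\<in>F. \<tau> \<bullet> x) * q x = 0" if "x \<in> W" for x
  proof (rule rpoly_domain[OF W rpoly_inner _ _ z that])
    show "rpoly (\<lambda>x. g1 x * h x - (\<Prod>\<tau>\<in>F. \<tau> \<bullet> x) * q x)"
      using g1 h q rpoly_prod_inner[OF insert.hyps(1)] by auto
    show "\<tau> \<bullet> x * (g1 x * h x - (\<Prod>\<tau>\<in>F. \<tau> \<bullet> x) * q x) = 0" if "x \<in> W" for x
      using insert.prems(4)[OF that] g1(2)[OF that] insert.hyps by (simp add: algebra_simps)
  qed
  then obtain g' where "rpoly g'" "\<forall>x\<in>W. g1 x = (\<Prod>\<tau>\<in>F. \<tau> \<bullet> x) * g' x"
    using insert.IH[of g1] insert.prems g1(1) by auto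
  then show ?case using g1(2) insert.hyps by (intro exI[of _ g']) auto
qed

text \<open>What remains after dividing by the earlier groups is still divisible by the next one, by
  \<open>prod_linear_dvd_cancel\<close>. Coprimality is asked only across different groups, since
  forms inside one group may be proportional.\<close>

lemma prod_groups_dvd:
  assumes W: "subspace W" and I: "finite I" and F: "\<And>i. i \<in> I \<Longrightarrow> finite (F i)" and f: "rpoly f"
    and nz: "\<And>i \<tau>. i \<in> I \<Longrightarrow> \<tau> \<in> F i \<Longrightarrow> \<exists>x\<in>W. \<tau> \<bullet> x \<noteq> 0"
    and np: "\<And>i j \<tau> \<sigma>. i \<in> I \<Longrightarrow> j \<in> I \<Longrightarrow> i \<noteq> j \<Longrightarrow> \<tau> \<in> F i \<Longrightarrow> \<sigma> \<in> F j \<Longrightarrow>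
      \<exists>x\<in>hyp W \<tau>. \<sigma> \<bullet> x \<noteq> 0"
    and dv: "\<And>i. i \<in> I \<Longrightarrow> \<exists>q. rpoly q \<and> (\<forall>x\<in>W. f x = (\<Prod>\<tau>\<in>F i. \<tau> \<bullet> x) * q x)"
  shows "\<exists>q. rpoly q \<and> (\<forall>x\<in>W. f x = (\<Prod>i\<in>I. \<Prod>\<tau>\<in>F i. \<tau> \<bullet> x) * q x)"
  using I F nz np dv
proof (induction I)
  case empty
  then show ?case using f by auto
next
  case (insert i I)
  have "\<exists>q. rpoly q \<and> (\<forall>x\<in>W. f x = (\<Prod>i\<in>I. \<Prod>\<tau>\<in>F i. \<tau> \<bullet> x) * q x)"
  proof (rule insert.IH)
    show "finite (F k)" if "k \<in> I" for k using insert.prems(1) that by simp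
    show "\<exists>x\<in>W. \<tau> \<bullet> x \<noteq> 0" if "k \<in> I" "\<tau> \<in> F k" for k \<tau>
      by (rule insert.prems(2)[of k]) (use that in auto)
    show "\<exists>x\<in>hyp W \<tau>. \<sigma> \<bullet> x \<noteq> 0"
      if "k \<in> I" "l \<in> I" "k \<noteq> l" "\<tau> \<in> F k" "\<sigma> \<in> F l" for k l \<tau> \<sigma>
      by (rule insert.prems(3)[of k l]) (use that in auto)
    show "\<exists>q. rpoly q \<and> (\<forall>x\<in>W. f x = (\<Prod>\<tau>\<in>F k. \<tau> \<bullet> x) * q x)" if "k \<in> I" for k
      by (rule insert.prems(4)) (use that in auto)
  qed
  then obtain q where q: "rpoly q" "\<And>x. x \<in> W \<Longrightarrow> f x = (\<Prod>i\<in>I. \<Prod>\<tau>\<in>F i. \<tau> \<bullet> x) * q x"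
    by blast
  obtain r where r: "rpoly r" "\<And>x. x \<in> W \<Longrightarrow> f x = (\<Prod>\<tau>\<in>F i. \<tau> \<bullet> x) * r x"
    using insert.prems(4)[of i] by blast
  have fin: "finite (Sigma I F)" using insert by auto
  define h where "h = (\<lambda>x. \<Prod>i\<in>I. \<Prod>\<tau>\<in>F i. \<tau> \<bullet> x)"
  have h: "h x = (\<Prod>p\<in>Sigma I F. snd p \<bullet> x)" for x
    unfolding h_def using insert by (subst prod.Sigma) (auto simp: case_prod_beta)
  have hp: "rpoly h" unfolding h_def using insert
    by (intro real_polynomial_function_prod rpoly_inner) auto
  have "\<exists>g'. rpoly g' \<and> (\<forall>x\<in>W. q x = (\<Prod>\<tau>\<in>F i. \<tau> \<bullet> x) * g' x)"
  proof (rule prod_linear_dvd_cancel[OF W _ q(1) hp r(1)])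
    show "finite (F i)" using insert by auto
    show "\<exists>x\<in>W. \<tau> \<bullet> x \<noteq> 0" if "\<tau> \<in> F i" for \<tau> using insert.prems(2) that by blast
    show "\<exists>x\<in>hyp W \<tau>. h x \<noteq> 0" if t: "\<tau> \<in> F i" for \<tau>
    proof -
      have "finite (snd ` Sigma I F)" using fin by auto
      then have "\<exists>x\<in>hyp W \<tau>. (\<Prod>\<sigma>\<in>snd ` Sigma I F. \<sigma> \<bullet> x) \<noteq> 0"
        by (rule prod_inner_not_zero[OF subspace_hyp[OF W]])
           (use insert.prems(3)[of i _ \<tau>] insert.hyps(2) t in force)
      then show ?thesis using fin unfolding h by (auto simp: prod_zero_iff)
    qed
    show "q x * h x = (\<Prod>\<tau>\<in>F i. \<tau> \<bullet> x) * r x" if "x \<in> W" for x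
      using q(2)[OF that] r(2)[OF that] by (simp add: h_def mult.commute)
  qed
  then obtain g' where "rpoly g'" "\<forall>x\<in>W. q x = (\<Prod>\<tau>\<in>F i. \<tau> \<bullet> x) * g' x" by blast
  then show ?case using q(2) insert.hyps by (intro exI[of _ g']) auto
qed

text \<open>Cancelling \<open>B\<close> leaves
  \<open>c ^ d * h (c *\<^sub>R x) = c ^ b * h x\<close>. For \<open>d \<le> b\<close> this is
  homogeneity of \<open>h\<close>; for \<open>d > b\<close>, letting \<open>c\<close> tend to 0
  forces \<open>h\<close> to vanish.\<close>

lemma rpoly_homogeneous_quotient:
  assumes W: "subspace W" and B: "rpoly B" and h: "rpoly h"
    and x0: "x0 \<in> W" "B x0 \<noteq> 0"
    and hB: "\<And>x c. x \<in> W \<Longrightarrow> B (c *\<^sub>R x) = c ^ d * B x"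
    and hf: "\<And>x c. x \<in> W \<Longrightarrow> B (c *\<^sub>R x) * h (c *\<^sub>R x) = c ^ b * (B x * h x)"
  shows "(d \<le> b \<and> (\<forall>x\<in>W. \<forall>c. h (c *\<^sub>R x) = c ^ (b - d) * h x)) \<or> (\<forall>x\<in>W. h x = 0)"
proof -
  have hpc: "rpoly (\<lambda>x. h (c *\<^sub>R x))" for c
    by (rule rpoly_compose[OF h]) (intro polynomial_function_cmul; simp)
  have e: "c ^ d * h (c *\<^sub>R x) - c ^ b * h x = 0" if "x \<in> W" for x c
  proof (rule rpoly_domain[OF W B _ _ x0 that])
    show "rpoly (\<lambda>x. c ^ d * h (c *\<^sub>R x) - c ^ b * h x)"
      using hpc h by (intro real_polynomial_function_diff rpoly_mult) auto
    show "B x * (c ^ d * h (c *\<^sub>R x) - c ^ b * h x) = 0" if "x \<in> W" for x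
      using hf[OF that, of c] hB[OF that, of c] by (simp add: algebra_simps)
  qed
  \<comment> \<open>Dividing by powers of \<open>c\<close> is possible only for nonzero
    \<open>c\<close>; the value at \<open>c = 0\<close> is reached as a limit.\<close>
  have lim: "((\<lambda>c. h (c *\<^sub>R x)) \<longlongrightarrow> h 0) (at 0)" for x
  proof -
    have "continuous_on UNIV h"
      using h by (simp add: continuous_on_polymonial_function real_polynomial_function_eq)
    then have "isCont h 0" by (simp add: continuous_on_eq_continuous_at)
    moreover have "((\<lambda>c. c *\<^sub>R x) \<longlongrightarrow> 0 *\<^sub>R x) (at (0::real))"
      by (intro tendsto_intros)
    ultimately show ?thesis using isCont_tendsto_compose[of 0 h] by simp
  qed
  show ?thesis
  proof (cases "d \<le> b")
    case True
    have s: "h (c *\<^sub>R x) = c ^ (b - d) * h x" if "x \<in> W" "c \<noteq> 0" for x c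
      using e[OF that(1), of c] that(2) True by (simp add: power_diff field_simps)
    have "h (0 *\<^sub>R x) = 0 ^ (b - d) * h x" if "x \<in> W" for x
    proof -
      have "((\<lambda>c. c ^ (b - d) * h x) \<longlongrightarrow> 0 ^ (b - d) * h x) (at 0)"
        by (intro tendsto_intros)
      moreover have "\<forall>\<^sub>F c in at 0. c ^ (b - d) * h x = h (c *\<^sub>R x)"
        using s[OF that] by (auto simp: eventually_at_filter)
      ultimately have "((\<lambda>c. h (c *\<^sub>R x)) \<longlongrightarrow> 0 ^ (b - d) * h x) (at 0)"
        using tendsto_cong by fast
      then show ?thesis using tendsto_unique[OF _ lim] by fastforce
    qed
    then have "\<forall>x\<in>W. \<forall>c. h (c *\<^sub>R x) = c ^ (b - d) * h x"
      using s by metis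
    then show ?thesis using True by blast
  next
    case False
    have s: "h x = c ^ (d - b) * h (c *\<^sub>R x)" if "x \<in> W" "c \<noteq> 0" for x c
      using e[OF that(1), of c] that(2) False by (simp add: power_diff field_simps)
    have "h x = 0" if "x \<in> W" for x
    proof -
      have "((\<lambda>c. c ^ (d - b) * h (c *\<^sub>R x)) \<longlongrightarrow> 0 ^ (d - b) * h 0) (at 0)"
        by (intro tendsto_intros lim)
      moreover have "\<forall>\<^sub>F c in at 0. c ^ (d - b) * h (c *\<^sub>R x) = h x"
        using s[OF that] by (auto simp: eventually_at_filter)
      ultimately have "((\<lambda>c. h x) \<longlongrightarrow> 0 ^ (d - b) * h 0) (at (0::real))"
        using tendsto_cong by fast
      then have "h x = 0 ^ (d - b) * h 0" by (simp add: tendsto_const_iff)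
      then show ?thesis using False by (simp add: power_0_left)
    qed
    then show ?thesis by blast
  qed
qed

section \<open>Vector fields tangent to an arrangement\<close>

definition tangent :: "'a::euclidean_space set \<Rightarrow> 'a set set \<Rightarrow> ('a \<Rightarrow> 'a) set" where
  "tangent W A = {X. polynomial_function X \<and> (\<forall>U\<in>insert W A. \<forall>x\<in>U. X x \<in> U)}"

text \<open>Fields and coefficients are polynomial on the whole space but are compared on
  \<open>W\<close> only, in accordance with the ring of polynomial functions on
  \<open>W\<close>.\<close>

definition vf_free :: "'a::euclidean_space set \<Rightarrow> 'a set set \<Rightarrow> nat multiset \<Rightarrow> bool" where
  "vf_free W A E \<longleftrightarrow> (\<exists>(m::nat) X d. E = image_mset d (mset_set {..<m}) \<and>
     (\<forall>k<m. X k \<in> tangent W A) \<and>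
     (\<forall>k<m. \<forall>x\<in>W. \<forall>c. X k (c *\<^sub>R x) = c ^ d k *\<^sub>R X k x) \<and>
     (\<forall>Y\<in>tangent W A. \<exists>c. (\<forall>k<m. rpoly (c k)) \<and> (\<forall>x\<in>W. Y x = (\<Sum>k<m. c k x *\<^sub>R X k x))) \<and>
     (\<forall>c. (\<forall>k<m. rpoly (c k)) \<longrightarrow> (\<forall>x\<in>W. (\<Sum>k<m. c k x *\<^sub>R X k x) = 0) \<longrightarrow>
        (\<forall>k<m. \<forall>x\<in>W. c k x = 0)))"

lemma tangentI:
  assumes "polynomial_function X" "\<And>x. x \<in> W \<Longrightarrow> X x \<in> W"
    "\<And>H x. H \<in> A \<Longrightarrow> x \<in> H \<Longrightarrow> X x \<in> H"
  shows "X \<in> tangent W A"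
  using assms by (auto simp: tangent_def)

lemma tangentD:
  assumes "X \<in> tangent W A"
  shows "polynomial_function X" "x \<in> W \<Longrightarrow> X x \<in> W" "H \<in> A \<Longrightarrow> x \<in> H \<Longrightarrow> X x \<in> H"
  using assms by (auto simp: tangent_def)

lemma vf_free_empty:
  assumes W: "subspace W"
  shows "vf_free W {} (replicate_mset (dim W) 0)"
proof -
  obtain B where B: "B \<subseteq> W" "pairwise orthogonal B" "\<And>x. x \<in> B \<Longrightarrow> norm x = 1"
    "independent B" "card B = dim W" "span B = W"
    using orthonormal_basis_subspace[OF W] by metis
  have fin: "finite B" using B(4) by (rule independent_imp_finite)
  obtain b where b: "bij_betw b {..<dim W} B"
    using fin B(5) ex_bij_betw_nat_finite[OF fin] by (metis atLeast0LessThan)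
  have bB: "b k \<in> B" if "k < dim W" for k using b that by (auto simp: bij_betw_def)
  have orth: "b k \<bullet> b l = (if k = l then 1 else 0)" if "k < dim W" "l < dim W" for k l
  proof (cases "k = l")
    case True
    then show ?thesis using B(3)[OF bB[OF that(1)]] by (simp add: norm_eq_1)
  next
    case False
    then have "b k \<noteq> b l" using b that by (auto simp: bij_betw_def inj_on_def)
    then show ?thesis using B(2) bB that False by (auto simp: pairwise_def orthogonal_def)
  qed
  have expand: "y = (\<Sum>k<dim W. (b k \<bullet> y) *\<^sub>R b k)" if "y \<in> W" for y
  proof -
    have "y = (\<Sum>v\<in>B. (v \<bullet> y) *\<^sub>R v)"
    proof (rule vector_eq_dot_span[of _ B])
      show "y \<in> span B" using that B by simp
      show "(\<Sum>v\<in>B. (v \<bullet> y) *\<^sub>R v) \<in> span B" by (intro span_sum span_scale span_base)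
      fix i assume i: "i \<in> B"
      have "i \<bullet> (\<Sum>v\<in>B. (v \<bullet> y) *\<^sub>R v) = (\<Sum>v\<in>B. if v = i then i \<bullet> y else 0)"
        unfolding inner_sum_right
      proof (rule sum.cong[OF refl])
        fix v assume v: "v \<in> B"
        show "i \<bullet> ((v \<bullet> y) *\<^sub>R v) = (if v = i then i \<bullet> y else 0)"
          using B(2) B(3)[OF i] i v by (auto simp: pairwise_def orthogonal_def norm_eq_1)
      qed
      then show "i \<bullet> y = i \<bullet> (\<Sum>v\<in>B. (v \<bullet> y) *\<^sub>R v)" using i fin by simp
    qed
    also have "\<dots> = (\<Sum>k<dim W. (b k \<bullet> y) *\<^sub>R b k)"
      using sum.reindex_bij_betw[OF b, of "\<lambda>v. (v \<bullet> y) *\<^sub>R v"] by simp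
    finally show ?thesis .
  qed
  show ?thesis unfolding vf_free_def
  proof (intro exI[of _ "dim W"] exI[of _ "\<lambda>k x. b k"] exI[of _ "\<lambda>k. 0"] conjI allI impI ballI)
    show "replicate_mset (dim W) 0 = image_mset (\<lambda>k. 0::nat) (mset_set {..<dim W})"
      by (simp add: image_mset_const_eq)
    show "(\<lambda>x. b k) \<in> tangent W {}" if "k < dim W" for k
      using that bB B(1) by (intro tangentI) auto
    show "b k = c ^ 0 *\<^sub>R b k" for k and c :: real by simp
    show "\<exists>c. (\<forall>k<dim W. rpoly (c k)) \<and> (\<forall>x\<in>W. Y x = (\<Sum>k<dim W. c k x *\<^sub>R b k))"
      if Y: "Y \<in> tangent W {}" for Y
      by (rule exI[of _ "\<lambda>k x. b k \<bullet> Y x"])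
        (use expand tangentD[OF Y] rpoly_inner_field in blast)
    show "c k x = 0" if s: "\<forall>x\<in>W. (\<Sum>k<dim W. c k x *\<^sub>R b k) = 0" and k: "k < dim W" "x \<in> W" for c k x
    proof -
      have "0 = b k \<bullet> (\<Sum>k<dim W. c k x *\<^sub>R b k)" using s k by simp
      also have "\<dots> = (\<Sum>l<dim W. if l = k then c k x else 0)"
        unfolding inner_sum_right using k by (intro sum.cong) (auto simp: orth)
      finally show ?thesis using k by simp
    qed
  qed
qed

text \<open>If some basis field \<open>X j\<close> has \<open>\<alpha> \<bullet> X j\<close> equal to a nonzero multiple of
  \<open>B\<close> on the new hyperplane, the other basis fields can be corrected by multiples of \<open>X j\<close>, and
  \<open>X j\<close> itself gets multiplied by \<open>\<alpha>\<close>. The field \<open>\<psi>\<close> guarantees that \<open>j\<close> exists.\<close>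

lemma vf_addition:
  fixes W :: "'a::euclidean_space set"
  assumes W: "subspace W" and A: "\<And>K. K \<in> A \<Longrightarrow> subspace K"
    and z: "z \<in> W" "\<alpha> \<bullet> z \<noteq> 0"
    and free: "vf_free W A (add_mset d F)"
    and B: "rpoly B" and x0: "x0 \<in> hyp W \<alpha>" "B x0 \<noteq> 0"
    and Bhom: "\<And>x c. x \<in> hyp W \<alpha> \<Longrightarrow> B (c *\<^sub>R x) = c ^ d * B x"
    and dvd: "\<And>X. X \<in> tangent W A \<Longrightarrow> \<exists>h. rpoly h \<and> (\<forall>x\<in>hyp W \<alpha>. \<alpha> \<bullet> X x = B x * h x)"
    and \<psi>: "\<psi> \<in> tangent W A" "\<And>x. x \<in> hyp W \<alpha> \<Longrightarrow> \<alpha> \<bullet> \<psi> x = \<kappa> * B x" "\<kappa> \<noteq> 0"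
  shows "vf_free W (insert (hyp W \<alpha>) A) (add_mset (Suc d) F)"
proof -
  define H where "H = hyp W \<alpha>"
  have H: "subspace H" "H \<subseteq> W" unfolding H_def by (rule subspace_hyp[OF W] hyp_subset)+
  have H0: "0 \<in> H" using H subspace_0 by blast
  obtain m :: nat and X and ds where E: "add_mset d F = image_mset ds (mset_set {..<m})"
    and "\<forall>k<m. X k \<in> tangent W A"
    and "\<forall>k<m. \<forall>x\<in>W. \<forall>c. X k (c *\<^sub>R x) = c ^ ds k *\<^sub>R X k x"
    and "\<forall>Y\<in>tangent W A. \<exists>c. (\<forall>k<m. rpoly (c k)) \<and> (\<forall>x\<in>W. Y x = (\<Sum>k<m. c k x *\<^sub>R X k x))"
    and "\<forall>c. (\<forall>k<m. rpoly (c k)) \<longrightarrow> (\<forall>x\<in>W. (\<Sum>k<m. c k x *\<^sub>R X k x) = 0) \<longrightarrow>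
        (\<forall>k<m. \<forall>x\<in>W. c k x = 0)"
    using free unfolding vf_free_def by (elim exE conjE) (rule that)
  then have X: "\<And>k. k < m \<Longrightarrow> X k \<in> tangent W A"
    and Xhom: "\<And>k x c. k < m \<Longrightarrow> x \<in> W \<Longrightarrow> X k (c *\<^sub>R x) = c ^ ds k *\<^sub>R X k x"
    and gen: "\<And>Y. Y \<in> tangent W A \<Longrightarrow>
      \<exists>c. (\<forall>k<m. rpoly (c k)) \<and> (\<forall>x\<in>W. Y x = (\<Sum>k<m. c k x *\<^sub>R X k x))"
    and ind: "\<And>c k x. (\<And>k. k < m \<Longrightarrow> rpoly (c k)) \<Longrightarrow>
      (\<And>x. x \<in> W \<Longrightarrow> (\<Sum>k<m. c k x *\<^sub>R X k x) = 0) \<Longrightarrow> k < m \<Longrightarrow> x \<in> W \<Longrightarrow> c k x = 0"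
    by blast+
  have "\<forall>k\<in>{..<m}. \<exists>h. rpoly h \<and> (\<forall>x\<in>H. \<alpha> \<bullet> X k x = B x * h x)"
    using dvd X unfolding H_def by auto
  then obtain h where h: "\<And>k. k < m \<Longrightarrow> rpoly (h k)"
    "\<And>k x. k < m \<Longrightarrow> x \<in> H \<Longrightarrow> \<alpha> \<bullet> X k x = B x * h k x"
    by (metis lessThan_iff)
  obtain c where c: "\<And>k. k < m \<Longrightarrow> rpoly (c k)" "\<And>x. x \<in> W \<Longrightarrow> \<psi> x = (\<Sum>k<m. c k x *\<^sub>R X k x)"
    using gen[OF \<psi>(1)] by blast
  \<comment> \<open>Expanding \<open>\<psi>\<close> in the basis and cancelling \<open>B\<close>
    gives \<open>(\<Sum>k<m. c k x * h k x) = \<kappa>\<close> on \<open>H\<close>. Evaluated at the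
    origin, this leaves some \<open>h j\<close> with a nonzero constant term.\<close>
  have "(\<Sum>k<m. c k 0 * h k 0) - \<kappa> = 0"
  proof (rule rpoly_domain[OF H(1) B _ _ _ x0(2) H0])
    show "rpoly (\<lambda>x. (\<Sum>k<m. c k x * h k x) - \<kappa>)"
      using c(1) h(1) by (intro real_polynomial_function_diff real_polynomial_function_sum rpoly_mult rpoly_const) auto
    show "B x * ((\<Sum>k<m. c k x * h k x) - \<kappa>) = 0" if "x \<in> H" for x
    proof -
      have "\<kappa> * B x = \<alpha> \<bullet> (\<Sum>k<m. c k x *\<^sub>R X k x)"
        using \<psi>(2)[of x] c(2)[of x] H that by (auto simp: H_def)
      also have "\<dots> = (\<Sum>k<m. B x * (c k x * h k x))"
        unfolding inner_sum_right using h(2) that by (intro sum.cong) auto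
      finally show ?thesis by (simp add: right_diff_distrib sum_distrib_left mult.commute)
    qed
  qed (use x0 in \<open>simp add: H_def\<close>)
  then have "(\<Sum>k<m. c k 0 * h k 0) \<noteq> 0" using \<psi>(3) by auto
  then obtain j where j: "j < m" "h j 0 \<noteq> 0"
    by (metis (no_types, lifting) lessThan_iff mult_zero_right sum.neutral)
  have quot: "(d \<le> ds k \<and> (\<forall>x\<in>H. \<forall>c. h k (c *\<^sub>R x) = c ^ (ds k - d) * h k x)) \<or> (\<forall>x\<in>H. h k x = 0)"
    if k: "k < m" for k
  proof (rule rpoly_homogeneous_quotient[OF H(1) B h(1)[OF k]])
    show "x0 \<in> H" "B x0 \<noteq> 0" using x0 by (auto simp: H_def)
    show "B (c *\<^sub>R x) = c ^ d * B x" if "x \<in> H" for x c using Bhom that by (auto simp: H_def)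
    fix x c assume x: "x \<in> H"
    have "B (c *\<^sub>R x) * h k (c *\<^sub>R x) = \<alpha> \<bullet> X k (c *\<^sub>R x)"
      using h(2)[OF k, of "c *\<^sub>R x"] x H by (simp add: subspace_scale)
    also have "\<dots> = c ^ ds k * (\<alpha> \<bullet> X k x)" using Xhom[OF k] x H by auto
    also have "\<dots> = c ^ ds k * (B x * h k x)" using h(2)[OF k x] by simp
    finally show "B (c *\<^sub>R x) * h k (c *\<^sub>R x) = c ^ ds k * (B x * h k x)" .
  qed
  define \<eta> where "\<eta> = h j 0"
  \<comment> \<open>A homogeneous function that does not vanish at the origin is constant, so
    \<open>X j\<close> has exactly the degree of \<open>B\<close>.\<close>
  have jd: "ds j = d" and hj: "\<And>x. x \<in> H \<Longrightarrow> h j x = \<eta>"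
  proof -
    have q: "d \<le> ds j" "\<And>x c. x \<in> H \<Longrightarrow> h j (c *\<^sub>R x) = c ^ (ds j - d) * h j x"
      using quot[OF j(1)] j(2) H0 by blast+
    have "h j 0 = 0 ^ (ds j - d) * h j 0" using q(2)[OF H0, of 0] by simp
    then have "(0::real) ^ (ds j - d) = 1" using j(2) by simp
    then show e: "ds j = d" using q(1) by (cases "ds j - d") auto
    show "h j x = \<eta>" if "x \<in> H" for x using q(2)[OF that, of 0] e by (simp add: \<eta>_def)
  qed
  have \<eta>: "\<eta> \<noteq> 0" using j by (simp add: \<eta>_def)
  obtain v where v: "v \<in> W" "\<alpha> \<bullet> v = 1" using unit_vector_exists[OF W z] .
  define \<pi> where "\<pi> = (\<lambda>x. x - (\<alpha> \<bullet> x) *\<^sub>R v)"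
  have \<pi>H: "\<pi> x \<in> H" if "x \<in> W" for x
    using v W that by (simp add: \<pi>_def H_def mem_hyp subspace_diff subspace_scale inner_diff_right)
  have \<pi>id: "\<pi> x = x" if "x \<in> H" for x using that by (simp add: \<pi>_def H_def mem_hyp)
  have \<pi>s: "\<pi> (c *\<^sub>R x) = c *\<^sub>R \<pi> x" for c x by (simp add: \<pi>_def scaleR_diff_right)
  \<comment> \<open>The function \<open>h k\<close> is known to be homogeneous on \<open>H\<close>
    only. Composition with the projection \<open>\<pi>\<close> makes the correction coefficient
    homogeneous on all of \<open>W\<close>.\<close>
  define g where "g = (\<lambda>k x. h k (\<pi> x) / \<eta>)"
  have g: "rpoly (g k)" if "k < m" for k
    unfolding g_def \<pi>_def
    by (intro real_polynomial_function_divide rpoly_compose[OF h(1)[OF that] polynomial_function_project])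
  define X' where "X' = (\<lambda>k x. if k = j then (\<alpha> \<bullet> x) *\<^sub>R X j x else X k x - g k x *\<^sub>R X j x)"
  define ds' where "ds' = ds(j := Suc d)"
  have sum_j: "(\<Sum>k<m. f k) = f j + (\<Sum>k\<in>{..<m}-{j}. f k)" for f :: "nat \<Rightarrow> 'a"
    using j by (simp add: sum.remove)
  have Xt: "X k x \<in> U" if "k < m" "U \<in> insert W A" "x \<in> U" for k x U
    using X[OF that(1)] that by (auto simp: tangent_def)
  have polX: "polynomial_function (X' k)" if "k < m" for k
  proof (cases "k = j")
    case True
    then show ?thesis unfolding X'_def
      using tangentD(1)[OF X[OF j(1)]] by (simp add: polynomial_function_scaleR rpoly_inner)
  next
    case False
    then show ?thesis unfolding X'_def
      using tangentD(1)[OF X[OF j(1)]] tangentD(1)[OF X[OF that]] g[OF that]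
      by (simp add: polynomial_function_scaleR polynomial_function_diff)
  qed
  have X't: "X' k \<in> tangent W (insert H A)" if k: "k < m" for k
  proof (rule tangentI[OF polX[OF k]])
    have U: "X' k x \<in> U" if "U \<in> insert W A" "x \<in> U" for U x
    proof -
      have "subspace U" using A W that by auto
      then show ?thesis
        using Xt[OF k that] Xt[OF j(1) that] by (simp add: X'_def subspace_diff subspace_scale)
    qed
    then show XW: "X' k x \<in> W" if "x \<in> W" for x using that by simp
    have "X' k x \<in> H" if x: "x \<in> H" for x
    proof -
      have "\<alpha> \<bullet> X' k x = 0"
        using h(2)[OF k x] h(2)[OF j(1) x] hj[OF x] \<eta> \<pi>id[OF x] x
        by (simp add: X'_def g_def inner_diff_right H_def mem_hyp)
      then show ?thesis using XW x H by (auto simp: H_def mem_hyp)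
    qed
    then show "X' k x \<in> K" if "K \<in> insert H A" "x \<in> K" for K x
      using U that by blast
  qed
  have X'hom: "X' k (c *\<^sub>R x) = c ^ ds' k *\<^sub>R X' k x" if k: "k < m" and x: "x \<in> W" for k x c
  proof (cases "k = j")
    case True
    then show ?thesis using Xhom[OF j(1) x] by (simp add: X'_def ds'_def jd)
  next
    case False
    have "g k (c *\<^sub>R x) *\<^sub>R X j (c *\<^sub>R x) = c ^ ds k *\<^sub>R (g k x *\<^sub>R X j x)"
      using quot[OF k]
    proof
      assume "d \<le> ds k \<and> (\<forall>x\<in>H. \<forall>c. h k (c *\<^sub>R x) = c ^ (ds k - d) * h k x)"
      then have "g k (c *\<^sub>R x) = c ^ (ds k - d) * g k x" "d \<le> ds k"
        using \<pi>H[OF x] by (auto simp: g_def \<pi>s)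
      then show ?thesis
        using Xhom[OF j(1) x, of c] by (simp add: jd mult.commute flip: power_add)
    next
      assume "\<forall>x\<in>H. h k x = 0"
      then show ?thesis using \<pi>H[OF x] \<pi>H[of "c *\<^sub>R x"] x W by (simp add: g_def subspace_scale)
    qed
    then show ?thesis using False Xhom[OF k x, of c] by (simp add: X'_def ds'_def scaleR_diff_right)
  qed
  have X'gen: "\<exists>c'. (\<forall>k<m. rpoly (c' k)) \<and> (\<forall>x\<in>W. Y x = (\<Sum>k<m. c' k x *\<^sub>R X' k x))"
    if Y: "Y \<in> tangent W (insert H A)" for Y
  proof -
    have "Y \<in> tangent W A" using Y by (auto simp: tangent_def)
    then obtain c where c: "\<And>k. k < m \<Longrightarrow> rpoly (c k)" "\<And>x. x \<in> W \<Longrightarrow> Y x = (\<Sum>k<m. c k x *\<^sub>R X k x)"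
      using gen by blast
    \<comment> \<open>This is the coefficient of \<open>X j\<close> once the other fields are
      replaced by the corrected ones. Tangency of \<open>Y\<close> to \<open>H\<close> makes it
      vanish there, so \<alpha> divides it.\<close>
    define p where "p = (\<lambda>x. c j x + (\<Sum>k\<in>{..<m}-{j}. c k x * g k x))"
    have p: "rpoly p" unfolding p_def using c(1) g j(1)
      by (intro rpoly_add real_polynomial_function_sum rpoly_mult) auto
    have Yp: "Y x = p x *\<^sub>R X j x + (\<Sum>k\<in>{..<m}-{j}. c k x *\<^sub>R X' k x)" if "x \<in> W" for x
    proof -
      have "(\<Sum>k\<in>{..<m}-{j}. c k x *\<^sub>R X' k x) =
          (\<Sum>k\<in>{..<m}-{j}. c k x *\<^sub>R X k x) - (\<Sum>k\<in>{..<m}-{j}. (c k x * g k x) *\<^sub>R X j x)"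
        by (simp add: X'_def scaleR_diff_right flip: sum_subtractf)
      then show ?thesis using c(2)[OF that]
        by (simp add: sum_j p_def scaleR_add_left scaleR_sum_left)
    qed
    have "p x = 0" if "x \<in> H" for x
    proof (rule rpoly_domain[OF H(1) B p _ _ x0(2) that])
      show "B x * p x = 0" if x: "x \<in> H" for x
      proof -
        have xW: "x \<in> W" using x H by auto
        have "0 = \<alpha> \<bullet> Y x" using tangentD(3)[OF Y _ x] by (auto simp: H_def mem_hyp)
        also have "\<dots> = p x * (\<alpha> \<bullet> X j x) + (\<Sum>k\<in>{..<m}-{j}. c k x * (\<alpha> \<bullet> X' k x))"
          by (simp add: Yp[OF xW] inner_add_right inner_sum_right)
        also have "(\<Sum>k\<in>{..<m}-{j}. c k x * (\<alpha> \<bullet> X' k x)) = 0"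
        proof (rule sum.neutral, rule ballI)
          fix k assume "k \<in> {..<m} - {j}"
          then have "X' k x \<in> H" using tangentD(3)[OF X't[of k] _ x] by auto
          then show "c k x * (\<alpha> \<bullet> X' k x) = 0" by (simp add: H_def mem_hyp)
        qed
        finally show ?thesis using h(2)[OF j(1) x] hj[OF x] \<eta> by auto
      qed
    qed (use x0 in \<open>simp add: H_def\<close>)
    then obtain q where q: "rpoly q" "\<And>x. x \<in> W \<Longrightarrow> p x = (\<alpha> \<bullet> x) * q x"
      using rpoly_divide_linear[OF W p z] unfolding H_def by blast
    show ?thesis
    proof (intro exI[of _ "c(j := q)"] conjI allI impI ballI)
      show "rpoly ((c(j := q)) k)" if "k < m" for k using c(1) q(1) that by auto
      fix x assume "x \<in> W"
      then show "Y x = (\<Sum>k<m. (c(j := q)) k x *\<^sub>R X' k x)"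
        using Yp q(2) by (simp add: sum_j X'_def mult.commute)
    qed
  qed
  have X'ind: "c k x = 0" if c: "\<And>k. k < m \<Longrightarrow> rpoly (c k)"
    and s: "\<And>x. x \<in> W \<Longrightarrow> (\<Sum>k<m. c k x *\<^sub>R X' k x) = 0" and k: "k < m" and x: "x \<in> W" for c k x
  proof -
    \<comment> \<open>Rewritten in the old basis, the relation has \<open>p\<close> as coefficient
      of \<open>X j\<close> and the other coefficients unchanged.\<close>
    define p where "p = (\<lambda>x. c j x * (\<alpha> \<bullet> x) - (\<Sum>k\<in>{..<m}-{j}. c k x * g k x))"
    have p: "rpoly p" unfolding p_def using c(1) g j(1)
      by (intro real_polynomial_function_diff real_polynomial_function_sum rpoly_mult rpoly_inner) auto
    have z0: "(c(j := p)) k x = 0" if "k < m" "x \<in> W" for k x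
    proof (rule ind[OF _ _ that])
      show "rpoly ((c(j := p)) k)" if "k < m" for k using c p that by auto
      fix x assume x: "x \<in> W"
      have "(\<Sum>k\<in>{..<m}-{j}. c k x *\<^sub>R X' k x) =
          (\<Sum>k\<in>{..<m}-{j}. c k x *\<^sub>R X k x) - (\<Sum>k\<in>{..<m}-{j}. (c k x * g k x) *\<^sub>R X j x)"
        by (simp add: X'_def scaleR_diff_right flip: sum_subtractf)
      note rest = this
      have X'j: "X' j x = (\<alpha> \<bullet> x) *\<^sub>R X j x" by (simp add: X'_def)
      have pj: "p x *\<^sub>R X j x = c j x *\<^sub>R X' j x - (\<Sum>k\<in>{..<m}-{j}. (c k x * g k x) *\<^sub>R X j x)"
        by (simp add: p_def X'j scaleR_diff_left scaleR_sum_left)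
      have "(\<Sum>k<m. (c(j := p)) k x *\<^sub>R X k x) = p x *\<^sub>R X j x + (\<Sum>k\<in>{..<m}-{j}. c k x *\<^sub>R X k x)"
        by (simp add: sum_j)
      also have "\<dots> = c j x *\<^sub>R X' j x + (\<Sum>k\<in>{..<m}-{j}. c k x *\<^sub>R X' k x)"
        unfolding pj rest by simp
      also have "\<dots> = 0" using s[OF x] by (simp only: sum_j)
      finally show "(\<Sum>k<m. (c(j := p)) k x *\<^sub>R X k x) = 0" .
    qed
    show ?thesis
    proof (cases "k = j")
      case True
      have "c j x = 0"
      proof (rule rpoly_domain[OF W rpoly_inner c[OF j(1)] _ z x])
        fix y assume y: "y \<in> W"
        have "c k y = 0" if "k < m" "k \<noteq> j" for k using z0[OF that(1) y] that(2) by simp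
        then have "(\<Sum>k\<in>{..<m}-{j}. c k y * g k y) = 0"
          by (intro sum.neutral) auto
        then show "(\<alpha> \<bullet> y) * c j y = 0" using z0[OF j(1) y] by (simp add: p_def mult.commute)
      qed
      then show ?thesis using True by simp
    qed (use z0[OF k x] in simp)
  qed
  have "image_mset ds (mset_set {..<m}) = add_mset (ds j) (image_mset ds (mset_set ({..<m}-{j})))"
    using j by (simp add: mset_set.remove)
  then have F: "F = image_mset ds (mset_set ({..<m}-{j}))" using E jd by simp
  have "image_mset ds' (mset_set {..<m}) = add_mset (ds' j) (image_mset ds' (mset_set ({..<m}-{j})))"
    using j by (simp add: mset_set.remove)
  also have "image_mset ds' (mset_set ({..<m}-{j})) = F"
    unfolding F by (intro image_mset_cong) (auto simp: ds'_def)
  also have "ds' j = Suc d" by (simp add: ds'_def)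
  finally have E': "add_mset (Suc d) F = image_mset ds' (mset_set {..<m})" by (rule sym)
  show ?thesis
    unfolding vf_free_def H_def[symmetric]
    using E' X't X'hom X'gen X'ind by (intro exI[of _ m] exI[of _ X'] exI[of _ ds']) blast
qed

text \<open>With \<open>G = (\<rho> \<bullet> x) (\<alpha> \<bullet> X x) - (\<alpha> \<bullet> x) (\<rho> \<bullet> X x)\<close>, every form in the pencil of \<open>\<alpha>\<close> and \<open>\<rho>\<close> whose
  hyperplane is preserved by \<open>X\<close> divides \<open>G\<close>; then restrict to the kernel of \<open>\<alpha>\<close>.\<close>

lemma tangent_pencil_dvd:
  fixes W :: "'a::euclidean_space set"
  assumes W: "subspace W" and z: "z \<in> W" "\<alpha> \<bullet> z \<noteq> 0" and T: "finite T"
    and A: "\<And>\<tau>. \<tau> \<in> T \<Longrightarrow> hyp W \<tau> \<in> A" "\<And>\<tau>. \<tau> \<in> T \<Longrightarrow> hyp W (\<rho> \<tau>) \<in> A"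
    and rel: "\<And>\<tau>. \<tau> \<in> T \<Longrightarrow> \<tau> = a \<tau> *\<^sub>R \<alpha> + c \<tau> *\<^sub>R \<rho> \<tau>"
      "\<And>\<tau>. \<tau> \<in> T \<Longrightarrow> a \<tau> \<noteq> 0" "\<And>\<tau>. \<tau> \<in> T \<Longrightarrow> c \<tau> \<noteq> 0"
    and nz: "\<And>\<tau>. \<tau> \<in> T \<Longrightarrow> \<exists>x\<in>hyp W \<alpha>. \<rho> \<tau> \<bullet> x \<noteq> 0"
    and np1: "\<And>\<tau> \<sigma>. \<tau> \<in> T \<Longrightarrow> \<sigma> \<in> T \<Longrightarrow> \<tau> \<noteq> \<sigma> \<Longrightarrow> \<rho> \<tau> = \<rho> \<sigma> \<Longrightarrow> \<exists>x\<in>hyp W \<tau>. \<sigma> \<bullet> x \<noteq> 0"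
    and np2: "\<And>\<tau> \<sigma>. \<tau> \<in> T \<Longrightarrow> \<sigma> \<in> T \<Longrightarrow> \<rho> \<tau> \<noteq> \<rho> \<sigma> \<Longrightarrow> \<exists>x\<in>hyp W \<alpha>. \<rho> \<tau> \<bullet> x = 0 \<and> \<rho> \<sigma> \<bullet> x \<noteq> 0"
    and X: "X \<in> tangent W A"
  shows "\<exists>h. rpoly h \<and> (\<forall>x\<in>hyp W \<alpha>. \<alpha> \<bullet> X x = (\<Prod>\<tau>\<in>T. \<tau> \<bullet> x) * h x)"
proof -
  define H where "H = hyp W \<alpha>"
  have H: "subspace H" "H \<subseteq> W" unfolding H_def by (rule subspace_hyp[OF W] hyp_subset)+
  define F where "F = (\<lambda>\<sigma>. {\<tau> \<in> T. \<rho> \<tau> = \<sigma>})"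
  have finF: "finite (F \<sigma>)" for \<sigma> using T by (simp add: F_def)
  have polX: "polynomial_function X" using tangentD[OF X] by simp
  have rel': "\<tau> \<bullet> x = a \<tau> * (\<alpha> \<bullet> x) + c \<tau> * (\<rho> \<tau> \<bullet> x)" if "\<tau> \<in> T" for \<tau> x
    using arg_cong[OF rel(1)[OF that], of "\<lambda>u. u \<bullet> x"] by (simp add: inner_add_left)
  have polaX: "rpoly (\<lambda>x. \<alpha> \<bullet> X x)" by (rule rpoly_inner_field[OF polX])
  have group: "\<exists>q. rpoly q \<and> (\<forall>x\<in>H. \<alpha> \<bullet> X x = (\<Prod>\<tau>\<in>F \<sigma>. \<tau> \<bullet> x) * q x)" if \<sigma>: "\<sigma> \<in> \<rho> ` T" for \<sigma>
  proof -
    define G where "G = (\<lambda>x. (\<sigma> \<bullet> x) * (\<alpha> \<bullet> X x) - (\<alpha> \<bullet> x) * (\<sigma> \<bullet> X x))"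
    have G: "rpoly G" unfolding G_def
      by (intro real_polynomial_function_diff rpoly_mult rpoly_inner rpoly_inner_field[OF polX])
    obtain s where s: "s \<in> H" "\<sigma> \<bullet> s \<noteq> 0" using nz \<sigma> unfolding H_def by auto
    then have sW: "s \<in> W" "\<alpha> \<bullet> s = 0" by (auto simp: H_def mem_hyp)
    obtain y where y: "y \<in> W" "\<sigma> \<bullet> y = 0" "\<alpha> \<bullet> y \<noteq> 0"
      using nonprop_sym[OF W sW s(2) z] by metis
    have ty: "\<tau> \<bullet> y \<noteq> 0" if "\<tau> \<in> F \<sigma>" for \<tau>
      using that rel' rel(2) y by (auto simp: F_def)
    have "\<sigma> \<notin> F \<sigma>" using ty y(2) by blast
    \<comment> \<open>The form \<open>\<sigma>\<close> is included among the divisors because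
      \<open>G\<close> is \<open>\<sigma>\<close> times \<open>\<alpha> \<bullet> X x\<close> on
      \<open>H\<close>, where the forms in \<open>F \<sigma>\<close> are multiples of
      \<open>\<sigma>\<close> too. Without the extra factor, cancelling \<open>\<sigma>\<close>
      would lose one of them.\<close>
    have "\<exists>q. rpoly q \<and> (\<forall>x\<in>W. G x = (\<Prod>i\<in>insert \<sigma> (F \<sigma>). \<Prod>\<tau>\<in>{i}. \<tau> \<bullet> x) * q x)"
    proof (rule prod_groups_dvd[OF W _ _ G])
      show nzW: "\<exists>x\<in>W. \<tau> \<bullet> x \<noteq> 0" if "i \<in> insert \<sigma> (F \<sigma>)" "\<tau> \<in> {i}" for i \<tau>
        using that ty y s sW by auto
      show "\<exists>x\<in>hyp W \<tau>. \<tau>' \<bullet> x \<noteq> 0"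
        if i: "i \<in> insert \<sigma> (F \<sigma>)" "j \<in> insert \<sigma> (F \<sigma>)" "i \<noteq> j" "\<tau> \<in> {i}" "\<tau>' \<in> {j}" for i j \<tau> \<tau>'
      proof -
        consider "\<tau> \<in> F \<sigma>" "\<tau>' \<in> F \<sigma>" | "\<tau> = \<sigma>" "\<tau>' \<in> F \<sigma>" | "\<tau>' = \<sigma>" "\<tau> \<in> F \<sigma>" using i by blast
        then show ?thesis
        proof cases
          case 1
          then show ?thesis using np1[of \<tau> \<tau>'] i by (auto simp: F_def)
        next
          case 2
          then show ?thesis using y ty by (intro bexI[of _ y]) (auto simp: mem_hyp)
        next
          case 3
          then obtain w where "w \<in> W" "\<tau> \<bullet> w = 0" "\<sigma> \<bullet> w \<noteq> 0"
            using nonprop_sym[OF W y(1,2) ty sW(1) s(2)] by metis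
          then show ?thesis using 3 by (auto simp: mem_hyp)
        qed
      qed
      fix i assume i: "i \<in> insert \<sigma> (F \<sigma>)"
      have "G x = 0" if x: "x \<in> hyp W i" for x
      proof (cases "i = \<sigma>")
        case True
        then have "X x \<in> hyp W \<sigma>" using A(2) \<sigma> x tangentD(3)[OF X] by auto
        then show ?thesis using x True by (simp add: G_def mem_hyp)
      next
        case False
        then have i: "i \<in> T" "\<rho> i = \<sigma>" using i by (auto simp: F_def)
        then have "X x \<in> hyp W i" using A(1) x tangentD(3)[OF X] by auto
        then have e: "a i * (\<alpha> \<bullet> x) = - c i * (\<sigma> \<bullet> x)" "a i * (\<alpha> \<bullet> X x) = - c i * (\<sigma> \<bullet> X x)"
          using x rel'[OF i(1)] i(2) by (auto simp: mem_hyp)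
        have "a i * G x = (\<sigma> \<bullet> x) * (a i * (\<alpha> \<bullet> X x)) - (a i * (\<alpha> \<bullet> x)) * (\<sigma> \<bullet> X x)"
          by (simp add: G_def algebra_simps)
        also have "\<dots> = 0" unfolding e by simp
        finally show ?thesis using rel(2)[OF i(1)] by simp
      qed
      moreover obtain w where "w \<in> W" "i \<bullet> w \<noteq> 0" using nzW[OF i, of i] by auto
      ultimately obtain q where "rpoly q" "\<And>x. x \<in> W \<Longrightarrow> G x = (i \<bullet> x) * q x"
        using rpoly_divide_linear[OF W G] by blast
      then show "\<exists>q. rpoly q \<and> (\<forall>x\<in>W. G x = (\<Prod>\<tau>\<in>{i}. \<tau> \<bullet> x) * q x)" by auto
    qed (use finF in auto)
    then obtain q where q: "rpoly q" "\<And>x. x \<in> W \<Longrightarrow> G x = (\<sigma> \<bullet> x) * (\<Prod>\<tau>\<in>F \<sigma>. \<tau> \<bullet> x) * q x"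
      using finF \<open>\<sigma> \<notin> F \<sigma>\<close> by auto
    have "\<alpha> \<bullet> X x - (\<Prod>\<tau>\<in>F \<sigma>. \<tau> \<bullet> x) * q x = 0" if "x \<in> H" for x
    proof (rule rpoly_domain[OF H(1) rpoly_inner _ _ s that])
      show "rpoly (\<lambda>x. \<alpha> \<bullet> X x - (\<Prod>\<tau>\<in>F \<sigma>. \<tau> \<bullet> x) * q x)"
        by (intro real_polynomial_function_diff rpoly_mult polaX q(1) rpoly_prod_inner finF)
      show "(\<sigma> \<bullet> x) * (\<alpha> \<bullet> X x - (\<Prod>\<tau>\<in>F \<sigma>. \<tau> \<bullet> x) * q x) = 0" if "x \<in> H" for x
        using q(2)[of x] that by (simp add: G_def H_def mem_hyp algebra_simps)
    qed
    then show ?thesis using q(1) by (intro exI[of _ q]) auto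
  qed
  \<comment> \<open>On \<open>H\<close> the forms of one group become proportional, so they cannot
    be split off there one by one; this is why each group was treated on \<open>W\<close> first.
    Different groups stay coprime on \<open>H\<close>.\<close>
  have "\<exists>q. rpoly q \<and> (\<forall>x\<in>H. \<alpha> \<bullet> X x = (\<Prod>\<sigma>\<in>\<rho> ` T. \<Prod>\<tau>\<in>F \<sigma>. \<tau> \<bullet> x) * q x)"
  proof (rule prod_groups_dvd[OF H(1) _ finF polaX])
    have HT: "\<tau> \<bullet> x = c \<tau> * (\<rho> \<tau> \<bullet> x)" if "\<tau> \<in> T" "x \<in> H" for \<tau> x
      using rel'[OF that(1)] that by (simp add: H_def mem_hyp)
    show "\<exists>x\<in>H. \<tau> \<bullet> x \<noteq> 0" if "\<tau> \<in> F i" for i \<tau>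
    proof -
      have "\<tau> \<in> T" using that by (simp add: F_def)
      with nz[OF this] HT[OF this] rel(3)[OF this] show ?thesis unfolding H_def by auto
    qed
    show "\<exists>x\<in>hyp H \<tau>. \<tau>' \<bullet> x \<noteq> 0" if "i \<noteq> j" "\<tau> \<in> F i" "\<tau>' \<in> F j" for i j \<tau> \<tau>'
    proof -
      have t: "\<tau> \<in> T" "\<tau>' \<in> T" "\<rho> \<tau> \<noteq> \<rho> \<tau>'" using that by (auto simp: F_def)
      obtain x where "x \<in> H" "\<rho> \<tau> \<bullet> x = 0" "\<rho> \<tau>' \<bullet> x \<noteq> 0"
        using np2[OF t] unfolding H_def by blast
      then show ?thesis using HT t rel(3)[OF t(2)] by (auto simp: mem_hyp)
    qed
  qed (use group T in auto)
  moreover have "(\<Prod>\<sigma>\<in>\<rho> ` T. \<Prod>\<tau>\<in>F \<sigma>. \<tau> \<bullet> x) = (\<Prod>\<tau>\<in>T. \<tau> \<bullet> x)" for x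
    unfolding F_def by (rule prod.image_gen[OF T, symmetric])
  ultimately show ?thesis by (simp add: H_def)
qed

section \<open>Derivations as vector fields\<close>

lemma zero_ext_Sym_dual: "rpoly p \<Longrightarrow> zero_ext W p \<in> Sym_dual W"
  by (auto simp: Sym_dual_def)

lemma Sym_dualE:
  assumes "f \<in> Sym_dual W"
  obtains p where "rpoly p" "f = zero_ext W p"
  using assms by (auto simp: Sym_dual_def)

lemma zero_ext_apply: "x \<in> W \<Longrightarrow> zero_ext W f x = f x"
  by (simp add: zero_ext_def)

lemma zero_ext_outside: "x \<notin> W \<Longrightarrow> zero_ext W f x = 0"
  by (simp add: zero_ext_def)

lemma Sym_dual_outside: "f \<in> Sym_dual W \<Longrightarrow> x \<notin> W \<Longrightarrow> f x = 0"
  by (auto simp: Sym_dual_def zero_ext_def)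

lemma zero_ext_add: "(\<lambda>x. zero_ext W f x + zero_ext W g x) = zero_ext W (\<lambda>x. f x + g x)"
  and zero_ext_mult: "(\<lambda>x. zero_ext W f x * zero_ext W g x) = zero_ext W (\<lambda>x. f x * g x)"
  and zero_ext_cmult: "(\<lambda>x. c * zero_ext W f x) = zero_ext W (\<lambda>x. c * f x)"
  by (auto simp: zero_ext_def)

lemma Sym_dual_add: "f \<in> Sym_dual W \<Longrightarrow> g \<in> Sym_dual W \<Longrightarrow> (\<lambda>x. f x + g x) \<in> Sym_dual W"
  by (elim Sym_dualE) (simp add: zero_ext_add zero_ext_Sym_dual rpoly_add)

lemma Sym_dual_cmult: "f \<in> Sym_dual W \<Longrightarrow> (\<lambda>x. c * f x) \<in> Sym_dual W"
  by (elim Sym_dualE) (simp add: zero_ext_cmult zero_ext_Sym_dual rpoly_mult rpoly_const)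

lemma Sym_dual_zero: "(\<lambda>x. 0) \<in> Sym_dual W"
proof -
  have "zero_ext W (\<lambda>x. 0) = (\<lambda>x. 0)" by (auto simp: zero_ext_def)
  then show ?thesis using zero_ext_Sym_dual[OF rpoly_const[of 0]] by metis
qed

lemma Sym_dual_sum:
  "(\<And>i. i \<in> I \<Longrightarrow> f i \<in> Sym_dual W) \<Longrightarrow> (\<lambda>x. \<Sum>i\<in>I. f i x) \<in> Sym_dual W"
  by (induction I rule: infinite_finite_induct) (auto simp: Sym_dual_zero Sym_dual_add)

text \<open>The second clause is what makes differentiation along a polynomial field map polynomials
  to polynomials.\<close>

lemma rpoly_has_derivative:
  assumes "rpoly p"
  shows "\<exists>D. \<forall>x. (p has_derivative D x) (at x) \<and> (\<forall>X. polynomial_function X \<longrightarrow> rpoly (\<lambda>x. D x (X x)))"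
  using assms
proof (induction p)
  case (linear f)
  show ?case
    by (rule exI[of _ "\<lambda>x. f"])
      (use linear bounded_linear_imp_has_derivative rpoly_compose[OF rpoly_linear[OF linear]] in blast)
next
  case (const c)
  show ?case by (rule exI[of _ "\<lambda>x h. 0"]) (auto intro: rpoly_const)
next
  case (add f g)
  then obtain D E where
    "\<forall>x. (f has_derivative D x) (at x) \<and> (\<forall>X. polynomial_function X \<longrightarrow> rpoly (\<lambda>x. D x (X x)))"
    "\<forall>x. (g has_derivative E x) (at x) \<and> (\<forall>X. polynomial_function X \<longrightarrow> rpoly (\<lambda>x. E x (X x)))"
    by blast
  then show ?case
    by (intro exI[of _ "\<lambda>x h. D x h + E x h"]) (auto intro!: has_derivative_add rpoly_add)
next
  case (mult f g)
  then obtain D E where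
    "\<forall>x. (f has_derivative D x) (at x) \<and> (\<forall>X. polynomial_function X \<longrightarrow> rpoly (\<lambda>x. D x (X x)))"
    "\<forall>x. (g has_derivative E x) (at x) \<and> (\<forall>X. polynomial_function X \<longrightarrow> rpoly (\<lambda>x. E x (X x)))"
    by blast
  then show ?case using mult.hyps
    by (intro exI[of _ "\<lambda>x h. f x * E x h + D x h * g x"])
      (auto intro!: has_derivative_mult rpoly_add rpoly_mult)
qed

text \<open>The derivative is taken along a line that stays inside \<open>W\<close> when
  \<open>X\<close> is tangent to \<open>W\<close>, so it does not depend on the polynomial extending
  \<open>f\<close> beyond \<open>W\<close>.\<close>

definition field_der :: "'a::euclidean_space set \<Rightarrow> ('a \<Rightarrow> 'a) \<Rightarrow> ('a \<Rightarrow> real) \<Rightarrow> 'a \<Rightarrow> real" where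
  "field_der W X f = (if f \<in> Sym_dual W
     then zero_ext W (\<lambda>x. deriv (\<lambda>t. f (x + t *\<^sub>R X x)) 0) else (\<lambda>x. 0))"

lemma field_der_eq:
  assumes W: "subspace W" and XW: "\<And>x. x \<in> W \<Longrightarrow> X x \<in> W"
    and p: "rpoly p" and D: "\<And>x. (p has_derivative D x) (at x)"
  shows "field_der W X (zero_ext W p) = zero_ext W (\<lambda>x. D x (X x))"
proof -
  have "deriv (\<lambda>t. zero_ext W p (x + t *\<^sub>R X x)) 0 = D x (X x)" if "x \<in> W" for x
  proof (rule DERIV_imp_deriv)
    have e: "(\<lambda>t. zero_ext W p (x + t *\<^sub>R X x)) = (\<lambda>t. p (x + t *\<^sub>R X x))"
      using that XW W by (auto simp: zero_ext_def subspace_add subspace_scale)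
    have "((\<lambda>t. x + t *\<^sub>R X x) has_derivative (\<lambda>t. t *\<^sub>R X x)) (at 0)"
      by (auto intro!: derivative_eq_intros)
    moreover have "(p has_derivative D x) (at (x + 0 *\<^sub>R X x))" using D by simp
    ultimately have "((\<lambda>t. p (x + t *\<^sub>R X x)) has_derivative (\<lambda>t. D x (t *\<^sub>R X x))) (at 0)"
      by (rule has_derivative_compose)
    moreover have "(\<lambda>t. D x (t *\<^sub>R X x)) = (\<lambda>t. D x (X x) * t)"
      using has_derivative_linear[OF D[of x]] by (auto simp: linear_cmul mult.commute)
    ultimately show "((\<lambda>t. zero_ext W p (x + t *\<^sub>R X x)) has_real_derivative D x (X x)) (at 0)"
      unfolding e has_field_derivative_def by simp
  qed
  then show ?thesis
    using zero_ext_Sym_dual[OF p] by (auto simp: field_der_def zero_ext_def)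
qed

lemma field_der_frechet:
  assumes W: "subspace W" and XW: "\<And>x. x \<in> W \<Longrightarrow> X x \<in> W" and p: "rpoly p"
  shows "field_der W X (zero_ext W p) = zero_ext W (\<lambda>x. frechet_derivative p (at x) (X x))"
proof (rule field_der_eq[OF W XW p])
  show "(p has_derivative frechet_derivative p (at x)) (at x)" for x
    using differentiable_at_real_polynomial_function[OF p] by (simp add: frechet_derivative_works)
qed

lemma field_der_linear:
  assumes "subspace W" "\<And>x. x \<in> W \<Longrightarrow> X x \<in> W" "linear l"
  shows "field_der W X (zero_ext W l) = zero_ext W (\<lambda>x. l (X x))"
  using assms linear_conv_bounded_linear[of l]
  by (intro field_der_eq rpoly_linear bounded_linear_imp_has_derivative) auto

lemma field_der_in_Der:
  assumes W: "subspace W" and X: "polynomial_function X" "\<And>x. x \<in> W \<Longrightarrow> X x \<in> W"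
  shows "field_der W X \<in> Der W"
  unfolding Der_def mem_Collect_eq
proof (intro conjI ballI allI impI)
  have eq: "field_der W X (zero_ext W p) = zero_ext W (\<lambda>x. D x (X x))"
    if "rpoly p" "\<And>x. (p has_derivative D x) (at x)" for p D
    using W X(2) that by (rule field_der_eq)
  fix f assume f: "f \<in> Sym_dual W"
  then obtain p where p: "rpoly p" "f = zero_ext W p" by (rule Sym_dualE)
  obtain D where D: "\<And>x. (p has_derivative D x) (at x)" "rpoly (\<lambda>x. D x (X x))"
    using rpoly_has_derivative[OF p(1)] X(1) by blast
  note ef = eq[OF p(1) D(1), folded p(2)]
  show "field_der W X f \<in> Sym_dual W"
    using ef D(2) zero_ext_Sym_dual by simp
  show "field_der W X (\<lambda>x. c * f x) = (\<lambda>x. c * field_der W X f x)" for c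
  proof -
    have "field_der W X (zero_ext W (\<lambda>x. c * p x)) = zero_ext W (\<lambda>x. c * D x (X x))"
      using D p by (intro eq rpoly_mult rpoly_const has_derivative_mult_right)
    then show ?thesis unfolding ef unfolding p(2) zero_ext_cmult by simp
  qed
  fix g assume "g \<in> Sym_dual W"
  then obtain q where q: "rpoly q" "g = zero_ext W q" by (rule Sym_dualE)
  obtain E where E: "\<And>x. (q has_derivative E x) (at x)"
    using rpoly_has_derivative[OF q(1)] by blast
  note eg = eq[OF q(1) E, folded q(2)]
  have "field_der W X (zero_ext W (\<lambda>x. p x + q x)) = zero_ext W (\<lambda>x. D x (X x) + E x (X x))"
    using D E p q by (intro eq rpoly_add has_derivative_add)
  then show "field_der W X (\<lambda>x. f x + g x) = (\<lambda>x. field_der W X f x + field_der W X g x)"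
    unfolding ef eg zero_ext_add unfolding p(2) q(2) zero_ext_add by simp
  have "field_der W X (zero_ext W (\<lambda>x. p x * q x)) = zero_ext W (\<lambda>x. p x * E x (X x) + D x (X x) * q x)"
    using D E p q by (intro eq rpoly_mult has_derivative_mult)
  then show "field_der W X (\<lambda>x. f x * g x) = (\<lambda>x. field_der W X f x * g x + f x * field_der W X g x)"
    unfolding ef eg unfolding p(2) q(2) zero_ext_mult by (simp add: zero_ext_def fun_eq_iff)
qed (simp add: field_der_def)

section \<open>Every derivation comes from a polynomial vector field\<close>

lemma DerD:
  assumes "\<theta> \<in> Der W"
  shows "f \<in> Sym_dual W \<Longrightarrow> \<theta> f \<in> Sym_dual W"
    "f \<notin> Sym_dual W \<Longrightarrow> \<theta> f = (\<lambda>x. 0)"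
    "f \<in> Sym_dual W \<Longrightarrow> g \<in> Sym_dual W \<Longrightarrow> \<theta> (\<lambda>x. f x + g x) = (\<lambda>x. \<theta> f x + \<theta> g x)"
    "f \<in> Sym_dual W \<Longrightarrow> \<theta> (\<lambda>x. c * f x) = (\<lambda>x. c * \<theta> f x)"
    "f \<in> Sym_dual W \<Longrightarrow> g \<in> Sym_dual W \<Longrightarrow> \<theta> (\<lambda>x. f x * g x) = (\<lambda>x. \<theta> f x * g x + f x * \<theta> g x)"
  using assms unfolding Der_def by blast+

lemma Der_zero:
  assumes "\<theta> \<in> Der W"
  shows "\<theta> (\<lambda>x. 0) = (\<lambda>x. 0)"
  using DerD(4)[OF assms Sym_dual_zero, of 0] by simp

lemma Der_sum:
  assumes \<theta>: "\<theta> \<in> Der W" and "finite I" "\<And>i. i \<in> I \<Longrightarrow> f i \<in> Sym_dual W"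
  shows "\<theta> (\<lambda>x. \<Sum>i\<in>I. f i x) = (\<lambda>x. \<Sum>i\<in>I. \<theta> (f i) x)"
  using assms(2,3)
proof (induction I)
  case (insert i I)
  then have "\<theta> (\<lambda>x. f i x + (\<Sum>i\<in>I. f i x)) = (\<lambda>x. \<theta> (f i) x + \<theta> (\<lambda>x. \<Sum>i\<in>I. f i x) x)"
    by (intro DerD(3)[OF \<theta>] Sym_dual_sum) auto
  then show ?case using insert by simp
qed (simp add: Der_zero[OF \<theta>])

lemma linear_inner_representation:
  fixes l :: "'a::euclidean_space \<Rightarrow> real"
  assumes "linear l"
  obtains w where "l = (\<lambda>x. w \<bullet> x)"
proof
  show "l = (\<lambda>x. (\<Sum>b\<in>Basis. l b *\<^sub>R b) \<bullet> x)"
  proof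
    fix x
    have "l x = l (\<Sum>b\<in>Basis. (x \<bullet> b) *\<^sub>R b)" by (simp add: euclidean_representation)
    also have "\<dots> = (\<Sum>b\<in>Basis. (x \<bullet> b) * l b)"
      using assms by (simp add: linear_sum linear_cmul)
    finally show "l x = (\<Sum>b\<in>Basis. l b *\<^sub>R b) \<bullet> x"
      by (simp add: inner_sum_left inner_commute[of x] mult.commute)
  qed
qed

lemma Der_eqI:
  assumes \<theta>: "\<theta> \<in> Der W" and \<theta>': "\<theta>' \<in> Der W"
    and eq: "\<And>l. linear l \<Longrightarrow> \<theta> (zero_ext W l) = \<theta>' (zero_ext W l)"
  shows "\<theta> = \<theta>'"
proof
  fix f
  show "\<theta> f = \<theta>' f"
  proof (cases "f \<in> Sym_dual W")
    case False
    then show ?thesis using DerD(2)[OF \<theta>] DerD(2)[OF \<theta>'] by simp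
  next
    case True
    \<comment> \<open>The unit is the indicator of \<open>W\<close>, an idempotent. The product rule
      then gives \<open>\<phi> ?u x = 2 * \<phi> ?u x\<close> on \<open>W\<close>, and off
      \<open>W\<close> every element of the ring is 0.\<close>
    have one: "\<phi> (zero_ext W (\<lambda>x. 1)) = (\<lambda>x. 0)" if \<phi>: "\<phi> \<in> Der W" for \<phi>
    proof
      let ?u = "zero_ext W (\<lambda>x. 1::real)"
      have u: "?u \<in> Sym_dual W" by (rule zero_ext_Sym_dual[OF rpoly_const])
      have "(\<lambda>x. ?u x * ?u x) = ?u" by (simp add: zero_ext_mult)
      then have e: "\<phi> ?u x = \<phi> ?u x * ?u x + ?u x * \<phi> ?u x" for x
        using DerD(5)[OF \<phi> u u] by metis
      show "\<phi> ?u x = 0" for x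
        using e[of x] Sym_dual_outside[OF DerD(1)[OF \<phi> u]] by (cases "x \<in> W") (auto simp: zero_ext_apply)
    qed
    obtain p where p: "rpoly p" and f: "f = zero_ext W p" using True by (rule Sym_dualE)
    from p have "\<theta> (zero_ext W p) = \<theta>' (zero_ext W p)"
    proof (induction p)
      case (linear l)
      then show ?case using eq bounded_linear.linear by blast
    next
      case (const c)
      have "zero_ext W (\<lambda>x. c) = (\<lambda>x. c * zero_ext W (\<lambda>x. 1) x)" by (simp add: zero_ext_cmult)
      then show ?case
        using DerD(4)[OF \<theta>] DerD(4)[OF \<theta>'] one[OF \<theta>] one[OF \<theta>'] zero_ext_Sym_dual[OF rpoly_const] by metis
    next
      case (add p q)
      then show ?case
        using DerD(3)[OF \<theta> zero_ext_Sym_dual zero_ext_Sym_dual] DerD(3)[OF \<theta>' zero_ext_Sym_dual zero_ext_Sym_dual]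
        by (simp add: zero_ext_add)
    next
      case (mult p q)
      then show ?case
        using DerD(5)[OF \<theta> zero_ext_Sym_dual zero_ext_Sym_dual] DerD(5)[OF \<theta>' zero_ext_Sym_dual zero_ext_Sym_dual]
        by (simp add: zero_ext_mult)
    qed
    then show ?thesis by (simp add: f)
  qed
qed

text \<open>The components of the field are the images of the coordinate forms; agreement on linear
  forms then suffices by \<open>Der_eqI\<close>.\<close>

lemma Der_is_field_der:
  assumes W: "subspace W" and \<theta>: "\<theta> \<in> Der W"
  obtains X where "polynomial_function X" "\<And>x. x \<in> W \<Longrightarrow> X x \<in> W" "\<theta> = field_der W X"
proof -
  have zb: "zero_ext W (\<lambda>y. b \<bullet> y) \<in> Sym_dual W" for b
    by (rule zero_ext_Sym_dual[OF rpoly_inner])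
  have "\<forall>b. \<exists>p. rpoly p \<and> \<theta> (zero_ext W (\<lambda>y. b \<bullet> y)) = zero_ext W p"
    using DerD(1)[OF \<theta> zb] by (metis Sym_dualE)
  then obtain p where p: "\<And>b. rpoly (p b)" "\<And>b. \<theta> (zero_ext W (\<lambda>y. b \<bullet> y)) = zero_ext W (p b)"
    by metis
  define X where "X = (\<lambda>x. \<Sum>b\<in>Basis. p b x *\<^sub>R b)"
  have X: "polynomial_function X" unfolding X_def
    by (intro polynomial_function_sum polynomial_function_scaleR p) auto
  have inner: "\<theta> (zero_ext W (\<lambda>y. w \<bullet> y)) = zero_ext W (\<lambda>x. w \<bullet> X x)" for w
  proof -
    have "zero_ext W (\<lambda>y. w \<bullet> y) = (\<lambda>y. \<Sum>b\<in>Basis. (w \<bullet> b) * zero_ext W (\<lambda>y. b \<bullet> y) y)"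
    proof -
      have e: "(\<Sum>b\<in>Basis. (w \<bullet> b) * (b \<bullet> y)) = w \<bullet> y" for y
        by (subst euclidean_inner[of w]) (simp add: inner_commute)
      show ?thesis by (rule ext) (simp add: zero_ext_def e)
    qed
    then have "\<theta> (zero_ext W (\<lambda>y. w \<bullet> y)) = (\<lambda>y. \<Sum>b\<in>Basis. \<theta> (\<lambda>y. (w \<bullet> b) * zero_ext W (\<lambda>y. b \<bullet> y) y) y)"
      using Der_sum[OF \<theta> finite_Basis, of "\<lambda>b y. (w \<bullet> b) * zero_ext W (\<lambda>y. b \<bullet> y) y"]
      by (simp add: Sym_dual_cmult zb)
    also have "\<dots> = (\<lambda>y. \<Sum>b\<in>Basis. (w \<bullet> b) * zero_ext W (p b) y)"
      using DerD(4)[OF \<theta> zb] p(2) by simp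
    also have "\<dots> = zero_ext W (\<lambda>x. w \<bullet> X x)"
      unfolding X_def zero_ext_def by (rule ext) (simp add: inner_sum_right mult.commute)
    finally show ?thesis .
  qed
  \<comment> \<open>The component \<open>z\<close> of \<open>X x\<close> normal to \<open>W\<close>
    defines a form that is zero on \<open>W\<close>, so the derivation kills it. Hence
    \<open>z\<close> is orthogonal to \<open>X x\<close>, and therefore to itself.\<close>
  have XW: "X x \<in> W" if x: "x \<in> W" for x
  proof -
    obtain y z where yz: "y \<in> span W" "\<And>w. w \<in> span W \<Longrightarrow> orthogonal z w" "X x = y + z"
      using orthogonal_subspace_decomp_exists[of W "X x"] by metis
    have "zero_ext W (\<lambda>y. z \<bullet> y) = (\<lambda>x. 0)"
      using yz(2) by (auto simp: zero_ext_def orthogonal_def span_base)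
    then have "zero_ext W (\<lambda>x. z \<bullet> X x) x = 0"
      using inner[of z] Der_zero[OF \<theta>] by metis
    then have "z \<bullet> (y + z) = 0" using x yz(3) by (simp add: zero_ext_apply)
    moreover have "z \<bullet> y = 0" using yz(1,2) by (simp add: orthogonal_def)
    ultimately have "z = 0" by (simp add: inner_add_right)
    then show ?thesis using yz W by (simp add: span_eq_iff[THEN iffD2])
  qed
  have "\<theta> = field_der W X"
  proof (rule Der_eqI[OF \<theta> field_der_in_Der[OF W X XW]])
    fix l :: "'a \<Rightarrow> real" assume l: "linear l"
    then obtain w where w: "l = (\<lambda>x. w \<bullet> x)" using linear_inner_representation by blast
    have "field_der W X (zero_ext W l) = zero_ext W (\<lambda>x. l (X x))"
      by (rule field_der_linear[OF W XW l])
    then show "\<theta> (zero_ext W l) = field_der W X (zero_ext W l)"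
      using inner[of w] w by simp
  qed
  then show ?thesis using that X XW by blast
qed

text \<open>The choice in \<open>hyperplane_form\<close> is meaningful because a form cutting out
  \<open>H\<close> exists: the part orthogonal to \<open>H\<close> of a vector of \<open>W\<close>
  outside \<open>H\<close> gives one, by comparison of dimensions.\<close>

lemma hyperplane_form_representation:
  assumes W: "subspace W" and H: "subspace H" "H \<subseteq> W" "dim H + 1 = dim W"
  obtains w where "hyperplane_form W H = (\<lambda>x. w \<bullet> x)" "hyp W w = H" "\<exists>x\<in>W. w \<bullet> x \<noteq> 0"
proof -
  have "\<not> W \<subseteq> H" using H(2,3) by (metis add.commute add_left_imp_eq add.right_neutral zero_neq_one subset_antisym)
  then obtain x where x: "x \<in> W" "x \<notin> H" by blast
  obtain y w where w: "y \<in> span H" "\<And>u. u \<in> span H \<Longrightarrow> orthogonal w u" "x = y + w"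
    using orthogonal_subspace_decomp_exists[of H x] by metis
  have yH: "y \<in> H" using w(1) H(1) by (simp add: span_eq_iff[THEN iffD2])
  have "w \<noteq> 0" using yH w(3) x(2) by auto
  have wH: "w \<bullet> u = 0" if "u \<in> H" for u using w(2)[OF span_base[OF that]] by (simp add: orthogonal_def)
  have wx: "w \<bullet> x \<noteq> 0" using w(3) wH[OF yH] \<open>w \<noteq> 0\<close> by (simp add: inner_add_right)
  have "H \<subseteq> hyp W w" using H(2) wH by (auto simp: mem_hyp)
  moreover have "dim (hyp W w) = dim H" using dim_hyp[OF W x(1) wx] H(3) by simp
  ultimately have "H = hyp W w"
    using subspace_dim_equal[OF H(1) subspace_hyp[OF W]] by simp
  then have "linear (\<lambda>x. w \<bullet> x) \<and> {x\<in>W. w \<bullet> x = 0} = H"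
    by (auto simp: hyp_def intro!: bounded_linear.linear bounded_linear_inner_right)
  then have l: "linear (hyperplane_form W H) \<and> {x\<in>W. hyperplane_form W H x = 0} = H"
    unfolding hyperplane_form_def by (rule someI[where P = "\<lambda>l. linear l \<and> {x\<in>W. l x = 0} = H"])
  then obtain w' where w': "hyperplane_form W H = (\<lambda>x. w' \<bullet> x)" using linear_inner_representation by blast
  show ?thesis
    by (rule that[OF w']) (use l w' x in \<open>auto simp: hyp_def\<close>)
qed

text \<open>If the field is tangent, each form divides its own derivative, and the product rule
  collects the quotients. Conversely, on \<open>H\<close> only the term differentiating the form of
  \<open>H\<close> survives in the derivative of \<open>Q A\<close>. The product of the remaining
  forms is not identically zero on \<open>H\<close>, so it can be cancelled.\<close>

lemma field_der_log_iff:
  assumes C: "central_arrangement W A" and X: "polynomial_function X" "\<And>x. x \<in> W \<Longrightarrow> X x \<in> W"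
  shows "field_der W X \<in> log_derivations W A \<longleftrightarrow> X \<in> tangent W A"
proof -
  have W: "subspace W" and fin: "finite A"
    and HA: "\<And>H. H \<in> A \<Longrightarrow> subspace H \<and> H \<subseteq> W \<and> dim H + 1 = dim W"
    using C by (auto simp: central_arrangement_def)
  have "\<forall>H\<in>A. \<exists>w. hyperplane_form W H = (\<lambda>x. w \<bullet> x) \<and> hyp W w = H \<and> (\<exists>x\<in>W. w \<bullet> x \<noteq> 0)"
    using hyperplane_form_representation[OF W] HA by metis
  then obtain w where w: "\<And>H. H \<in> A \<Longrightarrow> hyperplane_form W H = (\<lambda>x. w H \<bullet> x)"
      "\<And>H. H \<in> A \<Longrightarrow> hyp W (w H) = H" "\<And>H. H \<in> A \<Longrightarrow> \<exists>x\<in>W. w H \<bullet> x \<noteq> 0"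
    by metis
  define Q where "Q = (\<lambda>F. zero_ext W (\<lambda>x. \<Prod>H\<in>F. w H \<bullet> x))"
  have QA: "defining_poly W A = Q A"
    unfolding defining_poly_def Q_def using w(1) by (auto intro!: arg_cong[of _ _ "zero_ext W"] prod.cong)
  have QS: "Q F \<in> Sym_dual W" if "F \<subseteq> A" for F
    unfolding Q_def using finite_subset[OF that fin]
    by (intro zero_ext_Sym_dual real_polynomial_function_prod rpoly_inner)
  let ?\<theta> = "field_der W X"
  have \<theta>: "?\<theta> \<in> Der W" by (rule field_der_in_Der[OF W X])
  have \<theta>w: "?\<theta> (zero_ext W (\<lambda>x. w H \<bullet> x)) = zero_ext W (\<lambda>x. w H \<bullet> X x)" for H
    by (rule field_der_linear[OF W X(2)]) (auto intro!: bounded_linear.linear bounded_linear_inner_right)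
  have zw: "zero_ext W (\<lambda>x. w H \<bullet> x) \<in> Sym_dual W" for H
    by (rule zero_ext_Sym_dual[OF rpoly_inner])
  have Q_insert: "Q (insert H F) = (\<lambda>x. zero_ext W (\<lambda>x. w H \<bullet> x) x * Q F x)" if "finite F" "H \<notin> F" for H F
    unfolding Q_def zero_ext_mult using that by simp
  have \<theta>Q_insert: "?\<theta> (Q (insert H F)) = (\<lambda>x. zero_ext W (\<lambda>x. w H \<bullet> X x) x * Q F x
      + zero_ext W (\<lambda>x. w H \<bullet> x) x * ?\<theta> (Q F) x)" if "F \<subseteq> A" "H \<notin> F" for H F
    unfolding Q_insert[OF finite_subset[OF that(1) fin] that(2)]
    using DerD(5)[OF \<theta> zw QS[OF that(1)]] \<theta>w by simp
  show ?thesis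
  proof
    assume t: "X \<in> tangent W A"
    have "\<exists>f\<in>Sym_dual W. ?\<theta> (Q F) = (\<lambda>x. Q F x * f x)" if "F \<subseteq> A" for F
      using finite_subset[OF that fin] that
    proof (induction F)
      case empty
      have Q0: "Q {} = zero_ext W (\<lambda>x. 1)" by (simp add: Q_def)
      have "(\<lambda>x. frechet_derivative (\<lambda>x. 1::real) (at x) (X x)) = (\<lambda>x. 0)"
        by (simp add: frechet_derivative_const)
      then have "?\<theta> (Q {}) = (\<lambda>x. 0)"
        unfolding Q0 by (subst field_der_frechet[OF W X(2) rpoly_const]) (auto simp: zero_ext_def)
      then show ?case using Sym_dual_zero by (intro bexI[of _ "\<lambda>x. 0"]) auto
    next
      case (insert H F)
      then have H: "H \<in> A" "F \<subseteq> A" by auto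
      obtain f where f: "f \<in> Sym_dual W" "?\<theta> (Q F) = (\<lambda>x. Q F x * f x)" using insert by auto
      obtain x where "x \<in> W" "w H \<bullet> x \<noteq> 0" using w(3)[OF H(1)] by blast
      moreover have "w H \<bullet> X y = 0" if "y \<in> hyp W (w H)" for y
        using tangentD(3)[OF t H(1)] w(2)[OF H(1)] that by (auto simp: mem_hyp)
      ultimately obtain g where g: "rpoly g" "\<And>y. y \<in> W \<Longrightarrow> w H \<bullet> X y = (w H \<bullet> y) * g y"
        using rpoly_divide_linear[OF W rpoly_inner_field[OF X(1)]] by metis
      have "?\<theta> (Q (insert H F)) = (\<lambda>x. Q (insert H F) x * (zero_ext W g x + f x))"
      proof
        fix x
        show "?\<theta> (Q (insert H F)) x = Q (insert H F) x * (zero_ext W g x + f x)"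
          using g(2)[of x] \<theta>Q_insert[OF H(2) insert.hyps(2)] Q_insert[OF insert.hyps(1,2)] f(2)
          by (cases "x \<in> W") (simp_all add: zero_ext_def algebra_simps)
      qed
      then show ?case using Sym_dual_add[OF zero_ext_Sym_dual[OF g(1)] f(1)]
        by (rule bexI[of _ "\<lambda>x. zero_ext W g x + f x"])
    qed
    then show "?\<theta> \<in> log_derivations W A"
      using \<theta> by (simp add: log_derivations_def QA)
  next
    assume l: "?\<theta> \<in> log_derivations W A"
    then obtain f where f: "?\<theta> (Q A) = (\<lambda>x. Q A x * f x)" by (auto simp: log_derivations_def QA)
    show "X \<in> tangent W A"
    proof (rule tangentI[OF X])
      fix H x assume H: "H \<in> A" and x: "x \<in> H"
      have sH: "subspace H" "H \<subseteq> W" using HA H by auto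
      have "H \<notin> A - {H}" "A - {H} \<subseteq> A" "insert H (A - {H}) = A" using H by auto
      note ins = \<theta>Q_insert[OF this(2,1), unfolded this(3)]
        Q_insert[OF finite_subset[OF this(2) fin] this(1), unfolded this(3)]
      let ?q = "\<lambda>x. \<Prod>K\<in>A - {H}. w K \<bullet> x"
      have q: "rpoly ?q" using fin by (intro real_polynomial_function_prod rpoly_inner) auto
      have "\<exists>x\<in>H. (\<Prod>\<tau>\<in>w ` (A - {H}). \<tau> \<bullet> x) \<noteq> 0"
      proof (rule prod_inner_not_zero[OF sH(1)])
        fix \<tau> assume "\<tau> \<in> w ` (A - {H})"
        then obtain K where K: "K \<in> A" "K \<noteq> H" "\<tau> = w K" by auto
        show "\<exists>x\<in>H. \<tau> \<bullet> x \<noteq> 0"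
        proof (rule ccontr)
          assume "\<not> ?thesis"
          then have "H \<subseteq> K" using K w(2)[OF K(1)] sH(2) by (auto simp: hyp_def)
          then show False
            using subspace_dim_equal[of H K] HA[OF H] HA[OF K(1)] K(2) by simp
        qed
      qed (use fin in auto)
      then obtain x0 where x0: "x0 \<in> H" "?q x0 \<noteq> 0" using fin by (auto simp: prod_zero_iff)
      have "w H \<bullet> X x = 0"
      proof (rule rpoly_domain[OF sH(1) q rpoly_inner_field[OF X(1)] _ x0 x])
        fix y assume y: "y \<in> H"
        then have yW: "y \<in> W" and y0: "w H \<bullet> y = 0" using sH(2) w(2)[OF H] by (auto simp: hyp_def)
        have "?\<theta> (Q A) y = (w H \<bullet> X y) * Q (A - {H}) y"
          unfolding ins(1) using yW y0 by (simp add: zero_ext_apply)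
        moreover have "Q A y = 0" unfolding ins(2) using yW y0 by (simp add: zero_ext_apply)
        ultimately show "?q y * (w H \<bullet> X y) = 0"
          using f yW by (auto simp: Q_def zero_ext_apply)
      qed
      then show "X x \<in> H" using X(2) x sH(2) w(2)[OF H] by (auto simp: hyp_def)
    qed
  qed
qed

lemma vf_free_imp_free_with_exponents:
  assumes C: "central_arrangement W A" and free: "vf_free W A E"
  shows "free_with_exponents W A E"
proof -
  have W: "subspace W" using C by (simp add: central_arrangement_def)
  obtain m :: nat and X and d where E: "E = image_mset d (mset_set {..<m})"
    and "\<forall>k<m. X k \<in> tangent W A"
    and "\<forall>k<m. \<forall>x\<in>W. \<forall>c. X k (c *\<^sub>R x) = c ^ d k *\<^sub>R X k x"
    and gen: "\<forall>Y\<in>tangent W A. \<exists>c. (\<forall>k<m. rpoly (c k)) \<and> (\<forall>x\<in>W. Y x = (\<Sum>k<m. c k x *\<^sub>R X k x))"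
    and ind: "\<forall>c. (\<forall>k<m. rpoly (c k)) \<longrightarrow> (\<forall>x\<in>W. (\<Sum>k<m. c k x *\<^sub>R X k x) = 0) \<longrightarrow>
        (\<forall>k<m. \<forall>x\<in>W. c k x = 0)"
    using free unfolding vf_free_def by (elim exE conjE) (rule that)
  then have X: "\<And>k. k < m \<Longrightarrow> X k \<in> tangent W A"
    and Xhom: "\<And>k x c. k < m \<Longrightarrow> x \<in> W \<Longrightarrow> X k (c *\<^sub>R x) = c ^ d k *\<^sub>R X k x"
    by blast+
  have XW: "X k x \<in> W" if "k < m" "x \<in> W" for k x using tangentD(2)[OF X[OF that(1)] that(2)] .
  have XD: "field_der W (X k) \<in> Der W" if "k < m" for k
    by (rule field_der_in_Der[OF W tangentD(1)[OF X[OF that]] XW[OF that]])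
  define \<theta>s where "\<theta>s = map (\<lambda>k. field_der W (X k)) [0..<m]"
  have len: "length \<theta>s = m" and nth: "\<And>k. k < m \<Longrightarrow> \<theta>s ! k = field_der W (X k)"
    by (auto simp: \<theta>s_def)
  have "module_basis W (log_derivations W A) \<theta>s"
    unfolding module_basis_def len
  proof (intro conjI ballI)
    show "set \<theta>s \<subseteq> log_derivations W A"
      using field_der_log_iff[OF C tangentD(1)[OF X] XW] X by (auto simp: \<theta>s_def)
    fix \<theta> assume \<theta>: "\<theta> \<in> log_derivations W A"
    then have "\<theta> \<in> Der W" by (simp add: log_derivations_def)
    then obtain Y where Y: "polynomial_function Y" "\<And>x. x \<in> W \<Longrightarrow> Y x \<in> W" "\<theta> = field_der W Y"
      using Der_is_field_der[OF W] by blast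
    then have Yt: "Y \<in> tangent W A" using field_der_log_iff[OF C Y(1,2)] \<theta> by simp
    then obtain c where c: "\<And>k. k < m \<Longrightarrow> rpoly (c k)" "\<And>x. x \<in> W \<Longrightarrow> Y x = (\<Sum>k<m. c k x *\<^sub>R X k x)"
      using gen by blast
    define cs where "cs = map (\<lambda>k. zero_ext W (c k)) [0..<m]"
    have csn: "cs ! k = zero_ext W (c k)" if "k < m" for k using that by (simp add: cs_def)
    have comb: "\<theta> = (\<lambda>g x. \<Sum>i<m. (cs ! i) x * (\<theta>s ! i) g x)"
    proof (intro ext)
      fix g x
      consider "g \<notin> Sym_dual W" | "x \<notin> W" | "g \<in> Sym_dual W" "x \<in> W" by blast
      then show "\<theta> g x = (\<Sum>i<m. (cs ! i) x * (\<theta>s ! i) g x)"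
      proof cases
        case 1
        then show ?thesis by (simp add: Y(3) field_der_def nth)
      next
        case 2
        then show ?thesis by (simp add: Y(3) field_der_def nth zero_ext_outside)
      next
        case 3
        obtain p where p: "rpoly p" "g = zero_ext W p" using 3(1) by (rule Sym_dualE)
        have fr: "field_der W Z (zero_ext W p) x = frechet_derivative p (at x) (Z x)"
          if "\<And>x. x \<in> W \<Longrightarrow> Z x \<in> W" for Z
          using field_der_frechet[OF W that p(1)] 3(2) by (simp add: zero_ext_apply)
        have lin: "linear (frechet_derivative p (at x))"
          using differentiable_at_real_polynomial_function[OF p(1)] linear_frechet_derivative by blast
        have "\<theta> g x = frechet_derivative p (at x) (Y x)"
          unfolding Y(3) p(2) using Y(2) by (rule fr)
        also have "\<dots> = (\<Sum>k<m. c k x * frechet_derivative p (at x) (X k x))"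
          unfolding c(2)[OF 3(2)] using lin by (simp add: linear_sum linear_cmul)
        also have "\<dots> = (\<Sum>k<m. (cs ! k) x * (\<theta>s ! k) g x)"
          using 3 by (intro sum.cong)
            (auto simp: csn nth p(2) fr[OF XW] zero_ext_apply)
        finally show ?thesis .
      qed
    qed
    show "\<exists>!cs. length cs = m \<and> set cs \<subseteq> Sym_dual W \<and>
        \<theta> = (\<lambda>g x. \<Sum>i<m. (cs ! i) x * (\<theta>s ! i) g x)"
    proof (rule ex1I)
      show "length cs = m \<and> set cs \<subseteq> Sym_dual W \<and> \<theta> = (\<lambda>g x. \<Sum>i<m. (cs ! i) x * (\<theta>s ! i) g x)"
        using c(1) by (intro conjI comb) (auto simp: cs_def intro!: zero_ext_Sym_dual)
      fix cs' assume cs': "length cs' = m \<and> set cs' \<subseteq> Sym_dual W \<and>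
        \<theta> = (\<lambda>g x. \<Sum>i<m. (cs' ! i) x * (\<theta>s ! i) g x)"
      have "\<forall>k\<in>{..<m}. \<exists>p. rpoly p \<and> cs' ! k = zero_ext W p"
        using cs' by (metis Sym_dualE lessThan_iff nth_mem subsetD)
      then obtain p where p: "\<And>k. k < m \<Longrightarrow> rpoly (p k)" "\<And>k. k < m \<Longrightarrow> cs' ! k = zero_ext W (p k)"
        by (metis lessThan_iff)
      \<comment> \<open>Two equal combinations of derivations are tested on the coordinate forms,
        which recovers the components of the vector fields.\<close>
      have s: "(\<Sum>k<m. (p k x - c k x) *\<^sub>R X k x) = 0" if x: "x \<in> W" for x
      proof (rule euclidean_eqI)
        fix b :: 'a assume "b \<in> Basis"
        let ?g = "zero_ext W (\<lambda>y. b \<bullet> y)"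
        have g: "field_der W (X k) ?g x = b \<bullet> X k x" if "k < m" for k
          using field_der_linear[OF W XW[OF that], where l = "\<lambda>y. b \<bullet> y"] x
          by (auto simp: zero_ext_apply bounded_linear.linear bounded_linear_inner_right)
        have "(\<Sum>k<m. c k x * (b \<bullet> X k x)) = \<theta> ?g x"
          by (subst comb) (auto intro!: sum.cong simp: csn nth g zero_ext_apply[OF x])
        also have "\<dots> = (\<Sum>k<m. p k x * (b \<bullet> X k x))"
          by (subst cs'[THEN conjunct2, THEN conjunct2])
            (auto intro!: sum.cong simp: p(2) nth g zero_ext_apply[OF x])
        finally show "(\<Sum>k<m. (p k x - c k x) *\<^sub>R X k x) \<bullet> b = 0 \<bullet> b"
          by (simp add: inner_sum_right inner_commute[of _ b] left_diff_distrib sum_subtractf)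
      qed
      have "\<forall>k<m. \<forall>x\<in>W. p k x - c k x = 0"
        using ind[THEN spec, of "\<lambda>k x. p k x - c k x"] p(1) c(1) s
        by (simp add: real_polynomial_function_diff)
      then have "cs' ! k = cs ! k" if "k < m" for k
        using that p(2)[OF that] csn[OF that] by (auto simp: zero_ext_def fun_eq_iff)
      then show "cs' = cs" using cs' by (intro nth_equalityI) (auto simp: cs_def)
    qed
  qed
  moreover have "list_all2 (homogeneous_der W) (map d [0..<m]) \<theta>s"
    unfolding list_all2_conv_all_nth homogeneous_der_def homogeneous_poly_def
  proof (intro conjI allI impI ballI)
    fix k l assume "k < length (map d [0..<m])"
    then have k: "k < m" by simp
    then show "\<theta>s ! k \<in> Der W" using XD nth by simp
    assume l: "linear (l :: 'a \<Rightarrow> real)"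
    then have zl: "zero_ext W l \<in> Sym_dual W"
      by (intro zero_ext_Sym_dual rpoly_linear) (simp add: linear_conv_bounded_linear)
    show "(\<theta>s ! k) (zero_ext W l) \<in> Sym_dual W"
      using DerD(1)[OF XD[OF k] zl] k nth by simp
    fix x c assume x: "x \<in> W"
    have "(\<theta>s ! k) (zero_ext W l) = zero_ext W (\<lambda>x. l (X k x))"
      using field_der_linear[OF W XW[OF k] l] nth[OF k] by simp
    then show "(\<theta>s ! k) (zero_ext W l) (c *\<^sub>R x) = c ^ (map d [0..<m] ! k) * (\<theta>s ! k) (zero_ext W l) x"
      using x W k Xhom[OF k x] l by (simp add: zero_ext_apply subspace_scale linear_cmul)
  qed (simp add: len)
  moreover have "E = mset (map d [0..<m])"
    by (simp add: E atLeast0LessThan)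
  ultimately show ?thesis unfolding free_with_exponents_def by blast
qed

section \<open>Adding one hyperplane\<close>

text \<open>An arrangement is given by normal vectors, several of which may define the same
  hyperplane. Inductive freeness and exponents are carried together because every addition needs the
  exponents of both deletion and restriction.\<close>

definition ifree :: "'a::euclidean_space set \<Rightarrow> 'a set \<Rightarrow> nat multiset \<Rightarrow> bool" where
  "ifree W S E \<longleftrightarrow> subspace W \<and> finite S \<and> (\<forall>\<alpha>\<in>S. \<exists>x\<in>W. \<alpha> \<bullet> x \<noteq> 0) \<and>
     inductively_free W (hyp W ` S) \<and> vf_free W (hyp W ` S) E"

lemma ifreeD:
  assumes "ifree W S E"
  shows "subspace W" "finite S" "\<And>\<alpha>. \<alpha> \<in> S \<Longrightarrow> \<exists>x\<in>W. \<alpha> \<bullet> x \<noteq> 0"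
    "inductively_free W (hyp W ` S)" "vf_free W (hyp W ` S) E"
  using assms by (auto simp: ifree_def)

lemma central_arrangement_hyp:
  assumes "subspace W" "finite S" "\<And>\<alpha>. \<alpha> \<in> S \<Longrightarrow> \<exists>x\<in>W. \<alpha> \<bullet> x \<noteq> 0"
  shows "central_arrangement W (hyp W ` S)"
  using assms dim_hyp[OF assms(1)] subspace_hyp[OF assms(1)] hyp_subset
  unfolding central_arrangement_def by blast

lemma ifree_free_with_exponents:
  "ifree W S E \<Longrightarrow> free_with_exponents W (hyp W ` S) E"
  by (intro vf_free_imp_free_with_exponents central_arrangement_hyp) (auto dest: ifreeD)

lemma ifree_empty: "subspace W \<Longrightarrow> ifree W {} (replicate_mset (dim W) 0)"
  by (simp add: ifree_def vf_free_empty inductively_free.empty)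

text \<open>The forms in \<open>T\<close> are those whose hyperplanes become redundant on the kernel of \<open>\<alpha>\<close>, being
  cut out there by members of \<open>R\<close>.\<close>

lemma ifree_step:
  fixes W :: "'a::euclidean_space set"
  assumes free: "ifree W S (add_mset d F)"
    and z: "z \<in> W" "\<alpha> \<bullet> z \<noteq> 0"
    and new: "\<And>\<sigma>. \<sigma> \<in> S \<Longrightarrow> hyp W \<sigma> \<noteq> hyp W \<alpha>"
    and restr: "ifree (hyp W \<alpha>) S' F" "hyp (hyp W \<alpha>) ` S' = hyp (hyp W \<alpha>) ` S"
    and TS: "T \<subseteq> S" and RS: "R \<subseteq> S"
    and R_nz: "\<And>\<rho>. \<rho> \<in> R \<Longrightarrow> \<exists>x\<in>hyp W \<alpha>. \<rho> \<bullet> x \<noteq> 0"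
    and R_sep: "\<And>\<rho> \<sigma>. \<rho> \<in> R \<Longrightarrow> \<sigma> \<in> R \<Longrightarrow> \<rho> \<noteq> \<sigma> \<Longrightarrow> \<exists>x\<in>hyp W \<alpha>. \<rho> \<bullet> x = 0 \<and> \<sigma> \<bullet> x \<noteq> 0"
    and T_sep: "\<And>\<rho> \<sigma>. \<rho> \<in> T \<Longrightarrow> \<sigma> \<in> T \<Longrightarrow> \<rho> \<noteq> \<sigma> \<Longrightarrow> \<exists>x\<in>W. \<rho> \<bullet> x = 0 \<and> \<sigma> \<bullet> x \<noteq> 0"
    and TR: "\<And>\<tau>. \<tau> \<in> T \<Longrightarrow> \<exists>\<rho>\<in>R. \<exists>a c. a \<noteq> 0 \<and> c \<noteq> 0 \<and> \<tau> = a *\<^sub>R \<alpha> + c *\<^sub>R \<rho>"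
    and d: "card T = d"
    and \<psi>: "\<psi> \<in> tangent W (hyp W ` S)" "\<kappa> \<noteq> 0"
      "\<And>x. x \<in> hyp W \<alpha> \<Longrightarrow> \<alpha> \<bullet> \<psi> x = \<kappa> * (\<Prod>\<tau>\<in>T. \<tau> \<bullet> x)"
  shows "ifree W (insert \<alpha> S) (add_mset (Suc d) F)"
proof -
  note W = ifreeD(1)[OF free] and S = ifreeD(2,3)[OF free]
  have T: "finite T" using TS S(1) by (rule finite_subset)
  let ?H = "hyp W \<alpha>" and ?A = "hyp W ` S"
  have H: "subspace ?H" by (rule subspace_hyp[OF W])
  obtain \<rho> a c where \<rho>: "\<And>\<tau>. \<tau> \<in> T \<Longrightarrow> \<rho> \<tau> \<in> R" "\<And>\<tau>. \<tau> \<in> T \<Longrightarrow> a \<tau> \<noteq> 0" "\<And>\<tau>. \<tau> \<in> T \<Longrightarrow> c \<tau> \<noteq> 0"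
    "\<And>\<tau>. \<tau> \<in> T \<Longrightarrow> \<tau> = a \<tau> *\<^sub>R \<alpha> + c \<tau> *\<^sub>R \<rho> \<tau>"
    using TR by metis
  define B where "B = (\<lambda>x. \<Prod>\<tau>\<in>T. \<tau> \<bullet> x)"
  have B: "rpoly B" unfolding B_def by (rule rpoly_prod_inner[OF T])
  have TH: "\<exists>x\<in>?H. \<tau> \<bullet> x \<noteq> 0" if t: "\<tau> \<in> T" for \<tau>
  proof -
    obtain x where x: "x \<in> ?H" "\<rho> \<tau> \<bullet> x \<noteq> 0" using R_nz \<rho>(1)[OF t] by blast
    have "\<tau> \<bullet> x = a \<tau> * (\<alpha> \<bullet> x) + c \<tau> * (\<rho> \<tau> \<bullet> x)"
      using arg_cong[OF \<rho>(4)[OF t], of "\<lambda>u. u \<bullet> x"] by (simp add: inner_add_left)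
    then show ?thesis using x \<rho>(3)[OF t] by (intro bexI[of _ x]) (auto simp: mem_hyp)
  qed
  obtain x0 where x0: "x0 \<in> ?H" "B x0 \<noteq> 0"
    using prod_inner_not_zero[OF H T TH] unfolding B_def by blast
  have vf: "vf_free W (insert ?H ?A) (add_mset (Suc d) F)"
  proof (rule vf_addition[OF W _ z ifreeD(5)[OF free] B x0 _ _ \<psi>(1) _ \<psi>(2)])
    show "subspace K" if "K \<in> ?A" for K using that subspace_hyp[OF W] by auto
    show "B (t *\<^sub>R x) = t ^ d * B x" for x t
      by (simp add: B_def prod.distrib d flip: power_mult_distrib)
    show "\<alpha> \<bullet> \<psi> x = \<kappa> * B x" if "x \<in> ?H" for x using \<psi>(3)[OF that] by (simp add: B_def)
    show "\<exists>h. rpoly h \<and> (\<forall>x\<in>?H. \<alpha> \<bullet> X x = B x * h x)" if X: "X \<in> tangent W ?A" for X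
      unfolding B_def
    proof (rule tangent_pencil_dvd[OF W z T _ _ \<rho>(4) \<rho>(2) \<rho>(3) _ _ _ X])
      show "hyp W \<tau> \<in> ?A" if "\<tau> \<in> T" for \<tau> using that TS by auto
      show "hyp W (\<rho> \<tau>) \<in> ?A" if "\<tau> \<in> T" for \<tau> using \<rho>(1)[OF that] RS by auto
      show "\<exists>x\<in>?H. \<rho> \<tau> \<bullet> x \<noteq> 0" if "\<tau> \<in> T" for \<tau> using R_nz \<rho>(1)[OF that] .
      show "\<exists>x\<in>hyp W \<tau>. \<sigma> \<bullet> x \<noteq> 0" if "\<tau> \<in> T" "\<sigma> \<in> T" "\<tau> \<noteq> \<sigma>" for \<tau> \<sigma>
        using T_sep[OF that] by (auto simp: mem_hyp)
      show "\<exists>x\<in>?H. \<rho> \<tau> \<bullet> x = 0 \<and> \<rho> \<sigma> \<bullet> x \<noteq> 0" if "\<tau> \<in> T" "\<sigma> \<in> T" "\<rho> \<tau> \<noteq> \<rho> \<sigma>" for \<tau> \<sigma>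
        using R_sep[OF \<rho>(1) \<rho>(1)] that by blast
    qed
  qed
  have C: "central_arrangement W (insert ?H ?A)"
    using central_arrangement_hyp[OF W, of "insert \<alpha> S"] S z by auto
  have del: "insert ?H ?A - {?H} = ?A" using new by auto
  have "?H \<inter> hyp W \<sigma> = hyp ?H \<sigma>" for \<sigma> by (auto simp: hyp_def)
  then have res: "(\<lambda>K. ?H \<inter> K) ` ?A = hyp ?H ` S'"
    unfolding restr(2) by (simp add: image_image)
  have "inductively_free W (insert ?H ?A)"
  proof (rule inductively_free.add_hyperplane[OF C, of ?H])
    show "inductively_free W (insert ?H ?A - {?H})" unfolding del by (rule ifreeD(4)[OF free])
    show "inductively_free ?H ((\<lambda>K. ?H \<inter> K) ` (insert ?H ?A - {?H}))"
      unfolding del res by (rule ifreeD(4)[OF restr(1)])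
    show "free_with_exponents W (insert ?H ?A - {?H}) (add_mset d F)"
      unfolding del by (rule ifree_free_with_exponents[OF free])
    show "free_with_exponents ?H ((\<lambda>K. ?H \<inter> K) ` (insert ?H ?A - {?H})) F"
      unfolding del res by (rule ifree_free_with_exponents[OF restr(1)])
  qed auto
  then show ?thesis
    unfolding ifree_def using W S z vf by auto
qed

text \<open>The vector \<open>v\<close> is the direction of the row coordinate: the lower forms
  \<open>R\<close> do not see it, and every form of the row takes the value 1 on it. Restriction to
  any form of the row leaves \<open>R\<close> with exponents \<open>F\<close>, so all additions
  raise the one exponent outside \<open>F\<close>, from 0 to \<open>card T\<close>.\<close>

lemma ifree_row:
  fixes W :: "'a::euclidean_space set"
  assumes v: "v \<in> W" and T: "finite T"
    and Rv: "\<And>\<rho>. \<rho> \<in> R \<Longrightarrow> \<rho> \<bullet> v = 0" and Tv: "\<And>\<tau>. \<tau> \<in> T \<Longrightarrow> \<tau> \<bullet> v = 1"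
    and R_sep: "\<And>\<rho> \<sigma>. \<rho> \<in> R \<Longrightarrow> \<sigma> \<in> R \<Longrightarrow> \<rho> \<noteq> \<sigma> \<Longrightarrow> \<exists>x\<in>W. \<rho> \<bullet> x = 0 \<and> \<sigma> \<bullet> x \<noteq> 0"
    and diff: "\<And>\<tau> \<sigma>. \<tau> \<in> T \<Longrightarrow> \<sigma> \<in> T \<Longrightarrow> \<tau> \<noteq> \<sigma> \<Longrightarrow> \<exists>\<rho>\<in>R. \<exists>c. \<tau> - \<sigma> = c *\<^sub>R \<rho>"
    and free: "ifree W R (add_mset 0 F)" and restr: "\<And>\<tau>. \<tau> \<in> T \<Longrightarrow> ifree (hyp W \<tau>) R F"
  shows "ifree W (R \<union> T) (add_mset (card T) F)"
  using T Tv diff restr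
proof (induction T)
  case empty
  then show ?case using free by simp
next
  case (insert \<tau>0 T)
  note W = ifreeD(1)[OF free]
  have pv: "\<tau>0 \<bullet> v = 1" using insert.prems(1) by simp
  define \<pi> where "\<pi> = (\<lambda>\<tau> x. x - (\<tau> \<bullet> x) *\<^sub>R v)"
  have \<pi>: "\<pi> \<tau> x \<in> hyp W \<tau>" if "x \<in> W" "\<tau> \<bullet> v = 1" for \<tau> x
    using that v W by (simp add: \<pi>_def mem_hyp subspace_diff subspace_scale inner_diff_right)
  have R\<pi>: "\<rho> \<bullet> \<pi> \<tau> x = \<rho> \<bullet> x" if "\<rho> \<in> R" for \<rho> \<tau> x
    using Rv[OF that] by (simp add: \<pi>_def inner_diff_right)
  have T_sep: "\<exists>x\<in>hyp W \<tau>. \<sigma> \<bullet> x \<noteq> 0"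
    if t: "\<tau> \<in> insert \<tau>0 T" "\<sigma> \<in> insert \<tau>0 T" "\<tau> \<noteq> \<sigma>" for \<tau> \<sigma>
  proof -
    obtain \<rho> c where \<rho>: "\<rho> \<in> R" "\<sigma> - \<tau> = c *\<^sub>R \<rho>" using insert.prems(2)[OF t(2,1)] t(3) by blast
    have "c \<noteq> 0" using \<rho>(2) t(3) by auto
    obtain x where x: "x \<in> W" "\<rho> \<bullet> x \<noteq> 0" using ifreeD(3)[OF free \<rho>(1)] by blast
    have y: "\<pi> \<tau> x \<in> hyp W \<tau>" using \<pi>[OF x(1)] insert.prems(1)[OF t(1)] .
    have "\<sigma> \<bullet> \<pi> \<tau> x = (\<sigma> - \<tau>) \<bullet> \<pi> \<tau> x" using y by (simp add: mem_hyp inner_diff_left)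
    also have "\<dots> \<noteq> 0" unfolding \<rho>(2) using R\<pi>[OF \<rho>(1)] x(2) \<open>c \<noteq> 0\<close> by simp
    finally show ?thesis using y by blast
  qed
  have IH: "ifree W (R \<union> T) (add_mset (card T) F)"
    by (rule insert.IH) (use insert.prems in auto)
  have rel: "\<exists>\<rho>\<in>R. \<exists>c. c \<noteq> 0 \<and> \<tau> = \<tau>0 + c *\<^sub>R \<rho>" if t: "\<tau> \<in> T" for \<tau>
  proof -
    have ne: "\<tau> \<noteq> \<tau>0" using t insert.hyps(2) by auto
    then obtain \<rho> c where \<rho>: "\<rho> \<in> R" "\<tau> - \<tau>0 = c *\<^sub>R \<rho>" using insert.prems(2)[of \<tau> \<tau>0] t by auto
    then show ?thesis using ne by (intro bexI[of _ \<rho>] exI[of _ c]) (auto simp: algebra_simps)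
  qed
  let ?H = "hyp W \<tau>0"
  have "ifree W (insert \<tau>0 (R \<union> T)) (add_mset (Suc (card T)) F)"
  proof (rule ifree_step[OF IH v])
    show "\<tau>0 \<bullet> v \<noteq> 0" using pv by simp
    show "hyp W \<sigma> \<noteq> ?H" if "\<sigma> \<in> R \<union> T" for \<sigma>
    proof (cases "\<sigma> \<in> R")
      case True
      then have "v \<in> hyp W \<sigma>" "v \<notin> ?H" using Rv v pv by (auto simp: mem_hyp)
      then show ?thesis by blast
    next
      case False
      then have "\<sigma> \<in> insert \<tau>0 T" "\<tau>0 \<noteq> \<sigma>" using that insert.hyps(2) by auto
      then show ?thesis using T_sep[of \<tau>0 \<sigma>] by (auto simp: mem_hyp)
    qed
    show "ifree ?H R F" using insert.prems(3) by simp
    show "hyp ?H ` R = hyp ?H ` (R \<union> T)"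
    proof -
      have "hyp ?H \<tau> \<in> hyp ?H ` R" if t: "\<tau> \<in> T" for \<tau>
      proof -
        obtain \<rho> c where "\<rho> \<in> R" "c \<noteq> 0" "\<tau> = \<tau>0 + c *\<^sub>R \<rho>" using rel[OF t] by blast
        then have "hyp ?H \<tau> = hyp ?H \<rho>" by (auto simp: hyp_def inner_add_left)
        then show ?thesis using \<open>\<rho> \<in> R\<close> by blast
      qed
      then show ?thesis by auto
    qed
    show "\<exists>x\<in>?H. \<rho> \<bullet> x \<noteq> 0" if "\<rho> \<in> R" for \<rho>
      using ifreeD(3)[OF free that] \<pi>[OF _ pv] R\<pi>[OF that] by metis
    show "\<exists>x\<in>?H. \<rho> \<bullet> x = 0 \<and> \<sigma> \<bullet> x \<noteq> 0" if "\<rho> \<in> R" "\<sigma> \<in> R" "\<rho> \<noteq> \<sigma>" for \<rho> \<sigma>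
      using R_sep[OF that] \<pi>[OF _ pv] R\<pi>[OF that(1)] R\<pi>[OF that(2)] by metis
    show "\<exists>x\<in>W. \<rho> \<bullet> x = 0 \<and> \<sigma> \<bullet> x \<noteq> 0" if "\<rho> \<in> T" "\<sigma> \<in> T" "\<rho> \<noteq> \<sigma>" for \<rho> \<sigma>
      using T_sep[of \<rho> \<sigma>] that by (auto simp: mem_hyp)
    show "\<exists>\<rho>\<in>R. \<exists>a c. a \<noteq> 0 \<and> c \<noteq> 0 \<and> \<tau> = a *\<^sub>R \<tau>0 + c *\<^sub>R \<rho>" if "\<tau> \<in> T" for \<tau>
      using rel[OF that] by (metis scaleR_one zero_neq_one)
    \<comment> \<open>A multiple of \<open>v\<close> is tangent to the hyperplanes of
      \<open>R\<close>, and the coefficient vanishes on those of \<open>T\<close>.\<close>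
    show "(\<lambda>x. (\<Prod>\<tau>\<in>T. \<tau> \<bullet> x) *\<^sub>R v) \<in> tangent W (hyp W ` (R \<union> T))"
    proof (rule tangentI)
      show "polynomial_function (\<lambda>x. (\<Prod>\<tau>\<in>T. \<tau> \<bullet> x) *\<^sub>R v)"
        by (intro polynomial_function_scaleR rpoly_prod_inner insert.hyps) auto
      show inW: "(\<Prod>\<tau>\<in>T. \<tau> \<bullet> x) *\<^sub>R v \<in> W" for x using W v by (simp add: subspace_scale)
      fix K x assume K: "K \<in> hyp W ` (R \<union> T)" and x: "x \<in> K"
      then obtain \<sigma> where \<sigma>: "\<sigma> \<in> R \<union> T" "K = hyp W \<sigma>" by auto
      have "(\<Prod>\<tau>\<in>T. \<tau> \<bullet> x) * (\<sigma> \<bullet> v) = 0"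
      proof (cases "\<sigma> \<in> R")
        case True
        then show ?thesis using Rv by simp
      next
        case False
        then have "\<sigma> \<in> T" "\<sigma> \<bullet> x = 0" using \<sigma> x by (auto simp: mem_hyp)
        then have "(\<Prod>\<tau>\<in>T. \<tau> \<bullet> x) = 0" using insert.hyps(1) by (intro prod_zero) auto
        then show ?thesis by simp
      qed
      then show "(\<Prod>\<tau>\<in>T. \<tau> \<bullet> x) *\<^sub>R v \<in> K" using inW \<sigma>(2) by (auto simp: mem_hyp)
    qed
    show "\<tau>0 \<bullet> (\<Prod>\<tau>\<in>T. \<tau> \<bullet> x) *\<^sub>R v = 1 * (\<Prod>\<tau>\<in>T. \<tau> \<bullet> x)" for x using pv by simp
  qed auto
  then show ?case using insert.hyps by simp
qed

text \<open>The vector \<open>u k\<close> acts as the partial derivative along the coordinate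
  \<open>e k\<close>. Only the coordinates in \<open>J\<close> have to be independent on
  \<open>W\<close>; the vectors \<open>e k\<close> need be neither orthogonal nor elements of
  \<open>W\<close>.\<close>

definition dual_on :: "'a::euclidean_space set \<Rightarrow> (nat \<Rightarrow> 'a) \<Rightarrow> nat set \<Rightarrow> (nat \<Rightarrow> 'a) \<Rightarrow> bool" where
  "dual_on W e J u \<longleftrightarrow> (\<forall>k\<in>J. u k \<in> W \<and> (\<forall>l\<in>J. e l \<bullet> u k = (if l = k then 1 else 0)))"

lemma dual_on_subset: "dual_on W e J u \<Longrightarrow> K \<subseteq> J \<Longrightarrow> dual_on W e K u"
  unfolding dual_on_def by blast

text \<open>The coordinate \<open>i\<close> is eliminated by the equation of the kernel: the other
  dual vectors are moved into the kernel along \<open>u i\<close>, which the remaining coordinates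
  do not notice.\<close>

lemma dual_on_hyp:
  assumes "subspace W" "dual_on W e J u" "i \<in> J" "\<alpha> \<bullet> u i = 1"
  shows "dual_on (hyp W \<alpha>) e (J - {i}) (\<lambda>k. u k - (\<alpha> \<bullet> u k) *\<^sub>R u i)"
  using assms unfolding dual_on_def
  by (auto simp: mem_hyp subspace_diff subspace_scale inner_diff_right)

lemma dual_on_point:
  assumes W: "subspace W" and u: "dual_on W e J u" and J: "finite J"
  shows "(\<Sum>k\<in>J. y k *\<^sub>R u k) \<in> W" "l \<in> J \<Longrightarrow> e l \<bullet> (\<Sum>k\<in>J. y k *\<^sub>R u k) = y l"
proof -
  show "(\<Sum>k\<in>J. y k *\<^sub>R u k) \<in> W"
    using u W by (intro subspace_sum subspace_scale) (auto simp: dual_on_def)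
  assume l: "l \<in> J"
  have "e l \<bullet> (\<Sum>k\<in>J. y k *\<^sub>R u k) = (\<Sum>k\<in>J. if k = l then y k else 0)"
    unfolding inner_sum_right using u l by (intro sum.cong) (auto simp: dual_on_def)
  then show "e l \<bullet> (\<Sum>k\<in>J. y k *\<^sub>R u k) = y l" using J l by simp
qed

section \<open>Formal signed roots and their linear forms\<close>

datatype froot = Minus nat nat | Plus nat nat | Single nat

fun froot_row :: "froot \<Rightarrow> nat" where
  "froot_row (Minus i j) = i"
| "froot_row (Plus i j) = i"
| "froot_row (Single i) = i"

fun froot_vec :: "(nat \<Rightarrow> 'a::euclidean_space) \<Rightarrow> froot \<Rightarrow> 'a" where
  "froot_vec e (Minus i j) = e i - e j"
| "froot_vec e (Plus i j) = e i + e j"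
| "froot_vec e (Single i) = e i"

fun froot_over :: "nat set \<Rightarrow> froot \<Rightarrow> bool" where
  "froot_over J (Minus i j) \<longleftrightarrow> i \<in> J \<and> j \<in> J \<and> i < j"
| "froot_over J (Plus i j) \<longleftrightarrow> i \<in> J \<and> j \<in> J \<and> i < j"
| "froot_over J (Single i) \<longleftrightarrow> i \<in> J"

lemma finite_over: "finite J \<Longrightarrow> finite {r. froot_over J r}"
proof -
  assume J: "finite J"
  have "{r. froot_over J r} \<subseteq> (\<lambda>(i, j). Minus i j) ` (J \<times> J) \<union> (\<lambda>(i, j). Plus i j) ` (J \<times> J) \<union> Single ` J"
  proof
    fix r assume "r \<in> {r. froot_over J r}"
    then show "r \<in> (\<lambda>(i, j). Minus i j) ` (J \<times> J) \<union> (\<lambda>(i, j). Plus i j) ` (J \<times> J) \<union> Single ` J"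
      by (cases r) auto
  qed
  then show ?thesis by (rule finite_subset) (use J in auto)
qed

lemma vec_separate:
  assumes W: "subspace W" and u: "dual_on W e J u" and J: "finite J"
    and r: "froot_over J r" and q: "froot_over J q" and ne: "r \<noteq> q"
  shows "\<exists>x\<in>W. froot_vec e r \<bullet> x = 0 \<and> froot_vec e q \<bullet> x \<noteq> 0"
proof -
  \<comment> \<open>Distinct powers of two never agree up to sign. The row coordinate of
    \<open>r\<close> is then reset so that \<open>r\<close> vanishes: it equals, up to sign, the
    coordinate at the second index of \<open>r\<close>, or is 0 for \<open>Single\<close>. A second
    index exceeds the row index, so no other form can vanish at this point.\<close>
  define y :: "nat \<Rightarrow> real" where "y = (\<lambda>k. if k = froot_row r then
    (case r of Minus i j \<Rightarrow> 2 ^ j | Plus i j \<Rightarrow> - (2 ^ j) | Single i \<Rightarrow> 0) else 2 ^ k)"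
  let ?x = "\<Sum>k\<in>J. y k *\<^sub>R u k"
  have x: "?x \<in> W" "\<And>l. l \<in> J \<Longrightarrow> e l \<bullet> ?x = y l" using dual_on_point[OF W u J] by auto
  have pos: "(2::real) ^ a + 2 ^ b \<noteq> 0" "- ((2::real) ^ a) - 2 ^ b \<noteq> 0" "(2::real) ^ a \<noteq> - (2 ^ b)" for a b :: nat
    using add_pos_pos[of "(2::real) ^ a" "2 ^ b"] by (auto simp: eq_neg_iff_add_eq_0)
  have "froot_vec e r \<bullet> ?x = 0"
    using r x(2) by (cases r) (auto simp: y_def inner_diff_left inner_add_left)
  moreover have "froot_vec e q \<bullet> ?x \<noteq> 0"
  proof (cases q)
    case (Minus a b)
    then have "froot_vec e q \<bullet> ?x = y a - y b" "a < b" using q x(2) by (auto simp: inner_diff_left)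
    then show ?thesis using r ne Minus pos by (cases r) (auto simp: y_def)
  next
    case (Plus a b)
    then have "froot_vec e q \<bullet> ?x = y a + y b" "a < b" using q x(2) by (auto simp: inner_add_left)
    then show ?thesis using r ne Plus pos by (cases r) (auto simp: y_def)
  next
    case (Single a)
    then have "froot_vec e q \<bullet> ?x = y a" using q x(2) by auto
    then show ?thesis using r ne Single by (cases r) (auto simp: y_def)
  qed
  ultimately show ?thesis using x(1) by blast
qed

lemma vec_inj_on:
  assumes "subspace W" "dual_on W e J u" "finite J"
  shows "inj_on (froot_vec e) {r. froot_over J r}"
  using vec_separate[OF assms] by (auto simp: inj_on_def) metis

lemma vec_nonzero:
  assumes W: "subspace W" and u: "dual_on W e J u" and r: "froot_over J r"
  shows "\<exists>x\<in>W. froot_vec e r \<bullet> x \<noteq> 0"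
proof -
  have "froot_row r \<in> J" using r by (cases r) auto
  then have "u (froot_row r) \<in> W" "froot_vec e r \<bullet> u (froot_row r) = 1"
    using u r by (cases r; auto simp: dual_on_def inner_diff_left inner_add_left)+
  then show ?thesis by force
qed

text \<open>The clauses run through the pairs of distinct forms in one row; each demands the form
  that is proportional to their difference, as required by \<open>ifree_row\<close>.\<close>

definition row_closed :: "froot set \<Rightarrow> bool" where
  "row_closed L \<longleftrightarrow>
     (\<forall>i j k. Minus i j \<in> L \<longrightarrow> Minus i k \<in> L \<longrightarrow> j < k \<longrightarrow> Minus j k \<in> L) \<and>
     (\<forall>i j k. Plus i j \<in> L \<longrightarrow> Plus i k \<in> L \<longrightarrow> j < k \<longrightarrow> Minus j k \<in> L) \<and>
     (\<forall>i j k. Minus i j \<in> L \<longrightarrow> Plus i k \<in> L \<longrightarrow> j < k \<longrightarrow> Plus j k \<in> L) \<and>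
     (\<forall>i j k. Minus i j \<in> L \<longrightarrow> Plus i k \<in> L \<longrightarrow> k < j \<longrightarrow> Plus k j \<in> L) \<and>
     (\<forall>i j. Minus i j \<in> L \<longrightarrow> Plus i j \<in> L \<longrightarrow> Single j \<in> L) \<and>
     (\<forall>i j. Minus i j \<in> L \<longrightarrow> Single i \<in> L \<longrightarrow> Single j \<in> L) \<and>
     (\<forall>i j. Plus i j \<in> L \<longrightarrow> Single i \<in> L \<longrightarrow> Single j \<in> L)"

lemma row_closedD:
  assumes "row_closed L"
  shows "Minus i j \<in> L \<Longrightarrow> Minus i k \<in> L \<Longrightarrow> j < k \<Longrightarrow> Minus j k \<in> L"
    and "Plus i j \<in> L \<Longrightarrow> Plus i k \<in> L \<Longrightarrow> j < k \<Longrightarrow> Minus j k \<in> L"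
    and "Minus i j \<in> L \<Longrightarrow> Plus i k \<in> L \<Longrightarrow> j < k \<Longrightarrow> Plus j k \<in> L"
    and "Minus i j \<in> L \<Longrightarrow> Plus i k \<in> L \<Longrightarrow> k < j \<Longrightarrow> Plus k j \<in> L"
    and "Minus i j \<in> L \<Longrightarrow> Plus i j \<in> L \<Longrightarrow> Single j \<in> L"
    and "Minus i j \<in> L \<Longrightarrow> Single i \<in> L \<Longrightarrow> Single j \<in> L"
    and "Plus i j \<in> L \<Longrightarrow> Single i \<in> L \<Longrightarrow> Single j \<in> L"
proof -
  note c = assms[unfolded row_closed_def]
  show "Minus i j \<in> L \<Longrightarrow> Minus i k \<in> L \<Longrightarrow> j < k \<Longrightarrow> Minus j k \<in> L"
    by (rule c[THEN conjunct1, rule_format])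
  show "Plus i j \<in> L \<Longrightarrow> Plus i k \<in> L \<Longrightarrow> j < k \<Longrightarrow> Minus j k \<in> L"
    by (rule c[THEN conjunct2, THEN conjunct1, rule_format])
  show "Minus i j \<in> L \<Longrightarrow> Plus i k \<in> L \<Longrightarrow> j < k \<Longrightarrow> Plus j k \<in> L"
    by (rule c[THEN conjunct2, THEN conjunct2, THEN conjunct1, rule_format])
  show "Minus i j \<in> L \<Longrightarrow> Plus i k \<in> L \<Longrightarrow> k < j \<Longrightarrow> Plus k j \<in> L"
    by (rule c[THEN conjunct2, THEN conjunct2, THEN conjunct2, THEN conjunct1, rule_format])
  show "Minus i j \<in> L \<Longrightarrow> Plus i j \<in> L \<Longrightarrow> Single j \<in> L"
    by (rule c[THEN conjunct2, THEN conjunct2, THEN conjunct2, THEN conjunct2, THEN conjunct1, rule_format])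
  show "Minus i j \<in> L \<Longrightarrow> Single i \<in> L \<Longrightarrow> Single j \<in> L"
    by (rule c[THEN conjunct2, THEN conjunct2, THEN conjunct2, THEN conjunct2, THEN conjunct2, THEN conjunct1, rule_format])
  show "Plus i j \<in> L \<Longrightarrow> Single i \<in> L \<Longrightarrow> Single j \<in> L"
    by (rule c[THEN conjunct2, THEN conjunct2, THEN conjunct2, THEN conjunct2, THEN conjunct2, THEN conjunct2, rule_format])
qed

lemma row_closed_diff:
  assumes L: "row_closed L" and r: "r \<in> L" "q \<in> L" "r \<noteq> q" "froot_row r = froot_row q" and ov: "\<And>r. r \<in> L \<Longrightarrow> froot_over J r"
  shows "\<exists>p\<in>L. froot_row p > froot_row r \<and> (\<exists>c. froot_vec e r - froot_vec e q = c *\<^sub>R froot_vec e p)"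
proof -
  define i where "i = froot_row r"
  define P where "P r q \<longleftrightarrow> (\<exists>p\<in>L. froot_row p > i \<and> (\<exists>c. froot_vec e r - froot_vec e q = c *\<^sub>R froot_vec e p))" for r q
  have PI: "P r q" if "p \<in> L" "froot_row p > i" "froot_vec e r - froot_vec e q = c *\<^sub>R froot_vec e p" for r q p c
    using that P_def by blast
  have sym: "P q r" if pq: "P r q" for r q
  proof -
    obtain p c where p: "p \<in> L" "froot_row p > i" "froot_vec e r - froot_vec e q = c *\<^sub>R froot_vec e p"
      using pq unfolding P_def by blast
    have "froot_vec e q - froot_vec e r = (- c) *\<^sub>R froot_vec e p"
      unfolding scaleR_minus_left p(3)[symmetric] by simp
    then show ?thesis using PI p by blast
  qed
  have lt: "i < j" if "Minus i j \<in> L \<or> Plus i j \<in> L" for j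
    using ov[of "Minus i j"] ov[of "Plus i j"] that by auto
  note cl = row_closedD[OF L]
  have MM: "P (Minus i j) (Minus i k)" if "Minus i j \<in> L" "Minus i k \<in> L" "j < k" for j k
    using cl(1)[OF that] that lt by (intro PI[of "Minus j k" _ _ "-1"]) auto
  have PP: "P (Plus i j) (Plus i k)" if "Plus i j \<in> L" "Plus i k \<in> L" "j < k" for j k
    using cl(2)[OF that] that lt by (intro PI[of "Minus j k" _ _ 1]) auto
  have MP: "P (Minus i j) (Plus i k)" if mp: "Minus i j \<in> L" "Plus i k \<in> L" for j k
  proof -
    consider "j < k" "Plus j k \<in> L" | "k < j" "Plus k j \<in> L" | "j = k" "Single j \<in> L"
      using cl(3)[OF mp] cl(4)[OF mp] cl(5)[of i j] mp by (cases j k rule: linorder_cases) auto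
    then show ?thesis
    proof cases
      case 1
      then show ?thesis using lt that by (intro PI[of "Plus j k" _ _ "-1"]) auto
    next
      case 2
      then show ?thesis using lt that by (intro PI[of "Plus k j" _ _ "-1"]) auto
    next
      case 3
      then show ?thesis using lt that by (intro PI[of "Single j" _ _ "-2"]) (auto simp: scaleR_2)
    qed
  qed
  have MS: "P (Minus i j) (Single i)" if "Minus i j \<in> L" "Single i \<in> L" for j
    using cl(6)[OF that] that lt by (intro PI[of "Single j" _ _ "-1"]) auto
  have PS: "P (Plus i j) (Single i)" if "Plus i j \<in> L" "Single i \<in> L" for j
    using cl(7)[OF that] that lt by (intro PI[of "Single j" _ _ 1]) auto
  have "P r q"
  proof (cases r)
    case (Minus a j)
    then have [simp]: "a = i" by (simp add: i_def)
    show ?thesis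
    proof (cases q)
      case q: (Minus b k)
      then have "b = i" "j \<noteq> k" using r Minus by auto
      then show ?thesis using MM[of j k] sym[OF MM[of k j]] r q Minus by (cases "j < k") auto
    qed (use r Minus MP MS in auto)
  next
    case (Plus a j)
    then have [simp]: "a = i" by (simp add: i_def)
    show ?thesis
    proof (cases q)
      case q: (Plus b k)
      then have "b = i" "j \<noteq> k" using r Plus by auto
      then show ?thesis using PP[of j k] sym[OF PP[of k j]] r q Plus by (cases "j < k") auto
    qed (use r Plus sym MP PS in auto)
  next
    case (Single a)
    then have [simp]: "a = i" by (simp add: i_def)
    show ?thesis
      by (cases q) (use r Single sym MS PS in auto)
  qed
  then show ?thesis by (simp add: P_def i_def)
qed

section \<open>Rows of signed roots\<close>

lemma vec_orthogonal_outside: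
  assumes "dual_on W e (insert b J) u" "b \<notin> J" "froot_over J r"
  shows "froot_vec e r \<bullet> u b = 0"
  using assms by (cases r) (auto simp: dual_on_def inner_diff_left inner_add_left)

lemma vec_dual_row:
  assumes "dual_on W e J u" "froot_over J r"
  shows "froot_vec e r \<bullet> u (froot_row r) = 1" "froot_row r \<in> J"
  using assms by (cases r; auto simp: dual_on_def inner_diff_left inner_add_left)+

lemma vec_image_separate:
  assumes W: "subspace W" and u: "dual_on W e J u" and J: "finite J"
    and R: "\<And>r. r \<in> R \<Longrightarrow> froot_over J r"
    and \<rho>: "\<rho> \<in> froot_vec e ` R" "\<sigma> \<in> froot_vec e ` R" "\<rho> \<noteq> \<sigma>"
  shows "\<exists>x\<in>W. \<rho> \<bullet> x = 0 \<and> \<sigma> \<bullet> x \<noteq> 0"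
proof -
  obtain r q where rq: "\<rho> = froot_vec e r" "\<sigma> = froot_vec e q" "r \<in> R" "q \<in> R" using \<rho>(1,2) by blast
  then show ?thesis using vec_separate[OF W u J R R, of r q] \<rho>(3) by auto
qed

lemma ifree_froot_row:
  assumes J: "finite J" and b: "\<And>j. j \<in> J \<Longrightarrow> b < j"
    and M: "\<And>r. r \<in> M \<Longrightarrow> froot_over J r"
    and N: "\<And>r. r \<in> N \<Longrightarrow> froot_over (insert b J) r" "\<And>r. r \<in> N \<Longrightarrow> froot_row r = b"
    and diff: "\<And>r q. r \<in> N \<Longrightarrow> q \<in> N \<Longrightarrow> r \<noteq> q \<Longrightarrow> \<exists>p\<in>M. \<exists>c. froot_vec e r - froot_vec e q = c *\<^sub>R froot_vec e p"
    and IH: "\<And>W u z. subspace W \<Longrightarrow> dual_on W e J u \<Longrightarrow> dim W = card J + z \<Longrightarrow>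
      ifree W (froot_vec e ` M) (E + replicate_mset z 0)"
    and W: "subspace W" "dual_on W e (insert b J) u" "dim W = card (insert b J) + z"
  shows "ifree W (froot_vec e ` (M \<union> N)) (add_mset (card N) (E + replicate_mset z 0))"
proof -
  have bJ: "b \<notin> J" using b by blast
  have J': "finite (insert b J)" using J by simp
  have inj: "inj_on (froot_vec e) N"
    using vec_inj_on[OF W(1,2) J'] by (rule inj_on_subset) (use N in auto)
  have MJ: "froot_over (insert b J) r" if "r \<in> M" for r using M[OF that] by (cases r) auto
  have finN: "finite N"
    by (rule finite_subset[OF _ finite_over[OF J']]) (use N in auto)
  have "ifree W (froot_vec e ` M \<union> froot_vec e ` N) (add_mset (card (froot_vec e ` N)) (E + replicate_mset z 0))"
  proof (rule ifree_row[where v = "u b"])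
    show "u b \<in> W" using W(2) by (simp add: dual_on_def)
    show "finite (froot_vec e ` N)" using finN by simp
    show "\<rho> \<bullet> u b = 0" if "\<rho> \<in> froot_vec e ` M" for \<rho>
      using that vec_orthogonal_outside[OF W(2) bJ] M by auto
    show "\<tau> \<bullet> u b = 1" if "\<tau> \<in> froot_vec e ` N" for \<tau>
      using that vec_dual_row(1)[OF W(2)] N by fastforce
    show "\<exists>x\<in>W. \<rho> \<bullet> x = 0 \<and> \<sigma> \<bullet> x \<noteq> 0" if rs: "\<rho> \<in> froot_vec e ` M" "\<sigma> \<in> froot_vec e ` M" "\<rho> \<noteq> \<sigma>" for \<rho> \<sigma>
    proof -
      obtain r q where "\<rho> = froot_vec e r" "\<sigma> = froot_vec e q" "r \<in> M" "q \<in> M" using rs by blast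
      then show ?thesis using vec_separate[OF W(1,2) J', of r q] MJ rs(3) by auto
    qed
    show "\<exists>\<rho>\<in>froot_vec e ` M. \<exists>c. \<tau> - \<sigma> = c *\<^sub>R \<rho>" if "\<tau> \<in> froot_vec e ` N" "\<sigma> \<in> froot_vec e ` N" "\<tau> \<noteq> \<sigma>" for \<tau> \<sigma>
      using that diff by blast
    have "ifree W (froot_vec e ` M) (E + replicate_mset (Suc z) 0)"
      by (rule IH[OF W(1) dual_on_subset[OF W(2)]]) (use W(3) J bJ in auto)
    then show "ifree W (froot_vec e ` M) (add_mset 0 (E + replicate_mset z 0))" by simp
    fix \<tau> assume "\<tau> \<in> froot_vec e ` N"
    then obtain r where r: "r \<in> N" "\<tau> = froot_vec e r" by blast
    have t1: "\<tau> \<bullet> u b = 1" using vec_dual_row(1)[OF W(2) N(1)[OF r(1)]] N(2)[OF r(1)] r(2) by simp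
    have ub: "u b \<in> W" using W(2) by (simp add: dual_on_def)
    have "insert b J - {b} = J" using bJ by auto
    then have "dual_on (hyp W \<tau>) e J (\<lambda>k. u k - (\<tau> \<bullet> u k) *\<^sub>R u b)"
      using dual_on_hyp[OF W(1,2) _ t1] by simp
    moreover have "dim (hyp W \<tau>) = card J + z"
      using dim_hyp[OF W(1) ub, of \<tau>] t1 W(3) J bJ by simp
    ultimately show "ifree (hyp W \<tau>) (froot_vec e ` M) (E + replicate_mset z 0)"
      using IH[OF subspace_hyp[OF W(1)]] by blast
  qed
  then show ?thesis using card_image[OF inj] by (simp add: image_Un)
qed

text \<open>The induction adds an index \<open>b\<close> below all others. Since a form belongs to
  the row of its smaller index, row \<open>b\<close> contains all forms involving \<open>b\<close>,
  and the rest lives over \<open>J\<close>.\<close>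

lemma ifree_row_closed:
  assumes "finite J" "subspace W" "dual_on W e J u" "dim W = card J + z" "row_closed L"
    and "\<And>r. r \<in> L \<Longrightarrow> froot_over J r"
  shows "ifree W (froot_vec e ` L) (image_mset (\<lambda>i. card {r \<in> L. froot_row r = i}) (mset_set J) + replicate_mset z 0)"
  using assms
proof (induction J arbitrary: W u z L rule: finite_linorder_min_induct)
  case empty
  have "L = {}"
  proof (rule equals0I)
    fix r assume "r \<in> L"
    then show False using empty.prems(5)[of r] by (cases r) auto
  qed
  then show ?case using ifree_empty[OF empty.prems(1)] empty.prems(3) by simp
next
  case (insert b J)
  define M N where "M = {r \<in> L. froot_row r \<noteq> b}" and "N = {r \<in> L. froot_row r = b}"
  have lt: "froot_row r < j \<and> j \<in> J" if "r \<in> L" "r = Minus (froot_row r) j \<or> r = Plus (froot_row r) j" for r j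
    using insert.prems(5)[OF that(1)] that(2) insert.hyps(2) by (cases r) auto
  have le: "b \<le> froot_row r" if "r \<in> L" for r
    using insert.prems(5)[OF that] insert.hyps(2) by (cases r) auto
  have gt: "b < j" if "Minus i j \<in> L \<or> Plus i j \<in> L" for i j
    using that lt[of "Minus i j" j] lt[of "Plus i j" j] le[of "Minus i j"] le[of "Plus i j"] by auto
  have Msub: "r \<in> M" if "r \<in> L" "froot_row r \<noteq> b" for r using that by (simp add: M_def)
  have inL: "r \<in> L" if "r \<in> M" for r using that by (simp add: M_def)
  have cM: "row_closed M"
    unfolding row_closed_def
  proof (intro conjI allI impI)
    note cl = row_closedD[OF insert.prems(4)]
    fix i j k
    show "Minus j k \<in> M" if "Minus i j \<in> M" "Minus i k \<in> M" "j < k"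
      using cl(1)[OF inL[OF that(1)] inL[OF that(2)] that(3)] gt[of i j] inL[OF that(1)] by (intro Msub) auto
    show "Minus j k \<in> M" if "Plus i j \<in> M" "Plus i k \<in> M" "j < k"
      using cl(2)[OF inL[OF that(1)] inL[OF that(2)] that(3)] gt[of i j] inL[OF that(1)] by (intro Msub) auto
    show "Plus j k \<in> M" if "Minus i j \<in> M" "Plus i k \<in> M" "j < k"
      using cl(3)[OF inL[OF that(1)] inL[OF that(2)] that(3)] gt[of i j] inL[OF that(1)] by (intro Msub) auto
    show "Plus k j \<in> M" if "Minus i j \<in> M" "Plus i k \<in> M" "k < j"
      using cl(4)[OF inL[OF that(1)] inL[OF that(2)] that(3)] gt[of i k] inL[OF that(2)] by (intro Msub) auto
    show "Single j \<in> M" if "Minus i j \<in> M" "Plus i j \<in> M"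
      using cl(5)[OF inL[OF that(1)] inL[OF that(2)]] gt[of i j] inL[OF that(1)] by (intro Msub) auto
    show "Single j \<in> M" if "Minus i j \<in> M" "Single i \<in> M"
      using cl(6)[OF inL[OF that(1)] inL[OF that(2)]] gt[of i j] inL[OF that(1)] by (intro Msub) auto
    show "Single j \<in> M" if "Plus i j \<in> M" "Single i \<in> M"
      using cl(7)[OF inL[OF that(1)] inL[OF that(2)]] gt[of i j] inL[OF that(1)] by (intro Msub) auto
  qed
  have bJ: "b \<notin> J" using insert.hyps(2) by blast
  have MJ: "froot_over J r" if "r \<in> M" for r
  proof -
    have "froot_over (insert b J) r" "froot_row r \<noteq> b" "b \<le> froot_row r"
      using that insert.prems(5) le by (auto simp: M_def)
    then show ?thesis by (cases r) auto
  qed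
  let ?E = "image_mset (\<lambda>i. card {r \<in> M. froot_row r = i}) (mset_set J)"
  have "ifree W (froot_vec e ` (M \<union> N)) (add_mset (card N) (?E + replicate_mset z 0))"
  proof (rule ifree_froot_row[OF insert.hyps(1) _ MJ _ _ _ _ insert.prems(1-3)])
    show "b < j" if "j \<in> J" for j using insert.hyps(2) that by blast
    show "froot_over (insert b J) r" "froot_row r = b" if "r \<in> N" for r
      using that insert.prems(5) by (auto simp: N_def)
    show "\<exists>p\<in>M. \<exists>c. froot_vec e r - froot_vec e q = c *\<^sub>R froot_vec e p" if rq: "r \<in> N" "q \<in> N" "r \<noteq> q" for r q
    proof -
      have "r \<in> L" "q \<in> L" "froot_row r = froot_row q" "froot_row r = b" using rq by (auto simp: N_def)
      then obtain p where "p \<in> L" "froot_row p > b" "\<exists>c. froot_vec e r - froot_vec e q = c *\<^sub>R froot_vec e p"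
        using row_closed_diff[OF insert.prems(4) _ _ rq(3) _ insert.prems(5)] by metis
      then show ?thesis using Msub by auto
    qed
    show "ifree W' (froot_vec e ` M) (?E + replicate_mset z' 0)"
      if "subspace W'" "dual_on W' e J u'" "dim W' = card J + z'" for W' u' z'
      using insert.IH[OF that cM MJ] .
  qed
  moreover have "?E = image_mset (\<lambda>i. card {r \<in> L. froot_row r = i}) (mset_set J)"
    using bJ insert.hyps(1) by (intro image_mset_cong arg_cong[of _ _ card]) (auto simp: M_def)
  moreover have "M \<union> {r \<in> L. froot_row r = b} = L" by (auto simp: M_def)
  ultimately show ?case using insert.hyps(1) bJ by (simp add: N_def)
qed

text \<open>This is the gradient of the product of the coordinates, expressed in the dual vectors.
  On \<open>e i \<bullet> x = s * (e l \<bullet> x)\<close> with a sign \<open>s\<close> its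
  components at \<open>i\<close> and \<open>l\<close> are related by the same sign, so it is tangent
  there. On a coordinate hyperplane it is not tangent: its normal component is the product of the
  other coordinates.\<close>

definition pm_field :: "(nat \<Rightarrow> 'a::euclidean_space) \<Rightarrow> nat set \<Rightarrow> (nat \<Rightarrow> 'a) \<Rightarrow> 'a \<Rightarrow> 'a" where
  "pm_field e J u x = (\<Sum>k\<in>J. (\<Prod>l\<in>J - {k}. e l \<bullet> x) *\<^sub>R u k)"

lemma polynomial_pm_field: "finite J \<Longrightarrow> polynomial_function (pm_field e J u)"
  unfolding pm_field_def
  by (intro polynomial_function_sum polynomial_function_scaleR real_polynomial_function_prod rpoly_inner) auto

lemma pm_field_swap:
  assumes "finite J" "k \<in> J" "l \<in> J" "k \<noteq> l" "e k \<bullet> x = s * (e l \<bullet> x)" "s * s = 1"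
  shows "(\<Prod>m\<in>J - {k}. e m \<bullet> x) = s * (\<Prod>m\<in>J - {l}. e m \<bullet> x)"
proof -
  have "(\<Prod>m\<in>J - {k}. e m \<bullet> x) = (e l \<bullet> x) * (\<Prod>m\<in>J - {k} - {l}. e m \<bullet> x)"
    using assms by (subst prod.remove[of _ l]) auto
  moreover have "(\<Prod>m\<in>J - {l}. e m \<bullet> x) = (e k \<bullet> x) * (\<Prod>m\<in>J - {k} - {l}. e m \<bullet> x)"
  proof -
    have "J - {k} - {l} = J - {l} - {k}" by blast
    then show ?thesis using assms by (simp add: prod.remove[of "J - {l}" k])
  qed
  ultimately show ?thesis using assms(5,6) by (simp add: mult.assoc[symmetric])
qed

lemma pm_field_inner:
  assumes "subspace W" "dual_on W e J u" "finite J" "l \<in> J"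
  shows "e l \<bullet> pm_field e J u x = (\<Prod>m\<in>J - {l}. e m \<bullet> x)"
  unfolding pm_field_def by (rule dual_on_point(2)[OF assms])

lemma pm_field_mem:
  assumes "subspace W" "dual_on W e J u" "finite J"
  shows "pm_field e J u x \<in> W"
  unfolding pm_field_def by (rule dual_on_point(1)[OF assms])

lemma pm_field_orthogonal:
  assumes W: "subspace W" and u: "dual_on W e J u" and J: "finite J"
    and r: "froot_over J r" "r \<noteq> Single (froot_row r)" and x: "froot_vec e r \<bullet> x = 0"
  shows "froot_vec e r \<bullet> pm_field e J u x = 0"
proof (cases r)
  case (Minus i j)
  then have ij: "i \<in> J" "j \<in> J" "i \<noteq> j" "e i \<bullet> x = 1 * (e j \<bullet> x)"
    using r(1) x by (auto simp: inner_diff_left)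
  show ?thesis
    using pm_field_swap[OF J ij] pm_field_inner[OF W u J] ij Minus by (simp add: inner_diff_left)
next
  case (Plus i j)
  then have ij: "i \<in> J" "j \<in> J" "i \<noteq> j" "e i \<bullet> x = (-1) * (e j \<bullet> x)"
    using r(1) x by (auto simp: inner_add_left)
  show ?thesis
    using pm_field_swap[OF J ij] pm_field_inner[OF W u J] ij Plus by (simp add: inner_add_left)
qed (use r in auto)

definition minus_of :: "nat \<Rightarrow> nat \<Rightarrow> froot" where
  "minus_of j k = Minus (min j k) (max j k)"

definition plus_of :: "nat \<Rightarrow> nat \<Rightarrow> froot" where
  "plus_of j k = Plus (min j k) (max j k)"

lemma vec_plus_of: "froot_vec e (plus_of j k) = e j + e k"
  by (simp add: plus_of_def min_def max_def add.commute)

lemma vec_minus_of: "froot_vec e (minus_of j k) = (if j \<le> k then 1 else -1) *\<^sub>R (e j - e k)"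
  by (simp add: minus_of_def min_def max_def)

lemma over_pm_of: "j \<in> J \<Longrightarrow> k \<in> J \<Longrightarrow> j \<noteq> k \<Longrightarrow> froot_over J (plus_of j k)"
  "j \<in> J \<Longrightarrow> k \<in> J \<Longrightarrow> j \<noteq> k \<Longrightarrow> froot_over J (minus_of j k)"
  by (auto simp: plus_of_def minus_of_def min_def max_def)

lemma inj_plus_of: "inj_on (plus_of j) K"
  by (auto simp: inj_on_def plus_of_def min_def max_def split: if_splits)

text \<open>On the kernel of \<open>e j\<close> the forms \<open>e j + e k\<close> and
  \<open>e j - e k\<close> both become multiples of \<open>e k\<close>. So \<open>card J - 1\<close>
  pairs of hyperplanes collapse; the plus forms make up \<open>T\<close> and the minus forms
  \<open>R\<close>. The product of \<open>T\<close> agrees there with the normal component of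
  \<open>pm_field\<close>.\<close>

lemma ifree_add_single:
  fixes W :: "'a::euclidean_space set"
  assumes J: "finite J" and W: "subspace W" and u: "dual_on W e J u" and j: "j \<in> J"
    and M: "\<And>r. r \<in> M \<Longrightarrow> froot_over J r" "\<And>i. Single i \<notin> M"
    and Mj: "\<And>k. k \<in> J \<Longrightarrow> k \<noteq> j \<Longrightarrow> plus_of j k \<in> M" "\<And>k. k \<in> J \<Longrightarrow> k \<noteq> j \<Longrightarrow> minus_of j k \<in> M"
    and free: "ifree W (froot_vec e ` M) (add_mset (card J - 1) F)"
    and restr: "ifree (hyp W (e j)) (froot_vec e ` ({r \<in> M. froot_over (J - {j}) r} \<union> Single ` (J - {j}))) F"
  shows "ifree W (insert (e j) (froot_vec e ` M)) (add_mset (card J) F)"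
proof -
  let ?K = "J - {j}" and ?H = "hyp W (e j)"
  have uj: "u j \<in> W" "e j \<bullet> u j = 1" using u j by (auto simp: dual_on_def)
  have Msingle: "r \<noteq> Single (froot_row r)" if "r \<in> M" for r using M(2)[of "froot_row r"] that by metis
  have inj: "inj_on (froot_vec e) {r. froot_over J r}" by (rule vec_inj_on[OF W u J])
  have cT: "card (froot_vec e ` plus_of j ` ?K) = card J - 1"
  proof -
    have "inj_on (froot_vec e) (plus_of j ` ?K)"
      by (rule inj_on_subset[OF inj]) (use over_pm_of j in auto)
    then show ?thesis using J j by (simp add: card_image inj_plus_of)
  qed
  have "ifree W (insert (e j) (froot_vec e ` M)) (add_mset (Suc (card J - 1)) F)"
  proof (rule ifree_step[OF free uj(1), where T = "froot_vec e ` plus_of j ` ?K" and R = "froot_vec e ` minus_of j ` ?K"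
        and \<psi> = "pm_field e J u" and \<kappa> = 1])
    show "e j \<bullet> u j \<noteq> 0" using uj by simp
    show "hyp W \<sigma> \<noteq> ?H" if s: "\<sigma> \<in> froot_vec e ` M" for \<sigma>
    proof -
      obtain r where r: "r \<in> M" "\<sigma> = froot_vec e r" using s by blast
      have "\<exists>x\<in>W. froot_vec e r \<bullet> x = 0 \<and> froot_vec e (Single j) \<bullet> x \<noteq> 0"
        by (rule vec_separate[OF W u J M(1)[OF r(1)]]) (use j r M(2) in auto)
      then show ?thesis using r(2) by (auto simp: hyp_def)
    qed
    show "ifree ?H (froot_vec e ` ({r \<in> M. froot_over ?K r} \<union> Single ` ?K)) F" by (rule restr)
    show "hyp ?H ` froot_vec e ` ({r \<in> M. froot_over ?K r} \<union> Single ` ?K) = hyp ?H ` froot_vec e ` M"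
    proof
      have "\<forall>k\<in>?K. hyp ?H (e k) \<in> hyp ?H ` froot_vec e ` M"
      proof
        fix k assume k: "k \<in> ?K"
        have "hyp ?H (e k) = hyp ?H (froot_vec e (plus_of j k))"
          by (auto simp: hyp_def vec_plus_of inner_add_left)
        then show "hyp ?H (e k) \<in> hyp ?H ` froot_vec e ` M" using Mj(1)[of k] k by auto
      qed
      then show "hyp ?H ` froot_vec e ` ({r \<in> M. froot_over ?K r} \<union> Single ` ?K) \<subseteq> hyp ?H ` froot_vec e ` M"
        unfolding image_Un Un_subset_iff by (auto simp: image_subset_iff)
      show "hyp ?H ` froot_vec e ` M \<subseteq> hyp ?H ` froot_vec e ` ({r \<in> M. froot_over ?K r} \<union> Single ` ?K)"
      proof (intro subsetI)
        fix h assume "h \<in> hyp ?H ` froot_vec e ` M"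
        then obtain r where r: "r \<in> M" "h = hyp ?H (froot_vec e r)" by blast
        show "h \<in> hyp ?H ` froot_vec e ` ({r \<in> M. froot_over ?K r} \<union> Single ` ?K)"
        proof (cases "froot_over ?K r")
          case True
          then show ?thesis using r by blast
        next
          case False
          have "\<exists>k\<in>?K. h = hyp ?H (froot_vec e (Single k))"
            using M(1)[OF r(1)] False Msingle[OF r(1)] r(2)
            by (cases r) (auto simp: hyp_def inner_diff_left inner_add_left)
          then show ?thesis by blast
        qed
      qed
    qed
    show "froot_vec e ` plus_of j ` ?K \<subseteq> froot_vec e ` M" "froot_vec e ` minus_of j ` ?K \<subseteq> froot_vec e ` M"
      using Mj by auto
    have uk: "u k \<in> ?H" "froot_vec e (minus_of j k) \<bullet> u k \<noteq> 0" "l \<noteq> k \<Longrightarrow> l \<in> ?K \<Longrightarrow> froot_vec e (minus_of j l) \<bullet> u k = 0"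
      if "k \<in> ?K" for k l
      using that u j by (auto simp: dual_on_def mem_hyp vec_minus_of inner_diff_left)
    show "\<exists>x\<in>?H. \<rho> \<bullet> x \<noteq> 0" if "\<rho> \<in> froot_vec e ` minus_of j ` ?K" for \<rho>
      using that uk by blast
    show "\<exists>x\<in>?H. \<rho> \<bullet> x = 0 \<and> \<sigma> \<bullet> x \<noteq> 0"
      if t: "\<rho> \<in> froot_vec e ` minus_of j ` ?K" "\<sigma> \<in> froot_vec e ` minus_of j ` ?K" "\<rho> \<noteq> \<sigma>" for \<rho> \<sigma>
    proof -
      obtain k l where kl: "k \<in> ?K" "l \<in> ?K" "\<rho> = froot_vec e (minus_of j k)" "\<sigma> = froot_vec e (minus_of j l)"
        using t(1,2) by blast
      then have "k \<noteq> l" using t(3) by auto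
      then show ?thesis using uk(1,2)[OF kl(2)] uk(3)[OF kl(2) _ kl(1)] kl by blast
    qed
    show "\<exists>x\<in>W. \<rho> \<bullet> x = 0 \<and> \<sigma> \<bullet> x \<noteq> 0"
      if t: "\<rho> \<in> froot_vec e ` plus_of j ` ?K" "\<sigma> \<in> froot_vec e ` plus_of j ` ?K" "\<rho> \<noteq> \<sigma>" for \<rho> \<sigma>
    proof -
      obtain k l where kl: "k \<in> ?K" "l \<in> ?K" "\<rho> = froot_vec e (plus_of j k)" "\<sigma> = froot_vec e (plus_of j l)"
        using t(1,2) by blast
      then have ne: "plus_of j k \<noteq> plus_of j l" using t(3) by auto
      show ?thesis unfolding kl(3,4)
        by (rule vec_separate[OF W u J over_pm_of(1) over_pm_of(1) ne]) (use kl j in auto)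
    qed
    show "\<exists>\<rho>\<in>froot_vec e ` minus_of j ` ?K. \<exists>a c. a \<noteq> 0 \<and> c \<noteq> 0 \<and> \<tau> = a *\<^sub>R e j + c *\<^sub>R \<rho>"
      if t: "\<tau> \<in> froot_vec e ` plus_of j ` ?K" for \<tau>
    proof -
      obtain k where k: "k \<in> ?K" "\<tau> = froot_vec e (plus_of j k)" using t by blast
      have "\<tau> = 2 *\<^sub>R e j + (if j \<le> k then -1 else 1) *\<^sub>R froot_vec e (minus_of j k)"
        unfolding k(2) vec_plus_of vec_minus_of by (simp add: scaleR_2)
      moreover have "(if j \<le> k then -1 else 1 :: real) \<noteq> 0" by simp
      ultimately show ?thesis using k(1)
        by (intro bexI[of _ "froot_vec e (minus_of j k)"] exI[of _ 2] exI[of _ "if j \<le> k then -1 else 1"]) auto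
    qed
    show "card (froot_vec e ` plus_of j ` ?K) = card J - 1" by (rule cT)
    show "pm_field e J u \<in> tangent W (hyp W ` froot_vec e ` M)"
    proof (rule tangentI[OF polynomial_pm_field[OF J] pm_field_mem[OF W u J]])
      fix h x assume "h \<in> hyp W ` froot_vec e ` M" "x \<in> h"
      then show "pm_field e J u x \<in> h"
        using pm_field_orthogonal[OF W u J M(1) Msingle] pm_field_mem[OF W u J] by (auto simp: mem_hyp)
    qed
    show "e j \<bullet> pm_field e J u x = 1 * (\<Prod>\<tau>\<in>froot_vec e ` plus_of j ` ?K. \<tau> \<bullet> x)" if x: "x \<in> ?H" for x
    proof -
      have "inj_on (froot_vec e) (plus_of j ` ?K)"
        by (rule inj_on_subset[OF inj]) (use over_pm_of j in auto)
      then have "(\<Prod>\<tau>\<in>froot_vec e ` plus_of j ` ?K. \<tau> \<bullet> x) = (\<Prod>k\<in>?K. froot_vec e (plus_of j k) \<bullet> x)"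
        by (simp add: prod.reindex inj_plus_of)
      also have "\<dots> = (\<Prod>k\<in>?K. e k \<bullet> x)"
        using x by (intro prod.cong) (auto simp: vec_plus_of inner_add_left mem_hyp)
      finally show ?thesis using pm_field_inner[OF W u J j] by simp
    qed
  qed simp
  moreover have "Suc (card J - 1) = card J" using J j by (metis Suc_diff_1 card_gt_0_iff empty_iff)
  ultimately show ?thesis by simp
qed

text \<open>For \<open>f\<close> in the definition of \<open>\<psi>\<close>, interpolation forces \<open>f = g P / y\<^sub>k\<close> on \<open>y\<^sub>b = y\<^sub>k\<close> and
  \<open>f = - g P / y\<^sub>k\<close> on \<open>y\<^sub>b = - y\<^sub>k\<close>, where \<open>y\<^sub>k = e\<^sub>k \<bullet> x\<close> and \<open>P\<close> is the product of the \<open>y\<^sub>k\<close>, \<open>k \<in> J\<close>; the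
  factor \<open>g\<close> makes \<open>y\<^sub>b\<close> divide the interpolating polynomial.\<close>

lemma ifree_add_plus:
  fixes W :: "'a::euclidean_space set"
  assumes J: "finite J" and b: "\<And>k. k \<in> J \<Longrightarrow> b < k"
    and W: "subspace W" and u: "dual_on W e (insert b J) u" and j: "j \<in> J" and K: "K \<subseteq> J - {j}"
    and M: "\<And>r. r \<in> M \<Longrightarrow> froot_over J r" "\<And>i. Single i \<notin> M"
    and Mj: "\<And>k. k \<in> J \<Longrightarrow> k \<noteq> j \<Longrightarrow> plus_of j k \<in> M" "\<And>k. k \<in> K \<Longrightarrow> minus_of j k \<in> M"
    and free: "ifree W (froot_vec e ` (M \<union> Minus b ` J \<union> Plus b ` K)) (add_mset (card J - 1 + card K) F)"
    and restr: "ifree (hyp W (e b + e j)) (insert (e j) (froot_vec e ` M)) F"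
  shows "ifree W (froot_vec e ` (M \<union> Minus b ` J \<union> Plus b ` insert j K)) (add_mset (card J + card K) F)"
proof -
  let ?\<alpha> = "e b + e j" and ?J = "J - {j}"
  let ?H = "hyp W ?\<alpha>" and ?S = "M \<union> Minus b ` J \<union> Plus b ` K"
  let ?T = "Minus b ` ?J \<union> Plus b ` K" and ?R = "plus_of j ` ?J \<union> minus_of j ` K"
  have bJ: "b \<notin> J" using b by blast
  have J': "finite (insert b J)" using J by simp
  have finK: "finite K" using K J by (meson finite_Diff finite_subset)
  have H: "subspace ?H" by (rule subspace_hyp[OF W])
  have uJ: "dual_on W e J u" by (rule dual_on_subset[OF u]) auto
  have ub: "u b \<in> W" "e b \<bullet> u b = 1" "\<And>k. k \<in> J \<Longrightarrow> e k \<bullet> u b = 0" "?\<alpha> \<bullet> u b = 1"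
    using u bJ j by (auto simp: dual_on_def inner_add_left)
  have uk: "u k \<in> W" "e b \<bullet> u k = 0" "e k \<bullet> u k = 1" if "k \<in> J" for k
    using u bJ that by (auto simp: dual_on_def)
  have Msingle: "r \<noteq> Single (froot_row r)" if "r \<in> M" for r using M(2)[of "froot_row r"] that by metis
  have overJ: "froot_over (insert b J) r" if "froot_over J r" for r using that by (cases r) auto
  have overS: "froot_over (insert b J) r" if "r \<in> ?S" for r
    using that M(1) overJ b K by auto
  have overT: "froot_over (insert b J) r" if "r \<in> ?T" for r using that b K by auto
  have overR: "froot_over J r" if "r \<in> ?R" for r using that j K by (auto intro!: over_pm_of)
  have RM: "?R \<subseteq> M" using Mj by auto
  have inj: "inj_on (froot_vec e) {r. froot_over (insert b J) r}" by (rule vec_inj_on[OF W u J'])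
  have injT: "inj_on (froot_vec e) ?T" by (rule inj_on_subset[OF inj]) (use overT in auto)
  have disj: "Minus b ` ?J \<inter> Plus b ` K = {}" by auto
  have cT: "card (froot_vec e ` ?T) = card J - 1 + card K"
    using J j finK disj by (simp add: card_image[OF injT] card_Un_disjoint card_image inj_on_def)
  have "insert b J - {b} = J" using bJ by auto
  then have uH: "dual_on ?H e J (\<lambda>k. u k - (?\<alpha> \<bullet> u k) *\<^sub>R u b)"
    using dual_on_hyp[OF W u _ ub(4)] by simp
  define P where "P k x = (\<Prod>l\<in>J - {k}. e l \<bullet> x)" for k x
  define g where "g x = (\<Prod>k\<in>K. e k \<bullet> x)" for x
  \<comment> \<open>The subtracted product vanishes where \<open>y\<^sub>b = y\<^sub>k\<close> with
    \<open>k\<close> in \<open>J\<close>, and where \<open>y\<^sub>b = - y\<^sub>k\<close> with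
    \<open>k\<close> in \<open>K\<close>; \<open>G\<close> then equals the first term, which gives
    \<open>f = G / y\<^sub>b\<close> its prescribed values. At \<open>y\<^sub>b = 0\<close> the two
    terms coincide, so the division by \<open>y\<^sub>b\<close> is possible.\<close>
  define G where "G x = (\<Prod>k\<in>J. e k \<bullet> x) * g x
      - (\<Prod>k\<in>J. e k \<bullet> x - e b \<bullet> x) * (\<Prod>k\<in>K. e k \<bullet> x + e b \<bullet> x)" for x
  have G: "rpoly G" and g: "rpoly g" and P: "rpoly (P k)" for k
    unfolding G_def g_def P_def using J finK
    by (auto intro!: real_polynomial_function_prod rpoly_inner real_polynomial_function_diff rpoly_mult rpoly_add)
  have PJ: "(\<Prod>k\<in>J. e k \<bullet> x) = (e k \<bullet> x) * P k x" if "k \<in> J" for k x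
    unfolding P_def using J that by (simp add: prod.remove)
  have "G x = 0" if "x \<in> hyp W (e b)" for x
    using that by (simp add: G_def g_def mem_hyp)
  then obtain f where f: "rpoly f" "\<And>x. x \<in> W \<Longrightarrow> G x = (e b \<bullet> x) * f x"
    using rpoly_divide_linear[OF W G ub(1), of "e b"] ub(2) by auto
  define \<psi> where "\<psi> x = f x *\<^sub>R u b + g x *\<^sub>R pm_field e J u x" for x
  have pol: "polynomial_function \<psi>" unfolding \<psi>_def
    by (intro polynomial_function_add polynomial_function_scaleR f(1) g polynomial_pm_field[OF J]) auto
  have \<psi>W: "\<psi> x \<in> W" for x
    unfolding \<psi>_def using W ub(1) pm_field_mem[OF W uJ J] by (simp add: subspace_add subspace_scale)
  have \<psi>b: "e b \<bullet> \<psi> x = f x" for x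
  proof -
    have "e b \<bullet> pm_field e J u x = 0"
      unfolding pm_field_def inner_sum_right using uk(2) by (intro sum.neutral) auto
    then show ?thesis by (simp add: \<psi>_def inner_add_right ub(2))
  qed
  have \<psi>k: "e k \<bullet> \<psi> x = g x * P k x" if "k \<in> J" for k x
    using pm_field_inner[OF W uJ J that] ub(3)[OF that] by (simp add: \<psi>_def inner_add_right P_def)
  have minus0: "f x - g x * P k x = 0" if k: "k \<in> J" and x: "x \<in> hyp W (e b - e k)" for k x
  proof (rule rpoly_domain[OF subspace_hyp[OF W] rpoly_inner _ _ _ _ x])
    show "rpoly (\<lambda>x. f x - g x * P k x)"
      by (intro real_polynomial_function_diff rpoly_mult f(1) g P)
    show "u b + u k \<in> hyp W (e b - e k)" "e k \<bullet> (u b + u k) \<noteq> 0"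
      using k ub uk W by (auto simp: mem_hyp subspace_add inner_add_right inner_diff_left)
    fix y assume "y \<in> hyp W (e b - e k)"
    then have y: "y \<in> W" "e b \<bullet> y = e k \<bullet> y" by (auto simp: mem_hyp inner_diff_left)
    have "(\<Prod>l\<in>J. e l \<bullet> y - e b \<bullet> y) = 0" using J k y(2) by (intro prod_zero) auto
    then have "(e k \<bullet> y) * f y = (e k \<bullet> y) * P k y * g y"
      using f(2)[OF y(1)] y(2) PJ[OF k] by (auto simp: G_def)
    then show "(e k \<bullet> y) * (f y - g y * P k y) = 0" by (simp add: algebra_simps)
  qed
  have plus0: "f x + g x * P k x = 0" if k: "k \<in> K" and x: "x \<in> hyp W (e b + e k)" for k x
  proof (rule rpoly_domain[OF subspace_hyp[OF W] rpoly_inner _ _ _ _ x])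
    have kJ: "k \<in> J" using k K by auto
    show "rpoly (\<lambda>x. f x + g x * P k x)" by (intro rpoly_add rpoly_mult f(1) g P)
    show "u b - u k \<in> hyp W (e b + e k)" "e k \<bullet> (u b - u k) \<noteq> 0"
      using kJ ub uk W by (auto simp: mem_hyp subspace_diff inner_diff_right inner_add_left)
    fix y assume "y \<in> hyp W (e b + e k)"
    then have y: "y \<in> W" "e b \<bullet> y = - (e k \<bullet> y)" by (auto simp: mem_hyp inner_add_left)
    have "(\<Prod>l\<in>K. e l \<bullet> y + e b \<bullet> y) = 0" using finK k y(2) by (intro prod_zero) auto
    then have "- (e k \<bullet> y) * f y = (e k \<bullet> y) * P k y * g y"
      using f(2)[OF y(1)] y(2) PJ[OF kJ] by (simp add: G_def)
    then show "(e k \<bullet> y) * (f y + g y * P k y) = 0" by (simp add: algebra_simps)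
  qed
  have tang: "\<psi> \<in> tangent W (hyp W ` froot_vec e ` ?S)"
  proof (rule tangentI[OF pol \<psi>W])
    fix h x assume "h \<in> hyp W ` froot_vec e ` ?S" and xh: "x \<in> h"
    then obtain r where r: "r \<in> ?S" "h = hyp W (froot_vec e r)" by blast
    have x: "x \<in> W" "froot_vec e r \<bullet> x = 0" using xh r(2) by (auto simp: mem_hyp)
    consider "r \<in> M" | k where "k \<in> J" "r = Minus b k" | k where "k \<in> K" "r = Plus b k"
      using r(1) by blast
    then have "froot_vec e r \<bullet> \<psi> x = 0"
    proof cases
      case 1
      have "froot_vec e r \<bullet> u b = 0" by (rule vec_orthogonal_outside[OF u bJ M(1)[OF 1]])
      moreover have "froot_vec e r \<bullet> pm_field e J u x = 0"
        by (rule pm_field_orthogonal[OF W uJ J M(1)[OF 1] Msingle[OF 1] x(2)])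
      ultimately show ?thesis by (simp add: \<psi>_def inner_add_right)
    next
      case 2
      then show ?thesis using minus0[of k x] x \<psi>b \<psi>k by (simp add: inner_diff_left mem_hyp)
    next
      case 3
      then show ?thesis using plus0[of k x] x \<psi>b \<psi>k[of k] K by (auto simp: inner_add_left mem_hyp)
    qed
    then show "\<psi> x \<in> h" using \<psi>W r(2) by (simp add: mem_hyp)
  qed
  \<comment> \<open>On the new hyperplane the subtracted product of \<open>G\<close> survives. Its
    factor with index \<open>j\<close> is \<open>2 * (e j \<bullet> x)\<close>, the source of the 2
    in \<open>\<kappa>\<close>; \<open>Q\<close> is the product of its other factors.\<close>
  define Q where "Q x = (\<Prod>k\<in>?J. e k \<bullet> x + e j \<bullet> x) * (\<Prod>k\<in>K. e k \<bullet> x - e j \<bullet> x)" for x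
  have \<psi>\<alpha>: "?\<alpha> \<bullet> \<psi> x = 2 * Q x" if x: "x \<in> ?H" for x
  proof -
    have "f x + g x * P j x - 2 * Q x = 0"
    proof (rule rpoly_domain[OF H rpoly_inner _ _ _ _ x])
      show "rpoly (\<lambda>x. f x + g x * P j x - 2 * Q x)"
        unfolding Q_def using J finK
        by (intro rpoly_add real_polynomial_function_diff rpoly_mult f(1) g P rpoly_const
            real_polynomial_function_prod rpoly_inner) auto
      show "u b - u j \<in> ?H" "e j \<bullet> (u b - u j) \<noteq> 0"
        using j ub uk W by (auto simp: mem_hyp subspace_diff inner_diff_right inner_add_left)
      fix y assume "y \<in> ?H"
      then have y: "y \<in> W" "e b \<bullet> y = - (e j \<bullet> y)" by (auto simp: mem_hyp inner_add_left)
      have "(\<Prod>k\<in>J. e k \<bullet> y + e j \<bullet> y) = (2 * (e j \<bullet> y)) * (\<Prod>k\<in>?J. e k \<bullet> y + e j \<bullet> y)"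
        using J j by (subst prod.remove[of _ j]) auto
      then have "- (e j \<bullet> y) * f y = (e j \<bullet> y) * P j y * g y - 2 * (e j \<bullet> y) * Q y"
        using f(2)[OF y(1)] y(2) PJ[OF j] by (simp add: G_def Q_def)
      then show "(e j \<bullet> y) * (f y + g y * P j y - 2 * Q y) = 0" by (simp add: algebra_simps)
    qed
    then show ?thesis using \<psi>b \<psi>k[OF j] by (simp add: inner_add_left)
  qed
  \<comment> \<open>On \<open>?H\<close> the form \<open>e b - e k\<close> becomes
    \<open>- (e k + e j)\<close>, so each minus form in \<open>?T\<close> contributes one
    sign.\<close>
  have QT: "(\<Prod>\<tau>\<in>froot_vec e ` ?T. \<tau> \<bullet> x) = (-1) ^ card ?J * Q x" if x: "x \<in> ?H" for x
  proof -
    have y: "e b \<bullet> x = - (e j \<bullet> x)" using x by (auto simp: mem_hyp inner_add_left)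
    have "(\<Prod>\<tau>\<in>froot_vec e ` ?T. \<tau> \<bullet> x) = (\<Prod>r\<in>?T. froot_vec e r \<bullet> x)"
      by (simp add: prod.reindex[OF injT])
    also have "\<dots> = (\<Prod>k\<in>?J. froot_vec e (Minus b k) \<bullet> x) * (\<Prod>k\<in>K. froot_vec e (Plus b k) \<bullet> x)"
      using J finK disj by (simp add: prod.union_disjoint prod.reindex inj_on_def)
    also have "(\<Prod>k\<in>K. froot_vec e (Plus b k) \<bullet> x) = (\<Prod>k\<in>K. e k \<bullet> x - e j \<bullet> x)"
      by (intro prod.cong) (auto simp: inner_add_left y)
    also have "(\<Prod>k\<in>?J. froot_vec e (Minus b k) \<bullet> x) = (\<Prod>k\<in>?J. (-1) * (e k \<bullet> x + e j \<bullet> x))"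
      by (intro prod.cong) (auto simp: inner_diff_left y)
    also have "\<dots> = (-1) ^ card ?J * (\<Prod>k\<in>?J. e k \<bullet> x + e j \<bullet> x)"
      by (simp only: prod.distrib prod_constant)
    finally show ?thesis by (simp add: Q_def)
  qed
  have "ifree W (insert ?\<alpha> (froot_vec e ` ?S)) (add_mset (Suc (card J - 1 + card K)) F)"
  proof (rule ifree_step[OF free ub(1), where T = "froot_vec e ` ?T" and R = "froot_vec e ` ?R"
        and \<psi> = \<psi> and \<kappa> = "2 * (-1) ^ card ?J"])
    show "?\<alpha> \<bullet> u b \<noteq> 0" using ub(4) by simp
    show "hyp W \<sigma> \<noteq> ?H" if s: "\<sigma> \<in> froot_vec e ` ?S" for \<sigma>
    proof -
      obtain r where r: "r \<in> ?S" "\<sigma> = froot_vec e r" using s by blast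
      have "r \<noteq> Plus b j" using r(1) M(1)[of r] bJ K by auto
      then have "\<exists>x\<in>W. froot_vec e r \<bullet> x = 0 \<and> froot_vec e (Plus b j) \<bullet> x \<noteq> 0"
        by (intro vec_separate[OF W u J' overS[OF r(1)]]) (use j b in auto)
      then show ?thesis using r(2) by (auto simp: hyp_def)
    qed
    show "ifree ?H (insert (e j) (froot_vec e ` M)) F" by (rule restr)
    have rel: "\<exists>p\<in>?R. \<exists>c. c \<noteq> 0 \<and> froot_vec e r = 1 *\<^sub>R ?\<alpha> + c *\<^sub>R froot_vec e p" if r: "r \<in> ?T" for r
    proof -
      consider k where "k \<in> ?J" "r = Minus b k" | k where "k \<in> K" "r = Plus b k" using r by blast
      then show ?thesis
      proof cases
        case 1
        then show ?thesis
          by (intro bexI[of _ "plus_of j k"] exI[of _ "-1"]) (auto simp: vec_plus_of)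
      next
        case 2
        then show ?thesis
          by (intro bexI[of _ "minus_of j k"] exI[of _ "if j \<le> k then -1 else 1"]) (auto simp: vec_minus_of)
      qed
    qed
    show "hyp ?H ` insert (e j) (froot_vec e ` M) = hyp ?H ` froot_vec e ` ?S"
    proof
      have ej: "hyp ?H (e j) = hyp ?H (froot_vec e (Minus b j))"
        by (auto simp: hyp_def inner_add_left inner_diff_left)
      have "Minus b j \<in> ?S" using j by auto
      then have "hyp ?H (e j) \<in> hyp ?H ` froot_vec e ` ?S" unfolding ej by blast
      then show "hyp ?H ` insert (e j) (froot_vec e ` M) \<subseteq> hyp ?H ` froot_vec e ` ?S" by auto
      show "hyp ?H ` froot_vec e ` ?S \<subseteq> hyp ?H ` insert (e j) (froot_vec e ` M)"
      proof (intro subsetI)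
        fix h assume "h \<in> hyp ?H ` froot_vec e ` ?S"
        then obtain r where r: "r \<in> ?S" "h = hyp ?H (froot_vec e r)" by blast
        consider "r \<in> M" | "r = Minus b j" | "r \<in> ?T" using r(1) by blast
        then show "h \<in> hyp ?H ` insert (e j) (froot_vec e ` M)"
        proof cases
          case 3
          then obtain p c where p: "p \<in> ?R" "c \<noteq> 0" "froot_vec e r = 1 *\<^sub>R ?\<alpha> + c *\<^sub>R froot_vec e p"
            using rel by blast
          have "h = hyp ?H (froot_vec e p)"
            unfolding r(2) p(3) using p(2) by (auto simp: hyp_def inner_add_left)
          then show ?thesis using p(1) RM by blast
        qed (use r(2) ej in auto)
      qed
    qed
    show "froot_vec e ` ?T \<subseteq> froot_vec e ` ?S" by auto
    show "froot_vec e ` ?R \<subseteq> froot_vec e ` ?S" using RM by auto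
    show "\<exists>x\<in>?H. \<rho> \<bullet> x \<noteq> 0" if "\<rho> \<in> froot_vec e ` ?R" for \<rho>
      using that vec_nonzero[OF H uH overR] by blast
    show "\<exists>x\<in>?H. \<rho> \<bullet> x = 0 \<and> \<sigma> \<bullet> x \<noteq> 0"
      if t: "\<rho> \<in> froot_vec e ` ?R" "\<sigma> \<in> froot_vec e ` ?R" "\<rho> \<noteq> \<sigma>" for \<rho> \<sigma>
      by (rule vec_image_separate[OF H uH J overR t])
    show "\<exists>x\<in>W. \<rho> \<bullet> x = 0 \<and> \<sigma> \<bullet> x \<noteq> 0"
      if t: "\<rho> \<in> froot_vec e ` ?T" "\<sigma> \<in> froot_vec e ` ?T" "\<rho> \<noteq> \<sigma>" for \<rho> \<sigma>
      by (rule vec_image_separate[OF W u J' overT t])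
    show "\<exists>\<rho>\<in>froot_vec e ` ?R. \<exists>a c. a \<noteq> 0 \<and> c \<noteq> 0 \<and> \<tau> = a *\<^sub>R ?\<alpha> + c *\<^sub>R \<rho>"
      if t: "\<tau> \<in> froot_vec e ` ?T" for \<tau>
    proof -
      obtain r where r: "r \<in> ?T" "\<tau> = froot_vec e r" using t by blast
      obtain p c where "p \<in> ?R" "c \<noteq> 0" "froot_vec e r = 1 *\<^sub>R ?\<alpha> + c *\<^sub>R froot_vec e p"
        using rel[OF r(1)] by blast
      then show ?thesis unfolding r(2) by (intro bexI[of _ "froot_vec e p"] exI[of _ 1] exI[of _ c]) auto
    qed
    show "card (froot_vec e ` ?T) = card J - 1 + card K" by (rule cT)
    show "\<psi> \<in> tangent W (hyp W ` froot_vec e ` ?S)" by (rule tang)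
    show "?\<alpha> \<bullet> \<psi> x = 2 * (-1) ^ card ?J * (\<Prod>\<tau>\<in>froot_vec e ` ?T. \<tau> \<bullet> x)" if x: "x \<in> ?H" for x
    proof -
      have "(-1) ^ card ?J * (-1) ^ card ?J = (1::real)" by (simp flip: power_mult_distrib)
      then have "2 * (-1) ^ card ?J * ((-1) ^ card ?J * Q x) = 2 * Q x"
        by (metis (no_types, lifting) mult.assoc mult.right_neutral)
      then show ?thesis unfolding \<psi>\<alpha>[OF x] QT[OF x] by simp
    qed
  qed simp
  moreover have "insert ?\<alpha> (froot_vec e ` ?S) = froot_vec e ` (M \<union> Minus b ` J \<union> Plus b ` insert j K)" by auto
  moreover have "Suc (card J - 1 + card K) = card J + card K"
  proof -
    have "card J > 0" using J j card_gt_0_iff by blast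
    then show ?thesis by simp
  qed
  ultimately show ?thesis by (simp only:)
qed

section \<open>Lower sets of type D\<close>

text \<open>Each clause takes a decomposition of a root into two positive roots and puts both
  summands in \<open>L\<close>. A plus root can be split at its smaller index, or at its larger one
  by raising it.\<close>

definition D_closed :: "nat \<Rightarrow> froot set \<Rightarrow> bool" where
  "D_closed n L \<longleftrightarrow> (\<forall>r\<in>L. froot_over {1..n} r \<and> r \<noteq> Single (froot_row r)) \<and>
     (\<forall>i j k. Minus i j \<in> L \<longrightarrow> i < k \<longrightarrow> k < j \<longrightarrow> Minus i k \<in> L \<and> Minus k j \<in> L) \<and>
     (\<forall>i j k. Plus i j \<in> L \<longrightarrow> i < k \<longrightarrow> k \<le> n \<longrightarrow> k \<noteq> j \<longrightarrow> Minus i k \<in> L \<and> plus_of k j \<in> L) \<and>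
     (\<forall>i j k. Plus i j \<in> L \<longrightarrow> j < k \<longrightarrow> k \<le> n \<longrightarrow> Minus j k \<in> L \<and> Plus i k \<in> L)"

lemma D_closedD:
  assumes "D_closed n L"
  shows "r \<in> L \<Longrightarrow> froot_over {1..n} r" "r \<in> L \<Longrightarrow> r \<noteq> Single (froot_row r)"
    "Minus i j \<in> L \<Longrightarrow> i < k \<Longrightarrow> k < j \<Longrightarrow> Minus i k \<in> L"
    "Minus i j \<in> L \<Longrightarrow> i < k \<Longrightarrow> k < j \<Longrightarrow> Minus k j \<in> L"
    "Plus i j \<in> L \<Longrightarrow> i < k \<Longrightarrow> k \<le> n \<Longrightarrow> k \<noteq> j \<Longrightarrow> Minus i k \<in> L"
    "Plus i j \<in> L \<Longrightarrow> i < k \<Longrightarrow> k \<le> n \<Longrightarrow> k \<noteq> j \<Longrightarrow> plus_of k j \<in> L"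
    "Plus i j \<in> L \<Longrightarrow> j < k \<Longrightarrow> k \<le> n \<Longrightarrow> Minus j k \<in> L"
    "Plus i j \<in> L \<Longrightarrow> j < k \<Longrightarrow> k \<le> n \<Longrightarrow> Plus i k \<in> L"
proof -
  note c = assms[unfolded D_closed_def]
  show "r \<in> L \<Longrightarrow> froot_over {1..n} r" "r \<in> L \<Longrightarrow> r \<noteq> Single (froot_row r)"
    using c[THEN conjunct1] by blast+
  show "Minus i j \<in> L \<Longrightarrow> i < k \<Longrightarrow> k < j \<Longrightarrow> Minus i k \<in> L"
    "Minus i j \<in> L \<Longrightarrow> i < k \<Longrightarrow> k < j \<Longrightarrow> Minus k j \<in> L"
    using c[THEN conjunct2, THEN conjunct1, rule_format, of i j k] by blast+
  show "Plus i j \<in> L \<Longrightarrow> i < k \<Longrightarrow> k \<le> n \<Longrightarrow> k \<noteq> j \<Longrightarrow> Minus i k \<in> L"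
    "Plus i j \<in> L \<Longrightarrow> i < k \<Longrightarrow> k \<le> n \<Longrightarrow> k \<noteq> j \<Longrightarrow> plus_of k j \<in> L"
    using c[THEN conjunct2, THEN conjunct2, THEN conjunct1, rule_format, of i j k] by blast+
  show "Plus i j \<in> L \<Longrightarrow> j < k \<Longrightarrow> k \<le> n \<Longrightarrow> Minus j k \<in> L"
    "Plus i j \<in> L \<Longrightarrow> j < k \<Longrightarrow> k \<le> n \<Longrightarrow> Plus i k \<in> L"
    using c[THEN conjunct2, THEN conjunct2, THEN conjunct2, rule_format, of i j k] by blast+
qed

lemma plus_of_commute: "plus_of j k = plus_of k j"
  by (simp add: plus_of_def min.commute max.commute)

text \<open>In type D the roots \<open>e\<^sub>k - e\<^sub>n\<close> and \<open>e\<^sub>k + e\<^sub>n\<close> have the same height. A row containing both contributes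
  its length minus one, and the number of such rows is a further exponent.\<close>

definition D_fork :: "nat \<Rightarrow> froot set \<Rightarrow> nat set" where
  "D_fork n L = {k. Minus k n \<in> L \<and> Plus k n \<in> L}"

definition D_row :: "nat \<Rightarrow> froot set \<Rightarrow> nat \<Rightarrow> nat" where
  "D_row n L i = card {r \<in> L. froot_row r = i} - (if i \<in> D_fork n L then 1 else 0)"

lemma card_Minus_Plus:
  assumes "finite A" "finite B"
  shows "card (Minus a ` A \<union> Plus a ` B) = card A + card B"
proof -
  have "Minus a ` A \<inter> Plus a ` B = {}" by auto
  then show ?thesis using assms by (simp add: card_Un_disjoint card_image inj_on_def)
qed

text \<open>On \<open>y\<^sub>j = 0\<close> the forms \<open>y\<^sub>j \<plusminus> y\<^sub>k\<close> become \<open>y\<^sub>k\<close>, which leaves an arrangement of type B.\<close>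

lemma D_restriction:
  assumes D: "D_closed n L" and b: "b \<in> D_fork n L" and bj: "Plus b j \<in> L"
  defines "J \<equiv> {b<..n}"
  defines "M \<equiv> {r \<in> L. b < froot_row r}"
  defines "N \<equiv> {r \<in> M. froot_over (J - {j}) r} \<union> Single ` (J - {j})"
  shows "row_closed N"
    "image_mset (\<lambda>i. card {r \<in> N. froot_row r = i}) (mset_set (J - {j})) = image_mset (D_row n L) (mset_set {b<..<n})"
proof -
  note cl = D_closedD[OF D]
  have bn: "Minus b n \<in> L" "Plus b n \<in> L" using b by (auto simp: D_fork_def)
  have jJ: "b < j" "j \<le> n" using cl(1)[OF bj] by auto
  have Mb: "Minus b c \<in> L" if "b < c" "c \<le> n" for c
    using cl(3)[OF bn(1), of c] bn(1) that by (cases "c = n") auto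
  have MM: "Minus a c \<in> L" if "b < a" "a < c" "c \<le> n" for a c
    using cl(4)[OF Mb[of c]] that by auto
  have Pj: "plus_of j a \<in> L" if "b < a" "a \<le> n" "a \<noteq> j" for a
    using cl(6)[OF bj, of a] that by (simp add: plus_of_commute)
  have Pa: "Plus a c \<in> L" if "j \<le> a" "a < c" "c \<le> n" for a c
  proof -
    have jc: "Plus j c \<in> L" using Pj[of c] that jJ by (simp add: plus_of_def)
    show ?thesis
    proof (cases "a = j")
      case False
      then show ?thesis using cl(6)[OF jc, of a] that by (simp add: plus_of_def)
    qed (use jc in simp)
  qed
  have Paj: "Plus a j \<in> L" if "b < a" "a < j" for a
    using Pj[of a] that jJ by (simp add: plus_of_def)
  have N_Minus: "Minus a c \<in> N \<longleftrightarrow> a \<in> J - {j} \<and> c \<in> J - {j} \<and> a < c" for a c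
    using MM by (auto simp: N_def M_def J_def)
  have N_Plus: "Plus a c \<in> N \<longleftrightarrow> a \<in> J - {j} \<and> c \<in> J - {j} \<and> a < c \<and> Plus a c \<in> L" for a c
    by (auto simp: N_def M_def J_def)
  have N_Single: "Single a \<in> N \<longleftrightarrow> a \<in> J - {j}" for a
    using cl(2)[of "Single a"] by (auto simp: N_def M_def)
  show "row_closed N"
    unfolding row_closed_def N_Minus N_Plus N_Single
  proof (intro conjI allI impI)
    fix i p k
    show "Plus p k \<in> L"
      if "i \<in> J - {j} \<and> p \<in> J - {j} \<and> i < p" "i \<in> J - {j} \<and> k \<in> J - {j} \<and> i < k \<and> Plus i k \<in> L" "p < k"
      using cl(6)[of i k p] that by (auto simp: plus_of_def J_def)
    show "Plus k p \<in> L"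
      if "i \<in> J - {j} \<and> p \<in> J - {j} \<and> i < p" "i \<in> J - {j} \<and> k \<in> J - {j} \<and> i < k \<and> Plus i k \<in> L" "k < p"
      using cl(6)[of i k p] that by (auto simp: plus_of_def J_def)
  qed auto
  define pl where "pl a = {c. a < c \<and> c \<le> n \<and> Plus a c \<in> L}" for a
  have fin_pl: "finite (pl a)" for a by (rule finite_subset[of _ "{..n}"]) (auto simp: pl_def)
  have rowL: "card {r \<in> L. froot_row r = a} = (n - a) + card (pl a)" if a: "b < a" for a
  proof -
    have "{r \<in> L. froot_row r = a} = Minus a ` {a<..n} \<union> Plus a ` pl a" (is "?l = ?r")
    proof
      show "?l \<subseteq> ?r"
      proof
        fix r assume "r \<in> ?l"
        then show "r \<in> ?r" using cl(1,2)[of r] by (cases r) (auto simp: pl_def)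
      qed
      show "?r \<subseteq> ?l" using MM a by (auto simp: pl_def)
    qed
    then show ?thesis using fin_pl by (simp add: card_Minus_Plus)
  qed
  have rowN: "card {r \<in> N. froot_row r = a} = Suc (card ({a<..n} - {j}) + card (pl a - {j}))"
    if a: "a \<in> J - {j}" for a
  proof -
    have "{r \<in> N. froot_row r = a} = insert (Single a) (Minus a ` ({a<..n} - {j}) \<union> Plus a ` (pl a - {j}))" (is "?l = ?r")
    proof
      show "?l \<subseteq> ?r"
      proof
        fix r assume "r \<in> ?l"
        then show "r \<in> ?r" using N_Minus N_Plus by (cases r) (auto simp: pl_def J_def)
      qed
      show "?r \<subseteq> ?l" using N_Minus N_Plus N_Single a by (auto simp: pl_def J_def)
    qed
    moreover have "Single a \<notin> Minus a ` ({a<..n} - {j}) \<union> Plus a ` (pl a - {j})" by auto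
    ultimately show ?thesis using fin_pl by (simp add: card_Minus_Plus)
  qed
  have fork: "a \<in> D_fork n L" if "b < a" "a < n" for a
  proof -
    have "Plus a n \<in> L" using cl(6)[OF bn(2), of a] that by (simp add: plus_of_def)
    then show ?thesis using MM[of a n] that by (simp add: D_fork_def)
  qed
  \<comment> \<open>The renumbering skips \<open>j\<close>. A row \<open>a < j\<close> loses its two
    forms involving \<open>j\<close> and gains \<open>Single a\<close>. From \<open>j\<close> on the
    rows are complete, and row \<open>Suc a\<close> together with its \<open>Single\<close> has one
    form less than row \<open>a\<close>. Both counts are \<open>D_row n L a\<close>.\<close>
  define \<phi> where "\<phi> a = (if a < j then a else Suc a)" for a
  have inj: "inj_on \<phi> {b<..<n}" by (auto simp: inj_on_def \<phi>_def split: if_splits)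
  have im: "\<phi> ` {b<..<n} = J - {j}"
  proof
    show "\<phi> ` {b<..<n} \<subseteq> J - {j}" by (auto simp: \<phi>_def J_def)
    show "J - {j} \<subseteq> \<phi> ` {b<..<n}"
    proof
      fix a assume a: "a \<in> J - {j}"
      show "a \<in> \<phi> ` {b<..<n}"
      proof (cases "a < j")
        case True
        then show ?thesis using a jJ by (intro image_eqI[of _ _ a]) (auto simp: \<phi>_def J_def)
      next
        case False
        then show ?thesis using a jJ by (intro image_eqI[of _ _ "a - 1"]) (auto simp: \<phi>_def J_def)
      qed
    qed
  qed
  have eq: "card {r \<in> N. froot_row r = \<phi> a} = D_row n L a" if a: "a \<in> {b<..<n}" for a
  proof -
    have "\<phi> a \<in> J - {j}" using im a by blast
    note N = rowN[OF this]
    have R: "D_row n L a = (n - a) + card (pl a) - 1"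
      using rowL[of a] fork[of a] a by (simp add: D_row_def)
    show ?thesis
    proof (cases "a < j")
      case True
      have "j \<in> pl a" using Paj[of a] a True jJ by (auto simp: pl_def)
      moreover have "card (pl a) > 0" using fin_pl \<open>j \<in> pl a\<close> card_gt_0_iff by blast
      ultimately show ?thesis using N R True jJ fin_pl by (simp add: \<phi>_def card_Diff_singleton)
    next
      case False
      have "pl a = {a<..n}" using Pa[of a] False by (auto simp: pl_def)
      moreover have "pl (Suc a) = {Suc a<..n}" using Pa[of "Suc a"] False by (auto simp: pl_def)
      ultimately show ?thesis using N R False a by (simp add: \<phi>_def) arith
    qed
  qed
  have "mset_set (J - {j}) = image_mset \<phi> (mset_set {b<..<n})"
    using image_mset_mset_set[OF inj] im by simp
  then show "image_mset (\<lambda>i. card {r \<in> N. froot_row r = i}) (mset_set (J - {j})) = image_mset (D_row n L) (mset_set {b<..<n})"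
    by (auto simp: image_mset.compositionality o_def eq intro!: image_mset_cong)
qed

text \<open>The index \<open>n\<close> has an empty row; its place among the exponents is taken by
  the number of forks. If \<open>b\<close> is no fork, row \<open>b\<close> never contains both
  \<open>Minus b j\<close> and \<open>Plus b j\<close>, so no \<open>Single\<close> form is needed
  as a difference and the row is added as in the other types. If \<open>b\<close> is a fork, so is
  every index between \<open>b\<close> and \<open>n\<close>.\<close>

lemma ifree_D:
  assumes D: "D_closed n L" and "i < n" "subspace W" "dual_on W e {i<..n} u" "dim W = (n - i) + z"
  shows "ifree W (froot_vec e ` {r \<in> L. i < froot_row r})
    (image_mset (D_row n L) (mset_set {i<..<n}) + {#card {k \<in> D_fork n L. i < k}#} + replicate_mset z 0)"
  using assms(2-)
proof (induction "n - 1 - i" arbitrary: i W u z)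
  case 0
  note cl = D_closedD[OF D]
  have i: "n = Suc i" using 0 by simp
  have e1: "{r \<in> L. i < froot_row r} = {}"
  proof (rule equals0I)
    fix r assume "r \<in> {r \<in> L. i < froot_row r}"
    then show False using cl(1,2)[of r] i by (cases r) auto
  qed
  have e2: "{k \<in> D_fork n L. i < k} = {}" using cl(1)[of "Minus _ n"] i by (force simp: D_fork_def)
  have e3: "{i<..<n} = {}" using i by auto
  show ?case unfolding e1 e2 e3 using ifree_empty[OF 0(3)] 0(5) i by simp
next
  case (Suc m)
  note cl = D_closedD[OF D]
  define b where "b = Suc i"
  define J where "J = {b<..n}"
  define M N where "M = {r \<in> L. b < froot_row r}" and "N = {r \<in> L. froot_row r = b}"
  define E where "E = image_mset (D_row n L) (mset_set {b<..<n})"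
  let ?F = "D_fork n L"
  have bn: "b < n" using Suc.hyps(2) by (simp add: b_def)
  have iJ: "{i<..n} = insert b J" using bn by (auto simp: b_def J_def)
  have W: "subspace W" and u: "dual_on W e (insert b J) u" and dW: "dim W = card (insert b J) + z"
    using Suc.prems bn by (auto simp: iJ[symmetric])
  have J: "finite J" and bJ: "b \<notin> J" "\<And>j. j \<in> J \<Longrightarrow> b < j" and cJ: "card J = n - b" by (auto simp: J_def)
  have LMN: "{r \<in> L. i < froot_row r} = M \<union> N" by (auto simp: M_def N_def b_def)
  have split_base: "image_mset (D_row n L) (mset_set {i<..<n}) = add_mset (D_row n L b) E"
  proof -
    have "{i<..<n} = insert b {b<..<n}" using bn by (auto simp: b_def)
    then show ?thesis by (simp add: E_def)
  qed
  have IH: "ifree W (froot_vec e ` M) (E + {#card {k \<in> ?F. b < k}#} + replicate_mset z 0)"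
    if "subspace W" "dual_on W e J u" "dim W = card J + z" for W u z
    unfolding M_def E_def
    by (rule Suc.hyps(1)) (use that Suc.hyps(2) bn in \<open>auto simp: b_def J_def\<close>)
  have MJ: "froot_over J r" if "r \<in> M" for r
    using cl(1,2)[of r] that by (cases r) (auto simp: M_def J_def)
  have NJ: "froot_over (insert b J) r" if "r \<in> N" for r
    using cl(1,2)[of r] that by (cases r) (auto simp: N_def J_def)
  have inM: "r \<in> M" if "r \<in> L" "b < froot_row r" for r using that by (simp add: M_def)
  have fork_lt: "k < n" if "k \<in> ?F" for k
    using that cl(1)[of "Minus k n"] by (auto simp: D_fork_def)
  show ?case
  proof (cases "b \<in> ?F")
    case False
    have "ifree W (froot_vec e ` (M \<union> N)) (add_mset (card N) (E + {#card {k \<in> ?F. b < k}#} + replicate_mset z 0))"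
    proof (rule ifree_froot_row[OF J bJ(2) MJ NJ _ _ IH W u dW])
      show "froot_row r = b" if "r \<in> N" for r using that by (simp add: N_def)
      fix r q assume rq: "r \<in> N" "q \<in> N" "r \<noteq> q"
      define P where "P r q \<longleftrightarrow> (\<exists>p\<in>M. \<exists>c. froot_vec e r - froot_vec e q = c *\<^sub>R froot_vec e p)" for r q
      have PI: "P r q" if "p \<in> M" "froot_vec e r - froot_vec e q = c *\<^sub>R froot_vec e p" for r q p c
        using that P_def by blast
      have sym: "P q r" if pq: "P r q" for r q
      proof -
        obtain p c where p: "p \<in> M" "froot_vec e r - froot_vec e q = c *\<^sub>R froot_vec e p"
          using pq unfolding P_def by blast
        have "froot_vec e q - froot_vec e r = (- c) *\<^sub>R froot_vec e p"
          unfolding scaleR_minus_left p(2)[symmetric] by simp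
        then show ?thesis using PI p by blast
      qed
      have MM: "P (Minus b j) (Minus b k)" if "Minus b j \<in> N" "Minus b k \<in> N" "j < k" for j k
      proof -
        have "b < j" "Minus j k \<in> L"
          using cl(4)[of b k j] NJ[OF that(1)] that by (auto simp: N_def J_def)
        then show ?thesis by (intro PI[of "Minus j k" _ _ "-1"] inM) auto
      qed
      have PP: "P (Plus b j) (Plus b k)" if "Plus b j \<in> N" "Plus b k \<in> N" "j < k" for j k
      proof -
        have "b < j" "Minus j k \<in> L"
          using cl(7)[of b j k] NJ[OF that(1)] NJ[OF that(2)] that by (auto simp: N_def J_def)
        then show ?thesis by (intro PI[of "Minus j k" _ _ 1] inM) auto
      qed
      have MP: "P (Minus b j) (Plus b k)" if mp: "Minus b j \<in> N" "Plus b k \<in> N" for j k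
      proof -
        have bjk: "b < j" "j \<le> n" "b < k" "k \<le> n" and L: "Minus b j \<in> L" "Plus b k \<in> L"
          using NJ[OF mp(1)] NJ[OF mp(2)] mp by (auto simp: J_def N_def)
        \<comment> \<open>A pair \<open>Minus b k\<close>, \<open>Plus b k\<close> would yield the
          pair with \<open>k\<close> replaced by \<open>n\<close>, that is, a fork at
          \<open>b\<close>.\<close>
        have "j \<noteq> k"
        proof
          assume "j = k"
          show False
          proof (cases "k = n")
            case True
            then show ?thesis using L \<open>j = k\<close> False by (simp add: D_fork_def)
          next
            case kn: False
            then have "Plus b n \<in> L" using cl(8)[OF L(2), of n] bjk by simp
            moreover have "Minus b n \<in> L" using cl(5)[OF L(2), of n] bn kn by simp
            ultimately show ?thesis using False by (simp add: D_fork_def)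
          qed
        qed
        then have "plus_of j k \<in> L" using cl(6)[OF L(2), of j] bjk by simp
        then show ?thesis using bjk
          by (intro PI[of "plus_of j k" _ _ "-1"] inM) (auto simp: vec_plus_of, simp add: plus_of_def)
      qed
      have "P r q"
      proof (cases r)
        case (Minus a j)
        then have [simp]: "a = b" using rq by (simp add: N_def)
        show ?thesis
        proof (cases q)
          case q: (Minus a' k)
          then have "a' = b" "j \<noteq> k" using rq Minus by (auto simp: N_def)
          then show ?thesis using MM[of j k] sym[OF MM[of k j]] rq q Minus by (cases "j < k") auto
        next
          case q: (Plus a' k)
          then show ?thesis using MP[of j k] rq Minus by (auto simp: N_def)
        next
          case q: (Single a')
          then show ?thesis using rq cl(2)[of q] by (auto simp: N_def)
        qed
      next
        case (Plus a j)
        then have [simp]: "a = b" using rq by (simp add: N_def)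
        show ?thesis
        proof (cases q)
          case q: (Plus a' k)
          then have "a' = b" "j \<noteq> k" using rq Plus by (auto simp: N_def)
          then show ?thesis using PP[of j k] sym[OF PP[of k j]] rq q Plus by (cases "j < k") auto
        next
          case q: (Minus a' k)
          then show ?thesis using sym[OF MP[of k j]] rq Plus by (auto simp: N_def)
        next
          case q: (Single a')
          then show ?thesis using rq cl(2)[of q] by (auto simp: N_def)
        qed
      next
        case (Single a)
        then show ?thesis using rq cl(2)[of r] by (auto simp: N_def)
      qed
      then show "\<exists>p\<in>M. \<exists>c. froot_vec e r - froot_vec e q = c *\<^sub>R froot_vec e p" by (simp add: P_def)
    qed
    moreover have "{k \<in> ?F. i < k} = {k \<in> ?F. b < k}"
      using False by (auto simp: b_def) (metis Suc_lessI)
    moreover have "D_row n L b = card N" using False by (simp add: D_row_def N_def)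
    ultimately show ?thesis unfolding LMN split_base by (simp add: add_mset_commute)
  next
    case True
    have bL: "Minus b n \<in> L" "Plus b n \<in> L" using True by (auto simp: D_fork_def)
    have Mb: "Minus b c \<in> L" if "c \<in> J" for c
      using cl(3)[OF bL(1), of c] bL(1) that by (cases "c = n") (auto simp: J_def)
    have MM: "Minus a c \<in> M" if "a \<in> J" "c \<in> J" "a < c" for a c
      using cl(4)[OF Mb[OF that(2)], of a] that by (intro inM) (auto simp: J_def)
    have fork: "k \<in> ?F" if "b < k" "k < n" for k
    proof -
      have "Plus k n \<in> L" using cl(6)[OF bL(2), of k] that by (simp add: plus_of_def)
      then show ?thesis using cl(4)[OF bL(1), of k] that by (simp add: D_fork_def)
    qed
    have "{k \<in> ?F. b < k} = {b<..<n}" using fork fork_lt by auto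
    moreover have "k \<in> ?F" if "b \<le> k" "k < n" for k
      using fork[of k] True that by (cases "k = b") auto
    then have "{k \<in> ?F. i < k} = {b..<n}" using fork_lt by (auto simp: b_def)
    ultimately have cF: "card {k \<in> ?F. b < k} = card J - 1" "card {k \<in> ?F. i < k} = card J"
      by (auto simp: cJ)
    define base where "base z = E + replicate_mset z 0" for z
    have IH': "ifree W (froot_vec e ` M) (add_mset (card J - 1) (base z))"
      if "subspace W" "dual_on W e J u" "dim W = card J + z" for W u z
      using IH[OF that] by (simp add: cF base_def)
    have "ifree W (froot_vec e ` (M \<union> Minus b ` J)) (add_mset (card (Minus b ` J)) (E + {#card {k \<in> ?F. b < k}#} + replicate_mset z 0))"
    proof (rule ifree_froot_row[OF J bJ(2) MJ _ _ _ IH W u dW])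
      show "froot_over (insert b J) r" "froot_row r = b" if "r \<in> Minus b ` J" for r
        using that bJ(2) by auto
      fix r q assume "r \<in> Minus b ` J" "q \<in> Minus b ` J" "r \<noteq> q"
      then obtain j k where jk: "j \<in> J" "k \<in> J" "j \<noteq> k" "r = Minus b j" "q = Minus b k" by auto
      show "\<exists>p\<in>M. \<exists>c. froot_vec e r - froot_vec e q = c *\<^sub>R froot_vec e p"
      proof (cases "j < k")
        case True
        then show ?thesis using MM[OF jk(1,2)] jk
          by (intro bexI[of _ "Minus j k"] exI[of _ "-1"]) auto
      next
        case False
        then show ?thesis using MM[OF jk(2,1)] jk
          by (intro bexI[of _ "Minus k j"] exI[of _ 1]) auto
      qed
    qed
    \<comment> \<open>Two exponents exchange roles here. The minus forms produce
      \<open>card J\<close>, which is the new number of forks. The old number of forks,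
      \<open>card J - 1\<close>, is raised once for every plus form and ends as
      \<open>D_row n L b\<close>.\<close>
    then have start: "ifree W (froot_vec e ` (M \<union> Minus b ` J \<union> Plus b ` {}))
        (add_mset (card J - 1 + card ({} :: nat set)) (add_mset (card J) (base z)))"
      by (simp add: cF base_def card_image inj_on_def add_mset_commute)
    define Q where "Q = {k \<in> J. Plus b k \<in> L}"
    have finQ: "finite Q" using J by (simp add: Q_def)
    have "ifree W (froot_vec e ` (M \<union> Minus b ` J \<union> Plus b ` A))
        (add_mset (card J - 1 + card A) (add_mset (card J) (base z)))" if "finite A" "A \<subseteq> Q" for A
      using that
    proof (induction A)
      case empty
      show ?case by (rule start)
    next
      case (insert j K)
      have jL: "Plus b j \<in> L" and j: "j \<in> J" using insert.prems by (auto simp: Q_def)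
      let ?H = "hyp W (e b + e j)"
      have uJ: "dual_on W e J u" by (rule dual_on_subset[OF u]) auto
      have ub: "u b \<in> W" "(e b + e j) \<bullet> u b = 1"
        using u bJ(1) j by (auto simp: dual_on_def inner_add_left)
      have H: "subspace ?H" by (rule subspace_hyp[OF W])
      have "insert b J - {b} = J" using bJ by auto
      then obtain v where v: "dual_on ?H e J v"
        using dual_on_hyp[OF W u _ ub(2)] by auto
      have dH: "dim ?H = card J + z"
        using dim_hyp[OF W ub(1), of "e b + e j"] ub(2) dW J bJ by simp
      have vj: "v j \<in> ?H" "e j \<bullet> v j = 1" using v j by (auto simp: dual_on_def)
      have Pj: "plus_of j k \<in> M" if "k \<in> J" "k \<noteq> j" for k
        using cl(6)[OF jL, of k] that j
        by (intro inM) (auto simp: plus_of_commute J_def, simp add: plus_of_def)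
      have mj: "minus_of j k \<in> M" if "k \<in> J" "k \<noteq> j" for k
        using MM[of j k] MM[of k j] that j by (cases "j < k") (auto simp: minus_of_def)
      have noS: "Single k \<notin> M" for k using cl(2)[of "Single k"] by (auto simp: M_def)
      let ?N = "{r \<in> M. froot_over (J - {j}) r} \<union> Single ` (J - {j})"
      note DR = D_restriction[OF D True jL, folded J_def M_def]
      have "ifree (hyp ?H (e j)) (froot_vec e ` ?N)
          (image_mset (\<lambda>i. card {r \<in> ?N. froot_row r = i}) (mset_set (J - {j})) + replicate_mset z 0)"
      proof (rule ifree_row_closed[OF _ subspace_hyp[OF H] dual_on_hyp[OF H v j vj(2)] _ DR(1)])
        show "finite (J - {j})" using J by simp
        show "dim (hyp ?H (e j)) = card (J - {j}) + z"
        proof -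
          have "Suc (card (J - {j})) = card J" by (rule card_Suc_Diff1[OF J j])
          then show ?thesis using dim_hyp[OF H vj(1), of "e j"] vj(2) dH by simp
        qed
        show "froot_over (J - {j}) r" if "r \<in> ?N" for r using that by auto
      qed
      then have rr: "ifree (hyp ?H (e j)) (froot_vec e ` ?N) (base z)" by (simp only: DR(2) base_def E_def)
      \<comment> \<open>The restriction for the form \<open>e b + e j\<close> is itself obtained by
        one addition: \<open>e j\<close> joins the lower rows \<open>M\<close>, for which the
        induction hypothesis is available on \<open>?H\<close>.\<close>
      have "ifree ?H (insert (e j) (froot_vec e ` M)) (add_mset (card J) (base z))"
        by (rule ifree_add_single[OF J H v j MJ noS Pj mj IH'[OF H v dH] rr])
      then have "ifree W (froot_vec e ` (M \<union> Minus b ` J \<union> Plus b ` insert j K))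
          (add_mset (card J + card K) (add_mset (card J) (base z)))"
        using insert.IH insert.prems insert.hyps mj
        by (intro ifree_add_plus[OF J bJ(2) W u j _ MJ noS Pj]) (auto simp: Q_def)
      moreover have "card J + card K = card J - 1 + card (insert j K)"
      proof -
        have "card J > 0" using J j card_gt_0_iff by blast
        then show ?thesis using insert.hyps by simp
      qed
      ultimately show ?case by (simp only:)
    qed
    note fin = this[OF finQ subset_refl]
    have N: "N = Minus b ` J \<union> Plus b ` Q"
    proof
      show "N \<subseteq> Minus b ` J \<union> Plus b ` Q"
      proof
        fix r assume r: "r \<in> N"
        then show "r \<in> Minus b ` J \<union> Plus b ` Q"
          using NJ[OF r] cl(2)[of r] by (cases r) (auto simp: N_def Q_def)
      qed
      show "Minus b ` J \<union> Plus b ` Q \<subseteq> N" using Mb by (auto simp: N_def Q_def)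
    qed
    have "card N = card J + card Q" unfolding N by (rule card_Minus_Plus[OF J finQ])
    then have "D_row n L b = card J - 1 + card Q"
      using True bn cJ by (simp add: D_row_def N_def)
    then show ?thesis
      using fin unfolding LMN split_base N cF base_def by (simp add: Un_assoc add_mset_commute)
  qed
qed

section \<open>Partitions and root systems\<close>

lemma le_card_initial_segment:
  assumes fin: "finite {j. 1 \<le> j \<and> P j}" and down: "\<And>j k. P k \<Longrightarrow> 1 \<le> j \<Longrightarrow> j \<le> k \<Longrightarrow> P j"
    and k: "1 \<le> (k::nat)"
  shows "k \<le> card {j. 1 \<le> j \<and> P j} \<longleftrightarrow> P k"
proof
  assume "P k"
  then have "{1..k} \<subseteq> {j. 1 \<le> j \<and> P j}" using down by auto
  then show "k \<le> card {j. 1 \<le> j \<and> P j}" using card_mono[OF fin, of "{1..k}"] by simp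
next
  assume le: "k \<le> card {j. 1 \<le> j \<and> P j}"
  show "P k"
  proof (rule ccontr)
    assume "\<not> P k"
    have "{j. 1 \<le> j \<and> P j} \<subseteq> {1..<k}"
    proof
      fix x assume "x \<in> {j. 1 \<le> j \<and> P j}"
      then show "x \<in> {1..<k}" using down[of x k] \<open>\<not> P k\<close> k by (cases "x < k") auto
    qed
    then have "card {j. 1 \<le> j \<and> P j} \<le> card {1..<k}" by (intro card_mono) auto
    then show False using le k by simp
  qed
qed

lemma mset_eq_by_tails:
  fixes A B :: "nat multiset"
  assumes "\<And>k. size (filter_mset (\<lambda>x. k \<le> x) A) = size (filter_mset (\<lambda>x. k \<le> x) B)"
  shows "A = B"
proof (rule multiset_eqI)
  have "size (filter_mset (\<lambda>x. k \<le> x) C) = count C k + size (filter_mset (\<lambda>x. Suc k \<le> x) C)" for C :: "nat multiset" and k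
    by (induction C) auto
  from this[of _ A] this[of _ B] show "count A x = count B x" for x
    using assms by (metis add_right_cancel)
qed

lemma size_filter_image_mset_set:
  assumes "finite A"
  shows "size (filter_mset P (image_mset f (mset_set A))) = card {a \<in> A. P (f a)}"
  using assms by (simp add: filter_mset_image_mset filter_mset_mset_set)

text \<open>Both multisets are compared by the number of entries that are at least \<open>k\<close>.
  For \<open>k \<ge> 1\<close> an index \<open>i\<close> counts on the left iff
  \<open>s - i + 1 \<le> lam k\<close>, which selects the last \<open>lam k\<close> indices up to
  \<open>s\<close>; on the right the number is \<open>lam k\<close> by assumption. The zeros only
  make the total sizes agree.\<close>

lemma conjugate_partition:
  fixes r :: "nat \<Rightarrow> nat" and lam :: "nat \<Rightarrow> nat"
  assumes J: "finite J" and lam: "\<And>j. 1 \<le> j \<Longrightarrow> lam j = card {i \<in> J. j \<le> r i}" and s: "s = lam 1"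
  shows "replicate_mset (card J - s) 0 + mset (map (\<lambda>i. card {j. 1 \<le> j \<and> lam j \<ge> s - i + 1}) [1..<s + 1])
    = image_mset r (mset_set J)"
proof (rule mset_eq_by_tails)
  let ?m = "\<lambda>i. card {j. 1 \<le> j \<and> lam j \<ge> s - i + 1}"
  have R: "mset (map ?m [1..<s + 1]) = image_mset ?m (mset_set {1..<s + 1})" by (simp only: mset_map mset_upt)
  have mono: "lam k \<le> lam j" if "1 \<le> j" "j \<le> k" for j k
    using that J lam[of j] lam[of k] by (auto intro!: card_mono)
  have fin: "finite {j. 1 \<le> j \<and> lam j \<ge> Suc t}" for t
  proof (rule finite_subset)
    show "{j. 1 \<le> j \<and> lam j \<ge> Suc t} \<subseteq> {..Max (insert 0 (r ` J))}"
    proof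
      fix j assume "j \<in> {j. 1 \<le> j \<and> lam j \<ge> Suc t}"
      then have "card {i \<in> J. j \<le> r i} > 0" using lam[of j] by simp
      then obtain i where "i \<in> J" "j \<le> r i" using J by (auto simp: card_gt_0_iff)
      then show "j \<in> {..Max (insert 0 (r ` J))}" using J by (auto simp: Max_ge_iff)
    qed
  qed simp
  have sJ: "s \<le> card J" unfolding s using lam[of 1] J by (auto intro!: card_mono)
  fix k
  show "size (filter_mset (\<lambda>x. k \<le> x) (replicate_mset (card J - s) 0 + mset (map ?m [1..<s + 1])))
     = size (filter_mset (\<lambda>x. k \<le> x) (image_mset r (mset_set J)))"
  proof (cases "k = 0")
    case True
    then show ?thesis using sJ J by (simp add: R del: upt_Suc)
  next
    case False
    then have k: "1 \<le> k" by simp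
    have iff: "k \<le> ?m i \<longleftrightarrow> lam k \<ge> s - i + 1" for i
    proof (rule le_card_initial_segment[OF _ _ k])
      show "finite {j. 1 \<le> j \<and> s - i + 1 \<le> lam j}" using fin[of "s - i"] by simp
      show "s - i + 1 \<le> lam j" if "s - i + 1 \<le> lam l" "1 \<le> j" "j \<le> l" for j l
        using mono[OF that(2,3)] that(1) by linarith
    qed
    have ks: "lam k \<le> s" unfolding s using mono[of 1 k] k by simp
    have "{i \<in> {1..<s + 1}. k \<le> ?m i} = {i \<in> {1..<s + 1}. s - i + 1 \<le> lam k}"
      by (simp only: iff)
    also have "\<dots> = {s + 1 - lam k..<s + 1}" using ks by auto
    finally have "size (filter_mset (\<lambda>x. k \<le> x) (mset (map ?m [1..<s + 1]))) = card {s + 1 - lam k..<s + 1}"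
      by (simp only: R size_filter_image_mset_set[OF finite_atLeastLessThan])
    then have "size (filter_mset (\<lambda>x. k \<le> x) (mset (map ?m [1..<s + 1]))) = lam k"
      using ks by (simp del: upt_Suc)
    moreover have "filter_mset (\<lambda>x. k \<le> x) (replicate_mset (card J - s) 0) = {#}"
      using False by (simp add: filter_mset_eq_conv)
    ultimately show ?thesis
      using size_filter_image_mset_set[OF J, of "\<lambda>x. k \<le> x" r] lam[OF k] by (simp del: upt_Suc)
  qed
qed

text \<open>The values of \<open>ht\<close> form an initial segment of the positive integers and
  none is repeated. The set \<open>N\<close> will be a row of roots, or the set of forks
  \<open>i\<close> measured by \<open>n - i\<close>.\<close>

lemma card_fibre_prefix:
  fixes ht :: "'b \<Rightarrow> nat"
  assumes N: "finite N" and inj: "inj_on ht N" and pos: "\<And>r. r \<in> N \<Longrightarrow> 1 \<le> ht r"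
    and pred: "\<And>r. r \<in> N \<Longrightarrow> 1 < ht r \<Longrightarrow> \<exists>q\<in>N. Suc (ht q) = ht r"
    and j: "1 \<le> j"
  shows "card {r \<in> N. ht r = j} = (if j \<le> card N then 1 else 0)"
proof -
  have down: "k \<in> ht ` N \<Longrightarrow> 1 \<le> j \<Longrightarrow> j \<le> k \<Longrightarrow> j \<in> ht ` N" for j k
  proof (induction k)
    case (Suc k)
    show ?case
    proof (cases "j = Suc k")
      case False
      then obtain r where r: "r \<in> N" "ht r = Suc k" "1 < ht r" using Suc.prems by auto
      then obtain q where "q \<in> N" "ht q = k" using pred[OF r(1,3)] by auto
      then show ?thesis using Suc.IH Suc.prems False by auto
    qed (use Suc.prems in simp)
  qed simp
  have eq: "{j. 1 \<le> j \<and> j \<in> ht ` N} = ht ` N" using pos by auto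
  have "j \<le> card (ht ` N) \<longleftrightarrow> j \<in> ht ` N"
    using le_card_initial_segment[of "\<lambda>j. j \<in> ht ` N" j] down j N unfolding eq by simp
  then have iff: "j \<le> card N \<longleftrightarrow> j \<in> ht ` N" using card_image[OF inj] by simp
  show ?thesis
  proof (cases "j \<in> ht ` N")
    case True
    then obtain r where "r \<in> N" "ht r = j" by auto
    then have "{r \<in> N. ht r = j} = {r}" using inj by (auto simp: inj_on_def)
    then show ?thesis using iff True by simp
  next
    case False
    then have "{r \<in> N. ht r = j} = {}" by auto
    then have "card {r \<in> N. ht r = j} = 0" by (simp only: card.empty)
    then show ?thesis using iff False by simp
  qed
qed

lemma card_by_rows:
  assumes "finite L" "\<And>r. r \<in> L \<Longrightarrow> froot_row r \<in> J" "finite J"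
  shows "card {r \<in> L. P r} = (\<Sum>i\<in>J. card {r \<in> {r \<in> L. froot_row r = i}. P r})"
proof -
  have "{r \<in> L. P r} = (\<Union>i\<in>J. {r \<in> {r \<in> L. froot_row r = i}. P r})" using assms(2) by auto
  also have "card \<dots> = (\<Sum>i\<in>J. card {r \<in> {r \<in> L. froot_row r = i}. P r})"
    using assms by (intro card_UN_disjoint) auto
  finally show ?thesis .
qed

section \<open>Positive roots, simple reflections and dual bases\<close>

lemma sum_Nats: "(\<And>a. a \<in> A \<Longrightarrow> f a \<in> \<nat>) \<Longrightarrow> sum f A \<in> \<nat>"
  by (induction A rule: infinite_finite_induct) auto

text \<open>Reflecting in a simple root \<open>\<alpha>\<close> with \<open>\<beta> \<bullet> \<alpha> > 0\<close> lowers the height of \<open>\<beta>\<close>.\<close>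

lemma reflection_stable_subset:
  fixes \<Delta> :: "'a::euclidean_space set"
  assumes \<Delta>: "independent \<Delta>" "span \<Delta> = UNIV"
    and P: "\<And>\<beta>. \<beta> \<in> P \<Longrightarrow> \<beta> \<noteq> 0" "\<And>\<beta> \<alpha>. \<beta> \<in> P \<Longrightarrow> \<alpha> \<in> \<Delta> \<Longrightarrow> representation \<Delta> \<beta> \<alpha> \<in> \<nat>"
      "\<And>\<beta> \<alpha>. \<beta> \<in> P \<Longrightarrow> \<alpha> \<in> \<Delta> \<Longrightarrow> \<beta> \<noteq> \<alpha> \<Longrightarrow> root_reflection \<alpha> \<beta> \<in> P"
    and Q: "\<Delta> \<subseteq> Q" "\<And>\<beta> \<alpha>. \<beta> \<in> Q \<Longrightarrow> \<alpha> \<in> \<Delta> \<Longrightarrow> \<beta> \<noteq> \<alpha> \<Longrightarrow> root_reflection \<alpha> \<beta> \<in> Q"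
  shows "P \<subseteq> Q"
proof
  have fin: "finite \<Delta>" using \<Delta>(1) by (rule independent_imp_finite)
  have nat: "height \<Delta> \<beta> \<in> \<nat>" if "\<beta> \<in> P" for \<beta>
    unfolding height_def using P(2)[OF that] by (intro sum_Nats)
  have "\<beta> \<in> P \<Longrightarrow> height \<Delta> \<beta> = real m \<Longrightarrow> \<beta> \<in> Q" for \<beta> m
  proof (induction m arbitrary: \<beta> rule: less_induct)
    case (less m)
    show ?case
    proof (cases "\<beta> \<in> \<Delta>")
      case True
      then show ?thesis using Q(1) by blast
    next
      case False
      have \<beta>: "(\<Sum>\<alpha>\<in>\<Delta>. representation \<Delta> \<beta> \<alpha> *\<^sub>R \<alpha>) = \<beta>"
        using sum_representation_eq[OF \<Delta>(1) _ fin subset_refl, of \<beta>] \<Delta>(2) by simp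
      \<comment> \<open>Expanding the squared length of \<open>\<beta>\<close> over the simple roots
        shows that some summand is positive, which provides the simple root to reflect in.\<close>
      have "0 < \<beta> \<bullet> (\<Sum>\<alpha>\<in>\<Delta>. representation \<Delta> \<beta> \<alpha> *\<^sub>R \<alpha>)"
        unfolding \<beta> using P(1)[OF less.prems(1)] by simp
      then have "0 < (\<Sum>\<alpha>\<in>\<Delta>. representation \<Delta> \<beta> \<alpha> * (\<beta> \<bullet> \<alpha>))" by (simp add: inner_sum_right)
      then obtain \<alpha> where \<alpha>: "\<alpha> \<in> \<Delta>" "0 < representation \<Delta> \<beta> \<alpha> * (\<beta> \<bullet> \<alpha>)"
        by (meson not_le sum_nonpos)
      have "representation \<Delta> \<beta> \<alpha> \<ge> 0" using P(2)[OF less.prems(1) \<alpha>(1)] by (auto simp: Nats_def)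
      then have "\<beta> \<bullet> \<alpha> > 0" using \<alpha>(2) by (simp add: zero_less_mult_iff)
      moreover have "\<alpha> \<noteq> 0" using \<alpha>(1) \<Delta>(1) dependent_zero by blast
      ultimately have c: "cartan_int \<beta> \<alpha> > 0" by (simp add: cartan_int_def)
      define \<gamma> where "\<gamma> = root_reflection \<alpha> \<beta>"
      have \<gamma>: "\<gamma> \<in> P" unfolding \<gamma>_def using P(3)[OF less.prems(1) \<alpha>(1)] \<alpha>(1) False by blast
      have rep: "representation \<Delta> \<gamma> \<delta> = representation \<Delta> \<beta> \<delta> - cartan_int \<beta> \<alpha> * (if \<delta> = \<alpha> then 1 else 0)" for \<delta>
        unfolding \<gamma>_def root_reflection_def using \<Delta> \<alpha>(1)
        by (simp add: representation_diff representation_scale representation_basis)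
      have "height \<Delta> \<gamma> = height \<Delta> \<beta> - cartan_int \<beta> \<alpha>"
        unfolding height_def rep using fin \<alpha>(1) by (simp add: sum_subtractf sum_distrib_left[symmetric])
      then have lt: "height \<Delta> \<gamma> < real m" using c less.prems(2) by simp
      obtain k where k: "height \<Delta> \<gamma> = real k" using nat[OF \<gamma>] by (auto simp: Nats_def)
      have "\<gamma> \<in> Q" using less.IH[OF _ \<gamma> k] lt k by simp
      \<comment> \<open>Stability of \<open>Q\<close> excludes the reflecting root itself. If
        \<open>\<gamma>\<close> were \<alpha>, reflecting back would give
        \<open>\<beta> = - \<alpha>\<close>, which has a negative coefficient.\<close>
      moreover have "\<gamma> \<noteq> \<alpha>"
      proof
        assume e: "\<gamma> = \<alpha>"
        have rr: "root_reflection \<alpha> \<gamma> = \<beta>"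
          unfolding \<gamma>_def root_reflection_def cartan_int_def using \<open>\<alpha> \<noteq> 0\<close>
          by (simp add: inner_diff_left scaleR_diff_left algebra_simps)
        have "\<beta> = - \<alpha>"
          using rr \<open>\<alpha> \<noteq> 0\<close> unfolding e root_reflection_def cartan_int_def by (simp add: scaleR_2)
        then have "representation \<Delta> \<beta> \<alpha> = - 1"
          using \<Delta> \<alpha>(1) by (simp add: representation_neg representation_basis)
        then show False using \<open>representation \<Delta> \<beta> \<alpha> \<ge> 0\<close> by simp
      qed
      ultimately have "root_reflection \<alpha> \<gamma> \<in> Q" using Q(2) \<alpha>(1) by blast
      moreover have "root_reflection \<alpha> \<gamma> = \<beta>"
        unfolding \<gamma>_def root_reflection_def cartan_int_def using \<open>\<alpha> \<noteq> 0\<close>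
        by (simp add: inner_diff_left scaleR_diff_left algebra_simps)
      ultimately show ?thesis by simp
    qed
  qed
  then show "\<beta> \<in> Q" if "\<beta> \<in> P" for \<beta> using nat[OF that] that by (auto simp: Nats_def)
qed

text \<open>A simple reflection changes only the coefficient at \<alpha>. Since the system is
  reduced, a positive root other than \<alpha> has another positive coefficient. That one survives,
  and as the coefficients of a root share one sign, the image is positive.\<close>

lemma positive_roots_stable:
  fixes \<Phi> :: "'a::euclidean_space set"
  assumes \<Phi>: "root_system \<Phi>" and \<Delta>: "simple_roots \<Phi> \<Delta>" and \<beta>: "\<beta> \<in> positive_roots \<Phi> \<Delta>"
  shows "\<beta> \<noteq> 0" "\<alpha> \<in> \<Delta> \<Longrightarrow> representation \<Delta> \<beta> \<alpha> \<in> \<nat>"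
    "\<alpha> \<in> \<Delta> \<Longrightarrow> \<beta> \<noteq> \<alpha> \<Longrightarrow> root_reflection \<alpha> \<beta> \<in> positive_roots \<Phi> \<Delta>"
proof -
  have D: "\<Delta> \<subseteq> \<Phi>" "independent \<Delta>" "span \<Delta> = UNIV"
    and dich: "\<And>\<beta>. \<beta> \<in> \<Phi> \<Longrightarrow> (\<forall>\<alpha>\<in>\<Delta>. representation \<Delta> \<beta> \<alpha> \<in> \<nat>) \<or> (\<forall>\<alpha>\<in>\<Delta>. - representation \<Delta> \<beta> \<alpha> \<in> \<nat>)"
    using \<Delta> by (auto simp: simple_roots_def)
  have fin: "finite \<Delta>" using D(2) by (rule independent_imp_finite)
  have b: "\<beta> \<in> \<Phi>" "\<And>\<alpha>. \<alpha> \<in> \<Delta> \<Longrightarrow> representation \<Delta> \<beta> \<alpha> \<ge> 0"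
    using \<beta> by (auto simp: positive_roots_def)
  show "\<beta> \<noteq> 0" using b(1) \<Phi> by (auto simp: root_system_def)
  have Nats_nonneg: "x \<ge> 0" if "x \<in> \<nat>" for x :: real using that by (auto simp: Nats_def)
  show "representation \<Delta> \<beta> \<alpha> \<in> \<nat>" if "\<alpha> \<in> \<Delta>" for \<alpha>
    using dich[OF b(1)]
  proof
    assume "\<forall>\<alpha>\<in>\<Delta>. - representation \<Delta> \<beta> \<alpha> \<in> \<nat>"
    then have "- representation \<Delta> \<beta> \<alpha> \<ge> 0" using that Nats_nonneg by blast
    then have "representation \<Delta> \<beta> \<alpha> = 0" using b(2)[OF that] by simp
    then show ?thesis by simp
  qed (use that in blast)
  assume a: "\<alpha> \<in> \<Delta>" "\<beta> \<noteq> \<alpha>"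
  define \<gamma> where "\<gamma> = root_reflection \<alpha> \<beta>"
  have \<gamma>\<Phi>: "\<gamma> \<in> \<Phi>" using \<Phi> a(1) D(1) b(1) unfolding root_system_def \<gamma>_def by blast
  have rep: "representation \<Delta> \<gamma> \<delta> = representation \<Delta> \<beta> \<delta> - cartan_int \<beta> \<alpha> * (if \<delta> = \<alpha> then 1 else 0)" for \<delta>
    unfolding \<gamma>_def root_reflection_def using D a(1)
    by (simp add: representation_diff representation_scale representation_basis)
  have "\<exists>\<delta>\<in>\<Delta>. \<delta> \<noteq> \<alpha> \<and> representation \<Delta> \<beta> \<delta> \<noteq> 0"
  proof (rule ccontr)
    assume "\<not> ?thesis"
    then have z: "(\<Sum>\<delta>\<in>\<Delta> - {\<alpha>}. representation \<Delta> \<beta> \<delta> *\<^sub>R \<delta>) = 0"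
      by (intro sum.neutral) auto
    have "\<beta> = (\<Sum>\<delta>\<in>\<Delta>. representation \<Delta> \<beta> \<delta> *\<^sub>R \<delta>)"
      using sum_representation_eq[OF D(2) _ fin subset_refl, of \<beta>] D(3) by simp
    also have "\<dots> = representation \<Delta> \<beta> \<alpha> *\<^sub>R \<alpha>"
      using fin a(1) z by (simp add: sum.remove[of _ \<alpha>])
    finally have e: "\<beta> = representation \<Delta> \<beta> \<alpha> *\<^sub>R \<alpha>" .
    then have "representation \<Delta> \<beta> \<alpha> *\<^sub>R \<alpha> \<in> \<Phi>" using b(1) by simp
    then have "representation \<Delta> \<beta> \<alpha> = 1 \<or> representation \<Delta> \<beta> \<alpha> = -1"
      using \<Phi> a(1) D(1) unfolding root_system_def by blast
    then show False using b(2)[OF a(1)] e a(2) by auto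
  qed
  then obtain \<delta> where \<delta>: "\<delta> \<in> \<Delta>" "\<delta> \<noteq> \<alpha>" "representation \<Delta> \<beta> \<delta> \<noteq> 0" by blast
  then have pos: "representation \<Delta> \<gamma> \<delta> > 0" using b(2)[OF \<delta>(1)] rep by simp
  have "\<forall>\<alpha>\<in>\<Delta>. representation \<Delta> \<gamma> \<alpha> \<in> \<nat>"
    using dich[OF \<gamma>\<Phi>]
  proof
    assume "\<forall>\<alpha>\<in>\<Delta>. - representation \<Delta> \<gamma> \<alpha> \<in> \<nat>"
    then have "- representation \<Delta> \<gamma> \<delta> \<ge> 0" using \<delta>(1) Nats_nonneg by blast
    then show ?thesis using pos by simp
  qed
  then show "root_reflection \<alpha> \<beta> \<in> positive_roots \<Phi> \<Delta>"
    using \<gamma>\<Phi> Nats_nonneg unfolding \<gamma>_def[symmetric] positive_roots_def by auto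
qed

text \<open>The dual vector is the suitably scaled component of \<open>e k\<close> orthogonal to the
  span of the other vectors. It is nonzero because those others are too few to span the
  space.\<close>

lemma dual_basis_exists:
  fixes e :: "nat \<Rightarrow> 'a::euclidean_space"
  assumes J: "finite J" "card J = DIM('a)" and sp: "span (e ` J) = UNIV"
  shows "\<exists>u. dual_on UNIV e J u"
proof -
  have "\<exists>v. \<forall>l\<in>J. e l \<bullet> v = (if l = k then 1 else 0)" if k: "k \<in> J" for k
  proof -
    let ?S = "e ` (J - {k})"
    have "e k \<notin> span ?S"
    proof
      assume "e k \<in> span ?S"
      then have "span (insert (e k) ?S) = span ?S" by (rule span_redundant)
      moreover have "insert (e k) ?S = e ` J" using k by auto
      ultimately have "span ?S = UNIV" using sp by simp
      then have "DIM('a) = dim ?S" by (metis dim_UNIV dim_span)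
      also have "\<dots> \<le> card ?S" using J by (intro dim_le_card') auto
      also have "\<dots> \<le> card (J - {k})" using J by (intro card_image_le) auto
      also have "\<dots> < card J" using J k by (intro psubset_card_mono) auto
      finally show False using J by simp
    qed
    obtain y z where yz: "y \<in> span ?S" "\<And>w. w \<in> span ?S \<Longrightarrow> orthogonal z w" "e k = y + z"
      using orthogonal_subspace_decomp_exists[of ?S "e k"] by metis
    have "z \<noteq> 0" using yz(1,3) \<open>e k \<notin> span ?S\<close> by auto
    have "z \<bullet> y = 0" using yz(2)[OF yz(1)] by (simp add: orthogonal_def)
    then have ek: "e k \<bullet> z = z \<bullet> z" unfolding yz(3) by (simp add: inner_add_left inner_commute[of y])
    have "e l \<bullet> ((1 / (z \<bullet> z)) *\<^sub>R z) = (if l = k then 1 else 0)" if l: "l \<in> J" for l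
    proof (cases "l = k")
      case True
      then show ?thesis using ek \<open>z \<noteq> 0\<close> by simp
    next
      case False
      then have "e l \<in> span ?S" using l by (intro span_base) auto
      then have "z \<bullet> e l = 0" using yz(2) by (simp add: orthogonal_def)
      then show ?thesis using False by (simp add: inner_commute)
    qed
    then show ?thesis by blast
  qed
  then have "\<exists>u. \<forall>k\<in>J. \<forall>l\<in>J. e l \<bullet> u k = (if l = k then 1 else 0)" by metis
  then show ?thesis by (simp add: dual_on_def)
qed

section \<open>Coordinates for the classical types\<close>

lemma cartan_int_add: "cartan_int (x + y) \<alpha> = cartan_int x \<alpha> + cartan_int y \<alpha>"
  and cartan_int_diff: "cartan_int (x - y) \<alpha> = cartan_int x \<alpha> - cartan_int y \<alpha>"
  and cartan_int_scaleR: "cartan_int (c *\<^sub>R x) \<alpha> = c * cartan_int x \<alpha>"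
  by (simp_all add: cartan_int_def inner_add_left inner_diff_left algebra_simps add_divide_distrib diff_divide_distrib)

lemma root_reflection_add: "root_reflection \<alpha> (x + y) = root_reflection \<alpha> x + root_reflection \<alpha> y"
  and root_reflection_diff: "root_reflection \<alpha> (x - y) = root_reflection \<alpha> x - root_reflection \<alpha> y"
  and root_reflection_scaleR: "root_reflection \<alpha> (c *\<^sub>R x) = c *\<^sub>R root_reflection \<alpha> x"
  by (simp_all add: root_reflection_def cartan_int_add cartan_int_diff cartan_int_scaleR algebra_simps)

text \<open>The root system is left out: the coordinates and the candidates for positive roots are
  read off from the Cartan integers of the simple roots alone.\<close>

locale classical_basis =
  fixes \<Delta> :: "'a::euclidean_space set" and X :: classical_type and n :: nat and a :: "nat \<Rightarrow> 'a"
  assumes indep: "independent \<Delta>" and spans: "span \<Delta> = UNIV" and rank: "min_rank X \<le> n"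
    and a: "bij_betw a {1..n} \<Delta>"
    and cartan: "\<And>i j. i \<in> {1..n} \<Longrightarrow> j \<in> {1..n} \<Longrightarrow> cartan_int (a i) (a j) = cartan_matrix X n i j"
begin

definition tyA :: bool where "tyA \<longleftrightarrow> X = Type_A"
definition tyB :: bool where "tyB \<longleftrightarrow> X = Type_B"
definition tyC :: bool where "tyC \<longleftrightarrow> X = Type_C"
definition tyD :: bool where "tyD \<longleftrightarrow> X = Type_D"

lemma type_cases:
  obtains (A) "tyA" "\<not> tyB" "\<not> tyC" "\<not> tyD" | (B) "\<not> tyA" "tyB" "\<not> tyC" "\<not> tyD"
    | (C) "\<not> tyA" "\<not> tyB" "tyC" "\<not> tyD" | (D) "\<not> tyA" "\<not> tyB" "\<not> tyC" "tyD"
  unfolding tyA_def tyB_def tyC_def tyD_def by (cases X) auto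

lemma cartan_matrix_type:
  "tyA \<Longrightarrow> cartan_matrix X n i j = type_A_matrix i j"
  "tyB \<Longrightarrow> cartan_matrix X n i j = (if (i, j) = (n - 1, n) then -2 else type_A_matrix i j)"
  "tyC \<Longrightarrow> cartan_matrix X n i j = (if (i, j) = (n, n - 1) then -2 else type_A_matrix i j)"
  "tyD \<Longrightarrow> cartan_matrix X n i j = (if (i, j) \<in> {(n - 1, n), (n, n - 1)} then 0
      else if (i, j) \<in> {(n - 2, n), (n, n - 2)} then -1 else type_A_matrix i j)"
  by (auto simp: tyA_def tyB_def tyC_def tyD_def)

lemma rank_type: "1 \<le> n" "tyB \<Longrightarrow> 2 \<le> n" "tyC \<Longrightarrow> 3 \<le> n" "tyD \<Longrightarrow> 4 \<le> n"
proof -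
  show "1 \<le> n" using rank by (cases X) auto
  show "tyB \<Longrightarrow> 2 \<le> n" "tyC \<Longrightarrow> 3 \<le> n" "tyD \<Longrightarrow> 4 \<le> n"
    using rank by (auto simp: tyB_def tyC_def tyD_def)
qed

text \<open>The last coordinate vector is forced by the shape of the top simple root:
  \<open>e n\<close> in types A and B, \<open>2 *\<^sub>R e n\<close> in type C. In type D one has
  \<open>a n = e (n - 1) + e n\<close> and \<open>a (n - 1) = e (n - 1) - e n\<close>, whose half
  difference is \<open>e n\<close>.\<close>

definition e_last :: 'a where
  "e_last = (if tyC then (1/2) *\<^sub>R a n else if tyD then (1/2) *\<^sub>R (a n - a (n - 1)) else a n)"

text \<open>The usual orthogonal coordinates in types B, C, D. In type A the vectors
  \<open>\<epsilon>\<^sub>i - \<epsilon>\<^sub>n\<^sub>+\<^sub>1\<close> are used, which makes the positive roots of A a part of those of B.\<close>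

definition e :: "nat \<Rightarrow> 'a" where
  "e i = e_last + (\<Sum>k=i..<n. a k)"

lemmas n_pos = rank_type(1)

lemma e_n: "e n = e_last"
  by (simp add: e_def)

lemma e_step: "i < n \<Longrightarrow> e i = a i + e (Suc i)"
  by (simp add: e_def sum.atLeast_Suc_lessThan algebra_simps)

lemma a_low: "i < n \<Longrightarrow> a i = e i - e (Suc i)"
  using e_step by simp

lemma a_top:
  "tyA \<Longrightarrow> a n = e n" "tyB \<Longrightarrow> a n = e n" "tyC \<Longrightarrow> a n = 2 *\<^sub>R e n"
  "tyD \<Longrightarrow> a n = e (n - 1) + e n"
proof -
  assume D: "tyD"
  then have C: "\<not> tyC" by (cases rule: type_cases) auto
  have "e (n - 1) = a (n - 1) + e n" using e_step[of "n - 1"] rank_type(4)[OF D] by simp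
  moreover have "e n + e n = a n - a (n - 1)"
    using D C by (simp add: e_n e_last_def flip: scaleR_add_left)
  ultimately show "a n = e (n - 1) + e n" by (simp add: add.assoc)
qed (cases rule: type_cases; simp add: e_n e_last_def)+

lemma cartan_low: "1 \<le> i \<Longrightarrow> i < n \<Longrightarrow> 1 \<le> k \<Longrightarrow> k < n \<Longrightarrow> cartan_int (a i) (a k) = type_A_matrix i k"
  using cartan[of i k] by (cases rule: type_cases) (auto simp: cartan_matrix_type)

lemma cartan_e_low:
  assumes k: "1 \<le> k" "k < n" and i: "1 \<le> i" "i \<le> n"
  shows "cartan_int (e i) (a k) = (if i = k then 1 else if i = Suc k then -1 else 0)"
  using i(2)
proof (induction rule: inc_induct)
  case base
  have c: "cartan_int (a n) (a k) = cartan_matrix X n n k" using cartan k n_pos by auto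
  show ?case
  proof (cases rule: type_cases)
    case D
    then have n: "4 \<le> n" using rank_type by simp
    have "cartan_int (a (n - 1)) (a k) = type_A_matrix (n - 1) k" using cartan_low k n by simp
    then show ?thesis using c k n D
      by (auto simp: cartan_matrix_type e_n e_last_def cartan_int_scaleR cartan_int_diff type_A_matrix_def; arith)
  qed (use c k in \<open>auto simp: cartan_matrix_type e_n e_last_def cartan_int_scaleR type_A_matrix_def\<close>)
next
  case (step m)
  then have "cartan_int (a m) (a k) = type_A_matrix m k" using cartan_low k i by simp
  then show ?case using step e_step[of m] by (auto simp: cartan_int_add type_A_matrix_def)
qed

text \<open>The value 1 for \<open>i < n\<close> in type A reflects that the vectors
  \<open>\<epsilon>\<^sub>i - \<epsilon>\<^sub>n\<^sub>+\<^sub>1\<close> are not orthogonal to each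
  other.\<close>

lemma cartan_e_top:
  assumes i: "1 \<le> i" "i \<le> n"
  shows "cartan_int (e i) (a n) = (if tyA then if i = n then 2 else 1
    else if tyB then if i = n then 2 else 0 else if tyC then if i = n then 1 else 0
    else if i = n \<or> i = n - 1 then 1 else 0)"
  using i(2)
proof (induction rule: inc_induct)
  case base
  have c: "cartan_int (a n) (a n) = cartan_matrix X n n n" using cartan n_pos by auto
  show ?case
  proof (cases rule: type_cases)
    case D
    then have n: "4 \<le> n" using rank_type by simp
    have "cartan_int (a (n - 1)) (a n) = cartan_matrix X n (n - 1) n" using cartan n by auto
    then show ?thesis using c n D
      by (auto simp: cartan_matrix_type e_n e_last_def cartan_int_scaleR cartan_int_diff type_A_matrix_def)
  qed (use c n_pos in \<open>auto simp: cartan_matrix_type e_n e_last_def cartan_int_scaleR type_A_matrix_def\<close>)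
next
  case (step m)
  then have "cartan_int (a m) (a n) = cartan_matrix X n m n" using cartan i by simp
  then show ?case using step e_step[of m] rank_type i
    by (cases rule: type_cases) (auto simp: cartan_matrix_type cartan_int_add type_A_matrix_def)
qed

lemma reflection_low:
  assumes "1 \<le> k" "k < n" "1 \<le> i" "i \<le> n"
  shows "root_reflection (a k) (e i) = e (if i = k then Suc k else if i = Suc k then k else i)"
  using cartan_e_low[OF assms] a_low[OF assms(2)] by (auto simp: root_reflection_def)

lemma reflection_top:
  assumes "1 \<le> i" "i \<le> n"
  shows "tyA \<Longrightarrow> root_reflection (a n) (e i) = (if i = n then - e n else e i - e n)"
    "tyB \<or> tyC \<Longrightarrow> root_reflection (a n) (e i) = (if i = n then - e n else e i)"
    "tyD \<Longrightarrow> root_reflection (a n) (e i) = (if i = n then - e (n - 1) else if i = n - 1 then - e n else e i)"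
  using cartan_e_top[OF assms] a_top
  by (cases rule: type_cases; auto simp: root_reflection_def scaleR_2)+

text \<open>In type C the long roots are twice a coordinate vector; apart from this factor, which
  does not affect hyperplanes, \<open>rv\<close> is \<open>froot_vec e\<close>.\<close>

definition rv :: "froot \<Rightarrow> 'a" where
  "rv r = (case r of Single i \<Rightarrow> (if tyC then 2 else 1) *\<^sub>R e i | _ \<Rightarrow> froot_vec e r)"

lemma rv_simps [simp]:
  "rv (Minus i j) = e i - e j" "rv (Plus i j) = e i + e j"
  "rv (Single i) = (if tyC then 2 else 1) *\<^sub>R e i"
  by (simp_all add: rv_def)

definition roots :: "froot set" where
  "roots = {r. froot_over {1..n} r \<and> (case r of Minus _ _ \<Rightarrow> True | Plus _ _ \<Rightarrow> \<not> tyA | Single _ \<Rightarrow> \<not> tyD)}"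

lemma mem_roots:
  "Minus i j \<in> roots \<longleftrightarrow> 1 \<le> i \<and> i < j \<and> j \<le> n"
  "Plus i j \<in> roots \<longleftrightarrow> 1 \<le> i \<and> i < j \<and> j \<le> n \<and> \<not> tyA"
  "Single i \<in> roots \<longleftrightarrow> 1 \<le> i \<and> i \<le> n \<and> \<not> tyD"
  by (auto simp: roots_def)

text \<open>The reflection transposes the indices \<open>k\<close> and \<open>Suc k\<close>. The
  order of a pair is destroyed only for the pair of these two: a minus root is then
  \<open>a k\<close> itself, and a plus root is fixed.\<close>

lemma rv_stable_low:
  assumes k: "1 \<le> k" "k < n" and r: "r \<in> roots" "rv r \<noteq> a k"
  shows "root_reflection (a k) (rv r) \<in> rv ` roots"
proof -
  define \<sigma> where "\<sigma> i = (if i = k then Suc k else if i = Suc k then k else i)" for i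
  have s: "root_reflection (a k) (e i) = e (\<sigma> i)" "1 \<le> \<sigma> i" "\<sigma> i \<le> n" if "1 \<le> i" "i \<le> n" for i
    using reflection_low[OF k that] that k by (auto simp: \<sigma>_def)
  have lt: "\<sigma> i < \<sigma> j" if "i < j" "\<not> (i = k \<and> j = Suc k)" for i j
    using that by (auto simp: \<sigma>_def)
  show ?thesis
  proof (cases r)
    case (Minus i j)
    then have ij: "1 \<le> i" "i < j" "j \<le> n" using r(1) by (auto simp: mem_roots)
    have "\<not> (i = k \<and> j = Suc k)" using r(2) Minus a_low[OF k(2)] by auto
    then have "Minus (\<sigma> i) (\<sigma> j) \<in> roots" using lt s ij by (auto simp: mem_roots)
    moreover have "root_reflection (a k) (rv r) = rv (Minus (\<sigma> i) (\<sigma> j))"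
      using s(1) ij Minus by (simp add: root_reflection_diff)
    ultimately show ?thesis by (metis imageI)
  next
    case (Plus i j)
    then have ij: "1 \<le> i" "i < j" "j \<le> n" "\<not> tyA" using r(1) by (auto simp: mem_roots)
    have e: "root_reflection (a k) (rv r) = e (\<sigma> i) + e (\<sigma> j)"
      using s(1) ij Plus by (simp add: root_reflection_add)
    show ?thesis
    proof (cases "i = k \<and> j = Suc k")
      case True
      then have "root_reflection (a k) (rv r) = rv r" using e Plus by (simp add: \<sigma>_def add.commute)
      then show ?thesis using r(1) by simp
    next
      case False
      then have "Plus (\<sigma> i) (\<sigma> j) \<in> roots" using lt s ij by (auto simp: mem_roots)
      then show ?thesis unfolding e by (intro image_eqI[of _ _ "Plus (\<sigma> i) (\<sigma> j)"]) auto
    qed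
  next
    case (Single i)
    then have i: "1 \<le> i" "i \<le> n" "\<not> tyD" using r(1) by (auto simp: mem_roots)
    then have "Single (\<sigma> i) \<in> roots" using s by (auto simp: mem_roots)
    moreover have "root_reflection (a k) (rv r) = rv (Single (\<sigma> i))"
      using s(1)[OF i(1,2)] Single by (simp add: root_reflection_scaleR)
    ultimately show ?thesis by (metis imageI)
  qed
qed

text \<open>In types B and C the reflection changes the sign of the last coordinate. In type D it
  exchanges the last two with a change of sign. In type A it exchanges \<open>Single i\<close> with
  \<open>Minus i n\<close> for \<open>i < n\<close>.\<close>

lemma rv_stable_top:
  assumes r: "r \<in> roots" "rv r \<noteq> a n"
  shows "root_reflection (a n) (rv r) \<in> rv ` roots"
proof -
  have I: "root_reflection (a n) (rv r) \<in> rv ` roots"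
    if "q \<in> roots" "root_reflection (a n) (rv r) = rv q" for q using that by auto
  have BC: "root_reflection (a n) (rv r) \<in> rv ` roots" if X: "tyB \<or> tyC" "\<not> tyA" "\<not> tyD"
  proof -
    note s = reflection_top(2)[OF _ _ X(1)]
    show ?thesis
    proof (cases r)
      case (Minus i j)
      then have ij: "1 \<le> i" "i < j" "j \<le> n" using r(1) by (auto simp: mem_roots)
      then show ?thesis using s X Minus r(1)
        by (cases "j = n"; intro I[of "if j = n then Plus i n else r"]) (auto simp: mem_roots root_reflection_diff)
    next
      case (Plus i j)
      then have ij: "1 \<le> i" "i < j" "j \<le> n" using r(1) by (auto simp: mem_roots)
      then show ?thesis using s X Plus r(1)
        by (cases "j = n"; intro I[of "if j = n then Minus i n else r"]) (auto simp: mem_roots root_reflection_add)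
    next
      case (Single i)
      then have i: "1 \<le> i" "i \<le> n" using r(1) by (auto simp: mem_roots)
      have "i \<noteq> n" using r(2) Single a_top(2,3) X by (cases rule: type_cases) (auto simp: tyC_def[symmetric])
      then show ?thesis using i s X Single r(1) by (intro I[of r]) (auto simp: root_reflection_scaleR)
    qed
  qed
  show ?thesis
  proof (cases rule: type_cases)
    case X: A
    note s = reflection_top(1)[OF _ _ X(1)]
    show ?thesis
    proof (cases r)
      case (Minus i j)
      then have ij: "1 \<le> i" "i < j" "j \<le> n" using r(1) by (auto simp: mem_roots)
      show ?thesis
      proof (cases "j = n")
        case True
        then show ?thesis using ij s X Minus
          by (intro I[of "Single i"]) (auto simp: mem_roots root_reflection_diff)
      next
        case False
        then show ?thesis using ij s X Minus r(1)
          by (intro I[of r]) (auto simp: root_reflection_diff)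
      qed
    next
      case (Plus i j)
      then show ?thesis using r(1) X by (simp add: mem_roots)
    next
      case (Single i)
      then have i: "1 \<le> i" "i \<le> n" using r(1) by (auto simp: mem_roots)
      have "i \<noteq> n" using r(2) Single X a_top(1) by auto
      then show ?thesis using i s X Single
        by (intro I[of "Minus i n"]) (auto simp: mem_roots root_reflection_scaleR)
    qed
  next
    case X: D
    note s = reflection_top(3)[OF _ _ X(4)]
    have n: "4 \<le> n" using rank_type X by simp
    show ?thesis
    proof (cases r)
      case (Minus i j)
      then have ij: "1 \<le> i" "i < j" "j \<le> n" using r(1) by (auto simp: mem_roots)
      consider "j < n - 1" | "j = n - 1" | "j = n" "i < n - 1" | "j = n" "i = n - 1" using ij by linarith
      then show ?thesis
      proof cases
        case 1
        then show ?thesis using ij s X Minus r(1)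
          by (intro I[of r]) (auto simp: root_reflection_diff)
      next
        case 2
        then show ?thesis using ij s X Minus n
          by (intro I[of "Plus i n"]) (auto simp: mem_roots root_reflection_diff)
      next
        case 3
        then show ?thesis using ij s X Minus n
          by (intro I[of "Plus i (n - 1)"]) (auto simp: mem_roots root_reflection_diff)
      next
        case 4
        then show ?thesis using ij s X Minus r(1) n
          by (intro I[of r]) (auto simp: root_reflection_diff)
      qed
    next
      case (Plus i j)
      then have ij: "1 \<le> i" "i < j" "j \<le> n" using r(1) by (auto simp: mem_roots)
      consider "j < n - 1" | "j = n - 1" | "j = n" "i < n - 1" | "j = n" "i = n - 1" using ij by linarith
      then show ?thesis
      proof cases
        case 1
        then show ?thesis using ij s X Plus r(1)
          by (intro I[of r]) (auto simp: root_reflection_add)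
      next
        case 2
        then show ?thesis using ij s X Plus n
          by (intro I[of "Minus i n"]) (auto simp: mem_roots root_reflection_add)
      next
        case 3
        then show ?thesis using ij s X Plus n
          by (intro I[of "Minus i (n - 1)"]) (auto simp: mem_roots root_reflection_add)
      next
        case 4
        then show ?thesis using r(2) Plus a_top(4)[OF X(4)] by simp
      qed
    next
      case (Single i)
      then show ?thesis using r(1) X by (simp add: mem_roots)
    qed
  qed (use BC in auto)
qed

section \<open>Identification of the formal roots with the positive roots\<close>

lemma fin: "finite \<Delta>"
  using indep by (rule independent_imp_finite)

lemma a_mem: "1 \<le> k \<Longrightarrow> k \<le> n \<Longrightarrow> a k \<in> \<Delta>"
  using a by (auto simp: bij_betw_def)

lemma a_obtain:
  assumes "\<alpha> \<in> \<Delta>"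
  obtains k where "1 \<le> k" "k \<le> n" "\<alpha> = a k"
  using a assms by (auto simp: bij_betw_def)

lemma card_rank: "n = DIM('a)"
proof -
  have "card \<Delta> = n" using bij_betw_same_card[OF a] by simp
  moreover have "card \<Delta> = DIM('a)" using indep spans by (metis dim_UNIV dim_span dim_eq_card_independent)
  ultimately show ?thesis by simp
qed

lemma simple_in_roots: "\<Delta> \<subseteq> rv ` roots"
proof
  fix \<alpha> assume "\<alpha> \<in> \<Delta>"
  then obtain k where k: "1 \<le> k" "k \<le> n" "\<alpha> = a k" by (rule a_obtain)
  have "\<exists>r\<in>roots. a k = rv r"
  proof (cases "k = n")
    case False
    then show ?thesis using k a_low[of k] by (intro bexI[of _ "Minus k (Suc k)"]) (auto simp: mem_roots)
  next
    case True
    show ?thesis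
    proof (cases "tyD")
      case D: True
      then have "4 \<le> n" using rank_type by simp
      moreover have "\<not> tyA" using D by (cases rule: type_cases) auto
      ultimately show ?thesis using True a_top(4)[OF D] D by (intro bexI[of _ "Plus (n - 1) n"]) (auto simp: mem_roots)
    next
      case False
      then show ?thesis using True k a_top(1-3) by (intro bexI[of _ "Single n"]; cases rule: type_cases) (auto simp: mem_roots)
    qed
  qed
  then show "\<alpha> \<in> rv ` roots" using k(3) by auto
qed

definition cone :: "'a set" where
  "cone = {\<beta>. \<forall>\<alpha>\<in>\<Delta>. representation \<Delta> \<beta> \<alpha> \<in> \<nat>}"

lemma cone_add: "x \<in> cone \<Longrightarrow> y \<in> cone \<Longrightarrow> x + y \<in> cone"
  using indep spans by (auto simp: cone_def representation_add)

lemma a_cone: "1 \<le> k \<Longrightarrow> k \<le> n \<Longrightarrow> a k \<in> cone"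
  using a_mem indep by (auto simp: cone_def representation_basis)

lemma Minus_cone:
  assumes "1 \<le> i" "i < j" "j \<le> n"
  shows "e i - e j \<in> cone"
proof -
  have "Suc i \<le> j" using assms by simp
  then show ?thesis using assms(3)
  proof (induction rule: dec_induct)
    case base
    then show ?case using a_low[of i] a_cone[of i] assms by simp
  next
    case (step m)
    have "e i - e (Suc m) = (e i - e m) + a m" using a_low[of m] step by simp
    moreover have "(e i - e m) + a m \<in> cone" using step a_cone[of m] by (intro cone_add) auto
    ultimately show ?case by (simp only:)
  qed
qed

lemma rv_cone:
  assumes "r \<in> roots"
  shows "rv r \<in> cone"
proof -
  have M: "e i - e j \<in> cone" if "1 \<le> i" "i < j" "j \<le> n" for i j by (rule Minus_cone[OF that])
  have an: "a n \<in> cone" using a_cone n_pos by simp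
  have AB: "e i \<in> cone" if "tyA \<or> tyB" "1 \<le> i" "i \<le> n" for i
  proof (cases "i = n")
    case True
    then show ?thesis using an a_top(1,2) that(1) by auto
  next
    case False
    then have "(e i - e n) + a n \<in> cone" using M[of i n] an cone_add that by simp
    then show ?thesis using a_top(1,2) that(1) by auto
  qed
  have C2: "2 *\<^sub>R e i \<in> cone" if "tyC" "1 \<le> i" "i \<le> n" for i
  proof (cases "i = n")
    case True
    then show ?thesis using an a_top(3) that(1) by auto
  next
    case False
    then have "(e i - e n) + ((e i - e n) + a n) \<in> cone" using M[of i n] an cone_add that by simp
    moreover have "(e i - e n) + ((e i - e n) + a n) = 2 *\<^sub>R e i"
      using a_top(3)[OF that(1)] by (simp add: scaleR_2)
    ultimately show ?thesis by simp
  qed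
  have D2: "e i + e n \<in> cone" if "tyD" "1 \<le> i" "i < n" for i
  proof (cases "i = n - 1")
    case True
    then show ?thesis using an a_top(4)[OF that(1)] by simp
  next
    case False
    then have "(e i - e (n - 1)) + a n \<in> cone" using M[of i "n - 1"] an cone_add that by simp
    then show ?thesis using a_top(4)[OF that(1)] by simp
  qed
  show ?thesis
  proof (cases r)
    case (Minus i j)
    then show ?thesis using assms M by (simp add: mem_roots)
  next
    case (Single i)
    then show ?thesis using assms AB[of i] C2[of i] by (cases rule: type_cases) (auto simp: mem_roots)
  next
    case (Plus i j)
    then have ij: "1 \<le> i" "i < j" "j \<le> n" "\<not> tyA" using assms by (auto simp: mem_roots)
    show ?thesis
    proof (cases rule: type_cases)
      case B
      then show ?thesis using AB[of i] AB[of j] ij Plus cone_add by simp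
    next
      case C
      then have "(e i - e j) + 2 *\<^sub>R e j \<in> cone" using M[of i j] C2[of j] \<open>tyC\<close> ij cone_add by simp
      then show ?thesis using Plus by (simp add: scaleR_2)
    next
      case D
      show ?thesis
      proof (cases "j = n")
        case True
        then show ?thesis using D2[OF \<open>tyD\<close>] ij Plus by simp
      next
        case False
        then have "(e i + e n) + (e j - e n) \<in> cone"
          by (intro cone_add[OF D2[OF \<open>tyD\<close>] M]) (use ij False in auto)
        then show ?thesis using Plus by simp
      qed
    qed (use ij in simp)
  qed
qed

lemma span_e: "span (e ` {1..n}) = UNIV"
proof -
  have E: "e i \<in> span (e ` {1..n})" if "1 \<le> i" "i \<le> n" for i using that by (intro span_base) auto
  have "rv r \<in> span (e ` {1..n})" if "r \<in> roots" for r
    using that E by (cases r) (auto simp: mem_roots intro!: span_diff span_add span_scale)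
  then have "\<Delta> \<subseteq> span (e ` {1..n})" using simple_in_roots by auto
  then have "span \<Delta> \<subseteq> span (e ` {1..n})" by (rule span_minimal) simp
  then show ?thesis using spans by auto
qed

lemma dual_e: "\<exists>u. dual_on UNIV e {1..n} u"
  by (rule dual_basis_exists[OF _ _ span_e]) (use card_rank in auto)

lemma over_roots: "r \<in> roots \<Longrightarrow> froot_over {1..n} r"
  by (simp add: roots_def)

lemma hyp_rv: "hyp W (rv r) = hyp W (froot_vec e r)"
  by (cases r) (auto simp: hyp_def)

lemma rv_nonzero:
  assumes "r \<in> roots"
  shows "rv r \<noteq> 0"
proof
  assume z: "rv r = 0"
  obtain u where "dual_on UNIV e {1..n} u" using dual_e by blast
  then obtain x where "froot_vec e r \<bullet> x \<noteq> 0"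
    using vec_nonzero[OF subspace_UNIV _ over_roots[OF assms]] by blast
  then have "x \<notin> hyp UNIV (rv r)" by (simp add: hyp_rv mem_hyp)
  then show False using z by (simp add: mem_hyp)
qed

lemma inj_rv: "inj_on rv roots"
proof (rule inj_onI, rule ccontr)
  fix r q assume rq: "r \<in> roots" "q \<in> roots" "rv r = rv q" "r \<noteq> q"
  obtain u where "dual_on UNIV e {1..n} u" using dual_e by blast
  then have "\<exists>x\<in>UNIV. froot_vec e r \<bullet> x = 0 \<and> froot_vec e q \<bullet> x \<noteq> 0"
    by (rule vec_separate[OF subspace_UNIV _ _ over_roots[OF rq(1)] over_roots[OF rq(2)] rq(4)]) simp
  then have "hyp UNIV (froot_vec e r) \<noteq> hyp UNIV (froot_vec e q)" by (auto simp: hyp_def)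
  then show False using rq(3) hyp_rv by metis
qed

text \<open>Both sets contain the simple roots, consist of nonzero combinations with natural
  coefficients, and are stable under each simple reflection away from its own root. So
  \<open>reflection_stable_subset\<close> applies in both directions.\<close>

lemma positive_roots_eq:
  assumes "root_system \<Phi>" "simple_roots \<Phi> \<Delta>"
  shows "positive_roots \<Phi> \<Delta> = rv ` roots"
proof
  have st: "root_reflection \<alpha> \<beta> \<in> rv ` roots" if b: "\<beta> \<in> rv ` roots" "\<alpha> \<in> \<Delta>" "\<beta> \<noteq> \<alpha>" for \<alpha> \<beta>
  proof -
    obtain k where k: "1 \<le> k" "k \<le> n" "\<alpha> = a k" using b(2) by (rule a_obtain)
    obtain r where "r \<in> roots" "\<beta> = rv r" using b(1) by blast
    then show ?thesis
      using rv_stable_low[of k r] rv_stable_top[of r] k b(3) by (cases "k = n") auto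
  qed
  note pos = positive_roots_stable[OF assms]
  show "positive_roots \<Phi> \<Delta> \<subseteq> rv ` roots"
    by (rule reflection_stable_subset[OF indep spans pos simple_in_roots st])
  have "\<Delta> \<subseteq> positive_roots \<Phi> \<Delta>"
    using assms(2) indep by (auto simp: positive_roots_def simple_roots_def representation_basis)
  then show "rv ` roots \<subseteq> positive_roots \<Phi> \<Delta>"
    by (intro reflection_stable_subset[OF indep spans _ _ st _ pos(3)])
      (use rv_nonzero rv_cone in \<open>auto simp: cone_def\<close>)
qed

section \<open>Heights in coordinates\<close>

lemma height_add: "height \<Delta> (x + y) = height \<Delta> x + height \<Delta> y"
  and height_diff: "height \<Delta> (x - y) = height \<Delta> x - height \<Delta> y"
  and height_scaleR: "height \<Delta> (c *\<^sub>R x) = c * height \<Delta> x"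
  using indep spans
  by (simp_all add: height_def representation_add representation_diff representation_scale
      sum.distrib sum_subtractf sum_distrib_left)

lemma height_a: "1 \<le> k \<Longrightarrow> k \<le> n \<Longrightarrow> height \<Delta> (a k) = 1"
  using a_mem[of k] indep fin by (simp add: height_def representation_basis)

text \<open>The constants come from \<open>e n\<close>: half a simple root in type C, half a
  difference of two simple roots in type D, and a simple root otherwise.\<close>

lemma height_e:
  assumes "1 \<le> i" "i \<le> n"
  shows "height \<Delta> (e i) = real (n - i) + (if tyC then 1/2 else if tyD then 0 else 1)"
  using assms(2)
proof (induction rule: inc_induct)
  case base
  show ?case using rank_type
    by (cases rule: type_cases) (simp_all add: e_n e_last_def height_scaleR height_diff height_a)
next
  case (step m)
  then show ?case using e_step[of m] assms height_a[of m] by (simp add: height_add)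
qed

text \<open>The constant for \<open>Plus\<close> is twice that of \<open>height_e\<close>, as two
  coordinate vectors are added; for \<open>Minus\<close> it cancels.\<close>

fun ht :: "froot \<Rightarrow> nat" where
  "ht (Minus i j) = j - i"
| "ht (Plus i j) = (n - i) + (n - j) + (if tyC then 1 else if tyD then 0 else 2)"
| "ht (Single i) = (if tyC then 2 * (n - i) + 1 else n - i + 1)"

lemma height_rv:
  assumes "r \<in> roots"
  shows "height \<Delta> (rv r) = real (ht r)"
proof (cases r)
  case (Minus i j)
  then show ?thesis using assms height_e[of i] height_e[of j]
    by (simp add: mem_roots height_diff of_nat_diff)
next
  case (Plus i j)
  then show ?thesis using assms height_e[of i] height_e[of j]
    by (cases rule: type_cases) (simp_all add: mem_roots height_add)
next
  case (Single i)
  then show ?thesis using assms height_e[of i]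
    by (cases rule: type_cases) (simp_all add: mem_roots height_scaleR)
qed

end

section \<open>Ideals of the positive roots\<close>

context classical_basis
begin

text \<open>This is the ideal property seen from the complement: a summand of a root outside the
  ideal cannot lie in the ideal. As \<open>r\<close> and \<open>q\<close> may be exchanged, both
  summands belong to \<open>L\<close>.\<close>

definition sum_closed :: "froot set \<Rightarrow> bool" where
  "sum_closed L \<longleftrightarrow> L \<subseteq> roots \<and>
     (\<forall>p\<in>L. \<forall>r\<in>roots. \<forall>q\<in>roots. rv p = rv r + rv q \<longrightarrow> r \<in> L)"

lemma sum_closedD:
  assumes "sum_closed L"
  shows "p \<in> L \<Longrightarrow> p \<in> roots"
    "p \<in> L \<Longrightarrow> rv p = rv r + rv q \<Longrightarrow> r \<in> roots \<Longrightarrow> q \<in> roots \<Longrightarrow> r \<in> L"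
  using assms unfolding sum_closed_def by blast+

lemma Minus_split:
  assumes "sum_closed L" "Minus i j \<in> L" "i < k" "k < j"
  shows "Minus i k \<in> L" "Minus k j \<in> L"
proof -
  note c = sum_closedD[OF assms(1)]
  have "Minus i j \<in> roots" using c(1) assms(2) .
  then have r: "Minus i k \<in> roots" "Minus k j \<in> roots" using assms by (auto simp: mem_roots)
  show "Minus i k \<in> L" by (rule c(2)[OF assms(2) _ r]) simp
  show "Minus k j \<in> L" by (rule c(2)[OF assms(2) _ r(2,1)]) simp
qed

lemma Plus_split:
  assumes "sum_closed L" "Plus i j \<in> L" "i < k" "k \<le> n" "k \<noteq> j"
  shows "Minus i k \<in> L" "plus_of k j \<in> L"
proof -
  note c = sum_closedD[OF assms(1)]
  have "Plus i j \<in> roots" using c(1) assms(2) .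
  then have r: "Minus i k \<in> roots" "plus_of k j \<in> roots" using assms by (auto simp: mem_roots plus_of_def)
  have rv: "rv (plus_of k j) = e k + e j" by (simp add: plus_of_def min_def max_def add.commute)
  show "Minus i k \<in> L" by (rule c(2)[OF assms(2) _ r]) (simp add: rv)
  show "plus_of k j \<in> L" by (rule c(2)[OF assms(2) _ r(2,1)]) (simp add: rv)
qed

lemma Plus_raise:
  assumes "sum_closed L" "Plus i j \<in> L" "j < k" "k \<le> n"
  shows "Minus j k \<in> L" "Plus i k \<in> L"
proof -
  note c = sum_closedD[OF assms(1)]
  have "Plus i j \<in> roots" using c(1) assms(2) .
  then have r: "Minus j k \<in> roots" "Plus i k \<in> roots" using assms by (auto simp: mem_roots)
  show "Minus j k \<in> L" by (rule c(2)[OF assms(2) _ r]) simp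
  show "Plus i k \<in> L" by (rule c(2)[OF assms(2) _ r(2,1)]) simp
qed

text \<open>The decomposition of a plus root depends on the type: into the two short roots in type
  B, and into \<open>e i - e j\<close> and the long root \<open>2 *\<^sub>R e j\<close> in type
  C.\<close>

lemma Plus_Single:
  assumes "sum_closed L" "Plus i j \<in> L" "\<not> tyD"
  shows "Single j \<in> L" "tyB \<Longrightarrow> Single i \<in> L" "tyC \<Longrightarrow> Minus i j \<in> L"
proof -
  note c = sum_closedD[OF assms(1)]
  have "Plus i j \<in> roots" using c(1) assms(2) .
  then have r: "Minus i j \<in> roots" "Single i \<in> roots" "Single j \<in> roots" "\<not> tyA"
    using assms by (auto simp: mem_roots)
  have B: "Single i \<in> L \<and> Single j \<in> L" if "\<not> tyC"
    using c(2)[OF assms(2) _ r(2,3)] c(2)[OF assms(2) _ r(3,2)] that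
    by (simp add: tyC_def[symmetric] add.commute)
  have C: "Minus i j \<in> L \<and> Single j \<in> L" if "tyC"
    using c(2)[OF assms(2) _ r(1,3)] c(2)[OF assms(2) _ r(3,1)] that
    by (simp add: tyC_def[symmetric] scaleR_2)
  show "Single j \<in> L" using B C by blast
  show "tyB \<Longrightarrow> Single i \<in> L" using B by (cases rule: type_cases) auto
  show "tyC \<Longrightarrow> Minus i j \<in> L" using C by blast
qed

text \<open>In types A and B \<open>e i\<close> is the sum of \<open>e i - e j\<close> and
  \<open>e j\<close>. In type C \<open>2 *\<^sub>R e i\<close> is the sum of
  \<open>e i - e j\<close> and \<open>e i + e j\<close>, and \<open>Single j\<close> is then reached
  through the plus root.\<close>

lemma Single_split:
  assumes "sum_closed L" "Single i \<in> L" "i < j" "j \<le> n"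
  shows "Single j \<in> L" "\<not> tyC \<Longrightarrow> Minus i j \<in> L" "tyC \<Longrightarrow> Plus i j \<in> L"
proof -
  note c = sum_closedD[OF assms(1)]
  have "Single i \<in> roots" using c(1) assms(2) .
  then have r: "Minus i j \<in> roots" "Single j \<in> roots" "\<not> tyD" "1 \<le> i" using assms by (auto simp: mem_roots)
  have B: "Minus i j \<in> L \<and> Single j \<in> L" if "\<not> tyC"
    using c(2)[OF assms(2) _ r(1,2)] c(2)[OF assms(2) _ r(2,1)] that by simp
  have C: "Plus i j \<in> L" if "tyC"
  proof -
    have "\<not> tyA" using that by (cases rule: type_cases) auto
    then have "Plus i j \<in> roots" using r(1,4) assms by (auto simp: mem_roots)
    then show ?thesis using c(2)[OF assms(2) _ _ r(1), of "Plus i j"] that by (simp add: scaleR_2)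
  qed
  show "\<not> tyC \<Longrightarrow> Minus i j \<in> L" "tyC \<Longrightarrow> Plus i j \<in> L" using B C by blast+
  show "Single j \<in> L" using B Plus_Single(1)[OF assms(1) C r(3)] by blast
qed

lemma roots_lt: "Minus i j \<in> roots \<Longrightarrow> i < j" "Plus i j \<in> roots \<Longrightarrow> i < j"
  "Minus i j \<in> roots \<Longrightarrow> j \<le> n" "Plus i j \<in> roots \<Longrightarrow> j \<le> n"
  by (auto simp: mem_roots)

lemma row_closed_sum_closed:
  assumes L: "sum_closed L" and nD: "\<not> tyD"
  shows "row_closed L"
  unfolding row_closed_def
proof (intro conjI allI impI)
  note c = sum_closedD(1)[OF L]
  fix i j k
  show "Minus j k \<in> L" if "Minus i j \<in> L" "Minus i k \<in> L" "j < k"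
    using Minus_split(2)[OF L that(2) _ that(3)] roots_lt(1)[OF c[OF that(1)]] by simp
  show "Minus j k \<in> L" if "Plus i j \<in> L" "Plus i k \<in> L" "j < k"
    using Plus_raise(1)[OF L that(1,3)] roots_lt(4)[OF c[OF that(2)]] by simp
  show "Plus j k \<in> L" if "Minus i j \<in> L" "Plus i k \<in> L" "j < k"
    using Plus_split(2)[OF L that(2), of j] roots_lt(1,3)[OF c[OF that(1)]] that(3) by (simp add: plus_of_def)
  show "Plus k j \<in> L" if "Minus i j \<in> L" "Plus i k \<in> L" "k < j"
    using Plus_split(2)[OF L that(2), of j] roots_lt(1,3)[OF c[OF that(1)]] that(3) by (simp add: plus_of_def)
  show "Single j \<in> L" if "Minus i j \<in> L" "Plus i j \<in> L"
    using Plus_Single(1)[OF L that(2) nD] .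
  show "Single j \<in> L" if "Minus i j \<in> L" "Single i \<in> L"
    using Single_split(1)[OF L that(2)] roots_lt(1,3)[OF c[OF that(1)]] by simp
  show "Single j \<in> L" if "Plus i j \<in> L" "Single i \<in> L"
    using Plus_Single(1)[OF L that(1) nD] .
qed

lemma D_closed_sum_closed:
  assumes L: "sum_closed L" and D: "tyD"
  shows "D_closed n L"
  unfolding D_closed_def
proof (intro conjI allI impI ballI)
  note c = sum_closedD(1)[OF L]
  show "froot_over {1..n} r" if "r \<in> L" for r using over_roots[OF c[OF that]] .
  show "r \<noteq> Single (froot_row r)" if "r \<in> L" for r
    using c[OF that] D by (cases r) (auto simp: mem_roots)
  fix i j k
  show "Minus i k \<in> L" "Minus k j \<in> L" if "Minus i j \<in> L" "i < k" "k < j"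
    using Minus_split[OF L that] by auto
  show "Minus i k \<in> L" "plus_of k j \<in> L" if "Plus i j \<in> L" "i < k" "k \<le> n" "k \<noteq> j"
    using Plus_split[OF L that] by auto
  show "Minus j k \<in> L" "Plus i k \<in> L" if "Plus i j \<in> L" "j < k" "k \<le> n"
    using Plus_raise[OF L that] by auto
qed

section \<open>Distribution of heights over the rows\<close>

lemma finite_roots: "finite roots"
  by (rule finite_subset[OF _ finite_over[of "{1..n}"]]) (auto simp: roots_def)

lemma row_roots: "r \<in> roots \<Longrightarrow> froot_row r \<in> {1..n}"
  by (cases r) (auto simp: mem_roots)

lemma ht_pos: "r \<in> roots \<Longrightarrow> 1 \<le> ht r"
  by (cases r) (auto simp: mem_roots)

text \<open>In row \<open>i\<close> the minus roots take the heights from 1 to \<open>n - i\<close>.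
  In types A and B \<open>Single i\<close> comes next, in type B followed by the plus roots; in type
  C the plus roots come next and \<open>Single i\<close> is last.\<close>

lemma ht_inj:
  assumes "\<not> tyD" and "r \<in> roots" "q \<in> roots" "froot_row r = froot_row q" "ht r = ht q"
  shows "r = q"
proof -
  have MP: False if "Minus i j \<in> roots" "Plus i k \<in> roots" "ht (Minus i j) = ht (Plus i k)" for i j k
    using that assms(1) by (simp add: mem_roots split: if_splits; linarith)
  have MS: False if "Minus i j \<in> roots" "Single i \<in> roots" "ht (Minus i j) = ht (Single i)" for i j
    using that by (simp add: mem_roots split: if_splits; linarith)
  have PS: False if "Plus i j \<in> roots" "Single i \<in> roots" "ht (Plus i j) = ht (Single i)" for i j
    using that assms(1) by (simp add: mem_roots split: if_splits; linarith)
  obtain i where i: "froot_row r = i" "froot_row q = i" using assms(4) by simp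
  show ?thesis
  proof (cases r)
    case r: (Minus i' j)
    show ?thesis
    proof (cases q)
      case (Minus i'' k)
      then show ?thesis using assms(2-) r i by (auto simp: mem_roots)
    next
      case (Plus i'' k)
      then show ?thesis using MP[of i j k] assms(2-) r i by (auto simp del: ht.simps)
    next
      case (Single i'')
      then show ?thesis using MS[of i j] assms(2-) r i by (auto simp del: ht.simps)
    qed
  next
    case r: (Plus i' j)
    show ?thesis
    proof (cases q)
      case (Minus i'' k)
      then show ?thesis using MP[of i k j] assms(2-) r i by (auto simp del: ht.simps)
    next
      case (Plus i'' k)
      then show ?thesis using assms(2-) r i by (auto simp: mem_roots split: if_splits)
    next
      case (Single i'')
      then show ?thesis using PS[of i j] assms(2-) r i by (auto simp del: ht.simps)
    qed
  next
    case r: (Single i')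
    show ?thesis
    proof (cases q)
      case (Minus i'' k)
      then show ?thesis using MS[of i k] assms(2-) r i by (auto simp del: ht.simps)
    next
      case (Plus i'' k)
      then show ?thesis using PS[of i k] assms(2-) r i by (auto simp del: ht.simps)
    next
      case (Single i'')
      then show ?thesis using r i by simp
    qed
  qed
qed

lemma sum_indicator_card: "finite A \<Longrightarrow> (\<Sum>i\<in>A. if P i then 1 else 0 :: nat) = card {i \<in> A. P i}"
  by (simp add: sum.If_cases Int_def)

text \<open>Each row meets every height from 1 up to its length exactly once. The root one height
  below is found in the same row by a decomposition with a simple summand, which keeps it in
  \<open>L\<close>.\<close>

lemma height_counts_row_closed:
  assumes L: "sum_closed L" and nD: "\<not> tyD" and h: "1 \<le> h"
  shows "card {r \<in> L. ht r = h} = card {i \<in> {1..n}. h \<le> card {r \<in> L. froot_row r = i}}"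
proof -
  note c = sum_closedD(1)[OF L]
  have finL: "finite L" using c finite_roots by (meson finite_subset subsetI)
  have "card {r \<in> {r \<in> L. froot_row r = i}. ht r = h} = (if h \<le> card {r \<in> L. froot_row r = i} then 1 else 0)" for i
  proof (rule card_fibre_prefix[OF _ _ _ _ h])
    show "finite {r \<in> L. froot_row r = i}" using finL by simp
    show "1 \<le> ht r" if "r \<in> {r \<in> L. froot_row r = i}" for r using ht_pos c that by blast
    show "inj_on ht {r \<in> L. froot_row r = i}"
    proof (rule inj_onI)
      fix r q assume "r \<in> {r \<in> L. froot_row r = i}" "q \<in> {r \<in> L. froot_row r = i}" "ht r = ht q"
      then have "r \<in> roots" "q \<in> roots" "froot_row r = froot_row q" "ht r = ht q" using c by auto
      then show "r = q"
        using ht_inj[OF nD] by blast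
    qed
    fix r assume "r \<in> {r \<in> L. froot_row r = i}" and h1: "1 < ht r"
    then have r: "r \<in> L" "froot_row r = i" "r \<in> roots" using c by auto
    have I: "\<exists>q\<in>{r \<in> L. froot_row r = i}. Suc (ht q) = ht r" if "q \<in> L" "froot_row q = i" "Suc (ht q) = ht r" for q
      using that by blast
    show "\<exists>q\<in>{r \<in> L. froot_row r = i}. Suc (ht q) = ht r"
    proof (cases r)
      case (Minus i' j)
      then have "Minus i (j - 1) \<in> L" using Minus_split(1)[OF L, of i j "j - 1"] r h1 by auto
      then show ?thesis using Minus r h1 by (intro I) auto
    next
      case (Plus i' j)
      then have [simp]: "i' = i" and ij: "1 \<le> i" "i < j" "j \<le> n" "\<not> tyA" using r by (auto simp: mem_roots)
      show ?thesis
      proof (cases "j = n")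
        case False
        then have "Plus i (Suc j) \<in> L" using Plus_raise(2)[OF L, of i j "Suc j"] r Plus ij by auto
        then show ?thesis using Plus ij False by (intro I) auto
      next
        case True
        show ?thesis
        proof (cases rule: type_cases)
          case B
          then have "Single i \<in> L" using Plus_Single(2)[OF L _ nD, of i j] r Plus by simp
          then show ?thesis using Plus ij True B by (intro I) (auto simp: tyC_def[symmetric])
        next
          case C
          then have "Minus i n \<in> L" using Plus_Single(3)[OF L _ nD, of i j] r Plus True by simp
          then show ?thesis using Plus ij True C by (intro I) auto
        qed (use ij nD in auto)
      qed
    next
      case (Single i')
      then have [simp]: "i' = i" and i: "1 \<le> i" "i \<le> n" using r by (auto simp: mem_roots)
      have lt: "i < n" using h1 Single i by (auto split: if_splits)
      show ?thesis
      proof (cases tyC)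
        case True
        then have "Plus i (Suc i) \<in> L" using Single_split(3)[OF L, of i "Suc i"] lt r Single by simp
        then show ?thesis using Single lt True by (intro I) auto
      next
        case False
        then have "Minus i n \<in> L" using Single_split(2)[OF L, of i n] lt r Single by simp
        then show ?thesis using Single lt False by (intro I) auto
      qed
    qed
  qed
  then show ?thesis
    using card_by_rows[OF finL, of "{1..n}" "\<lambda>r. ht r = h"] row_roots c sum_indicator_card[of "{1..n}"] by simp
qed

text \<open>The exponent counting forks is stored at the index \<open>n\<close>, whose row is empty
  in type D.\<close>

definition D_exponent :: "froot set \<Rightarrow> nat \<Rightarrow> nat" where
  "D_exponent L = (D_row n L)(n := card (D_fork n L))"

text \<open>In a fork row \<open>Minus i n\<close> and \<open>Plus i n\<close> share the height
  \<open>n - i\<close>. With \<open>Plus i n\<close> set aside, the row has consecutive heights from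
  1. The roots set aside behave like one further row, since their heights \<open>n - i\<close> are
  again consecutive from 1.\<close>

lemma height_counts_D:
  assumes L: "sum_closed L" and D: "tyD" and h: "1 \<le> h"
  shows "card {r \<in> L. ht r = h} = card {i \<in> {1..n}. h \<le> D_exponent L i}"
proof -
  note c = sum_closedD(1)[OF L]
  let ?F = "D_fork n L"
  have nC: "\<not> tyC" "4 \<le> n" using D rank_type by (cases rule: type_cases; auto)+
  have finL: "finite L" using c finite_roots by (meson finite_subset subsetI)
  have Fn: "i < n" "1 \<le> i" if "i \<in> ?F" for i
    using that c[of "Minus i n"] by (auto simp: D_fork_def mem_roots)
  have fork: "i \<in> ?F" if "Plus i j \<in> L" "j < n" for i j
  proof -
    have "i < j" using roots_lt(2)[OF c[OF that(1)]] .
    then show ?thesis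
      using Plus_raise(2)[OF L that(1), of n] Plus_split(1)[OF L that(1), of n] that by (simp add: D_fork_def)
  qed
  have rowi: "card {r \<in> {r \<in> L. froot_row r = i}. ht r = h} =
      (if h \<le> D_row n L i then 1 else 0) + (if i \<in> ?F \<and> n - i = h then 1 else 0)" for i
  proof -
    define N where "N = {r \<in> L. froot_row r = i} - (if i \<in> ?F then {Plus i n} else {})"
    have finN: "finite N" using finL by (simp add: N_def)
    have NL: "r \<in> L" "froot_row r = i" "r \<in> roots" if "r \<in> N" for r using that c by (auto simp: N_def)
    have "card {r \<in> N. ht r = h} = (if h \<le> card N then 1 else 0)"
    proof (rule card_fibre_prefix[OF finN _ _ _ h])
      show "1 \<le> ht r" if "r \<in> N" for r using ht_pos NL that by blast
      have nf: "\<not> (Minus i n \<in> N \<and> Plus i n \<in> N)"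
        by (auto simp: N_def D_fork_def)
      have MP: False if mp: "Minus i j \<in> N" "Plus i k \<in> N" "j - i = (n - i) + (n - k)" for j k
      proof -
        have "i < j" "j \<le> n" "i < k" "k \<le> n" using NL(3)[OF mp(1)] NL(3)[OF mp(2)] by (auto simp: mem_roots)
        then have "j = n" "k = n" using mp(3) by linarith+
        then show False using nf mp by blast
      qed
      show "inj_on ht N"
      proof (rule inj_onI)
        fix r q assume rq: "r \<in> N" "q \<in> N" "ht r = ht q"
        then have *: "r \<in> roots" "q \<in> roots" "froot_row r = i" "froot_row q = i" using NL by auto
        show "r = q"
        proof (cases r)
          case r: (Minus i' j)
          show ?thesis
          proof (cases q)
            case q: (Plus i'' k)
            then show ?thesis using MP[of j k] rq * r nC D by simp
          qed (use rq * r D in \<open>auto simp: mem_roots\<close>)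
        next
          case r: (Plus i' j)
          show ?thesis
          proof (cases q)
            case q: (Minus i'' k)
            then show ?thesis using MP[of k j] rq * r nC D by simp
          qed (use rq * r D in \<open>auto simp: mem_roots\<close>)
        qed (use * D in \<open>auto simp: mem_roots\<close>)
      qed
      fix r assume r: "r \<in> N" and h1: "1 < ht r"
      note rL = NL[OF r]
      show "\<exists>q\<in>N. Suc (ht q) = ht r"
      proof (cases r)
        case (Minus i' j)
        then have "Minus i (j - 1) \<in> L" using Minus_split(1)[OF L, of i j "j - 1"] rL h1 by auto
        then show ?thesis using Minus rL h1 by (intro bexI[of _ "Minus i (j - 1)"]) (auto simp: N_def)
      next
        case (Plus i' j)
        then have [simp]: "i' = i" and ij: "1 \<le> i" "i < j" "j \<le> n" using rL by (auto simp: mem_roots)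
        show ?thesis
        proof (cases "j = n")
          case True
          have "i < n - 1" using h1 Plus True ij D nC by auto
          moreover from this have "Minus i (n - 1) \<in> L"
            using Plus_split(1)[OF L, of i n "n - 1"] rL Plus True by simp
          ultimately show ?thesis using Plus True D nC by (intro bexI[of _ "Minus i (n - 1)"]) (auto simp: N_def)
        next
          case False
          then have jn: "j < n" using ij by simp
          have F: "i \<in> ?F" using fork[of i j] rL Plus jn by simp
          show ?thesis
          proof (cases "Suc j = n")
            case True
            have "Minus i n \<in> L" using F by (simp add: D_fork_def)
            then show ?thesis using Plus True ij D nC by (intro bexI[of _ "Minus i n"]) (auto simp: N_def)
          next
            case sj: False
            have "Plus i (Suc j) \<in> L" using Plus_raise(2)[OF L, of i j "Suc j"] rL Plus jn by simp
            then show ?thesis using Plus sj jn D nC by (intro bexI[of _ "Plus i (Suc j)"]) (auto simp: N_def)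
          qed
        qed
      next
        case (Single i')
        then show ?thesis using rL D by (simp add: mem_roots)
      qed
    qed
    moreover have "card N = D_row n L i"
    proof (cases "i \<in> ?F")
      case True
      then have "Plus i n \<in> {r \<in> L. froot_row r = i}" by (simp add: D_fork_def)
      then show ?thesis using True finL by (simp add: N_def D_row_def card_Diff_singleton)
    qed (simp add: N_def D_row_def)
    moreover have "card {r \<in> {r \<in> L. froot_row r = i}. ht r = h} =
        card {r \<in> N. ht r = h} + (if i \<in> ?F \<and> n - i = h then 1 else 0)"
    proof (cases "i \<in> ?F \<and> n - i = h")
      case True
      then have "Plus i n \<in> L" "ht (Plus i n) = h" using D nC by (auto simp: D_fork_def)
      then have "{r \<in> {r \<in> L. froot_row r = i}. ht r = h} = insert (Plus i n) {r \<in> N. ht r = h}"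
        using True by (auto simp: N_def)
      moreover have "Plus i n \<notin> {r \<in> N. ht r = h}" using True by (auto simp: N_def)
      ultimately show ?thesis using True finN by simp
    next
      case False
      have "i \<in> ?F \<Longrightarrow> ht (Plus i n) \<noteq> h" using False D nC by simp
      then have "i \<in> ?F \<Longrightarrow> r \<noteq> Plus i n" if "ht r = h" for r using that by blast
      then have "{r \<in> {r \<in> L. froot_row r = i}. ht r = h} = {r \<in> N. ht r = h}"
        by (auto simp: N_def)
      then show ?thesis using False by simp
    qed
    ultimately show ?thesis by simp
  qed
  have finF: "finite ?F" by (rule finite_subset[of _ "{..<n}"]) (use Fn in auto)
  \<comment> \<open>The forks form an interval ending at \<open>n - 1\<close>: if \<open>i\<close>
    is a fork and \<open>Suc i < n\<close>, splitting both roots at \<open>Suc i\<close> makes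
    \<open>Suc i\<close> a fork.\<close>
  have "card {i \<in> ?F. n - i = h} = (if h \<le> card ?F then 1 else 0)"
  proof (rule card_fibre_prefix[OF finF _ _ _ h])
    show "inj_on (\<lambda>i. n - i) ?F" using Fn by (auto simp: inj_on_def) (metis diff_diff_cancel less_imp_le)
    show "1 \<le> n - i" if "i \<in> ?F" for i using Fn that by fastforce
    fix i assume i: "i \<in> ?F" "1 < n - i"
    have "Minus (Suc i) n \<in> L" using Minus_split(2)[OF L, of i n "Suc i"] i by (simp add: D_fork_def)
    moreover have "plus_of (Suc i) n \<in> L"
      using Plus_split(2)[OF L, of i n "Suc i"] i by (simp add: D_fork_def)
    ultimately have "Suc i \<in> ?F" using i by (simp add: D_fork_def plus_of_def)
    then show "\<exists>q\<in>?F. Suc (n - q) = n - i" using i by (intro bexI[of _ "Suc i"]) auto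
  qed
  moreover have "{i \<in> {1..n}. i \<in> ?F \<and> n - i = h} = {i \<in> ?F. n - i = h}" using Fn by fastforce
  ultimately have F: "(\<Sum>i\<in>{1..n}. if i \<in> ?F \<and> n - i = h then 1 else 0 :: nat) = (if h \<le> card ?F then 1 else 0)"
    by (simp add: sum_indicator_card)
  have rown: "D_row n L n = 0"
  proof -
    have "{r \<in> L. froot_row r = n} = {}"
    proof (rule equals0I)
      fix r assume "r \<in> {r \<in> L. froot_row r = n}"
      then have "r \<in> roots" "froot_row r = n" using c by auto
      then show False using D by (cases r) (auto simp: mem_roots)
    qed
    then show ?thesis unfolding D_row_def by (simp only: card.empty diff_0_eq_0)
  qed
  have split: "{1..n} = insert n {1..<n}" using n_pos by auto
  have "card {r \<in> L. ht r = h} = (\<Sum>i\<in>{1..n}. if h \<le> D_row n L i then 1 else 0) + (if h \<le> card ?F then 1 else 0)"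
    using card_by_rows[OF finL, of "{1..n}" "\<lambda>r. ht r = h"] row_roots c rowi F by (simp add: sum.distrib)
  also have "\<dots> = (\<Sum>i\<in>{1..<n}. if h \<le> D_row n L i then 1 else 0) + (if h \<le> card ?F then 1 else 0)"
    unfolding split using rown h by simp
  also have "\<dots> = (\<Sum>i\<in>{1..n}. if h \<le> D_exponent L i then 1 else 0)"
    unfolding split D_exponent_def by simp
  also have "\<dots> = card {i \<in> {1..n}. h \<le> D_exponent L i}"
    by (rule sum_indicator_card) simp
  finally show ?thesis .
qed

lemma ifree_sum_closed:
  assumes L: "sum_closed L"
  shows "\<exists>\<rho>. ifree UNIV (froot_vec e ` L) (image_mset \<rho> (mset_set {1..n})) \<and>
    (\<forall>h\<ge>1. card {r \<in> L. ht r = h} = card {i \<in> {1..n}. h \<le> \<rho> i})"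
proof -
  note c = sum_closedD(1)[OF L]
  obtain u where u: "dual_on UNIV e {1..n} u" using dual_e by blast
  show ?thesis
  proof (cases tyD)
    case False
    have "ifree UNIV (froot_vec e ` L) (image_mset (\<lambda>i. card {r \<in> L. froot_row r = i}) (mset_set {1..n}) + replicate_mset 0 0)"
      by (rule ifree_row_closed[OF _ subspace_UNIV u _ row_closed_sum_closed[OF L False]])
        (use c over_roots card_rank in auto)
    then show ?thesis using height_counts_row_closed[OF L False] by auto
  next
    case True
    have i0: "{0<..n} = {1..n}" "{r \<in> L. 0 < froot_row r} = L" "{k \<in> D_fork n L. 0 < k} = D_fork n L"
      using row_roots[OF c] c[of "Minus _ n"] by (force simp: D_fork_def mem_roots)+
    have "ifree UNIV (froot_vec e ` {r \<in> L. 0 < froot_row r})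
        (image_mset (D_row n L) (mset_set {0<..<n}) + {#card {k \<in> D_fork n L. 0 < k}#} + replicate_mset 0 0)"
    proof (rule ifree_D[OF D_closed_sum_closed[OF L True] _ subspace_UNIV])
      show "dual_on UNIV e {0<..n} u" unfolding i0 by (rule u)
    qed (use n_pos card_rank in auto)
    moreover have "image_mset (D_row n L) (mset_set {0<..<n}) + {#card (D_fork n L)#} =
        image_mset (D_exponent L) (mset_set {1..n})"
    proof -
      have "{1..n} = insert n {0<..<n}" using n_pos by auto
      then have "image_mset (D_exponent L) (mset_set {1..n}) =
          add_mset (card (D_fork n L)) (image_mset (D_exponent L) (mset_set {0<..<n}))"
        by (simp add: D_exponent_def)
      moreover have "image_mset (D_exponent L) (mset_set {0<..<n}) = image_mset (D_row n L) (mset_set {0<..<n})"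
        by (intro image_mset_cong) (auto simp: D_exponent_def)
      ultimately show ?thesis by simp
    qed
    ultimately have "ifree UNIV (froot_vec e ` L) (image_mset (D_exponent L) (mset_set {1..n}))"
      unfolding i0 by simp
    then show ?thesis using height_counts_D[OF L True] by blast
  qed
qed

end

theorem theorem1p8:
  fixes \<Phi> \<Delta> I :: "'a::euclidean_space set" and X :: classical_type and s :: nat
  assumes "irreducible_root_system \<Phi>"
    and "simple_roots \<Phi> \<Delta>"
    and "of_type \<Delta> X DIM('a)"
    and "root_ideal \<Phi> \<Delta> I"
    and "s = height_count \<Phi> \<Delta> I 1"
  shows "inductively_free UNIV (ideal_arrangement \<Phi> \<Delta> I) \<and>
         free_with_exponents UNIV (ideal_arrangement \<Phi> \<Delta> I)
           (replicate_mset (DIM('a) - s) 0 +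
            mset (map (ideal_exponent \<Phi> \<Delta> I) [1..<s + 1]))"
proof -
  have \<Phi>: "root_system \<Phi>" using assms(1) by (simp add: irreducible_root_system_def)
  obtain a where "bij_betw a {1..DIM('a)} \<Delta>" "min_rank X \<le> DIM('a)"
    "\<forall>i\<in>{1..DIM('a)}. \<forall>j\<in>{1..DIM('a)}. cartan_int (a i) (a j) = cartan_matrix X (DIM('a)) i j"
    using assms(3) by (auto simp: of_type_def)
  then interpret classical_basis \<Delta> X "DIM('a)" a
    using assms(2) by unfold_locales (auto simp: simple_roots_def)
  define L where "L = {r \<in> roots. rv r \<in> ideal_compl \<Phi> \<Delta> I}"
  have pos: "positive_roots \<Phi> \<Delta> = rv ` roots" by (rule positive_roots_eq[OF \<Phi> assms(2)])
  have compl: "ideal_compl \<Phi> \<Delta> I = rv ` L"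
    using pos by (auto simp: L_def ideal_compl_def)
  have L: "sum_closed L"
    unfolding sum_closed_def
  proof (intro conjI ballI impI)
    show "L \<subseteq> roots" by (auto simp: L_def)
    fix p r q assume p: "p \<in> L" and rq: "r \<in> roots" "q \<in> roots" and eq: "rv p = rv r + rv q"
    have "rv p \<in> positive_roots \<Phi> \<Delta>" "rv p \<notin> I" using p by (auto simp: L_def ideal_compl_def)
    moreover have "rv r \<in> positive_roots \<Phi> \<Delta>" "rv q \<in> positive_roots \<Phi> \<Delta>" using rq pos by auto
    ultimately have "rv r \<notin> I" using assms(4) unfolding root_ideal_def eq by blast
    then show "r \<in> L" using rq(1) pos by (auto simp: L_def ideal_compl_def)
  qed
  have LR: "L \<subseteq> roots" by (auto simp: L_def)
  have hc: "height_count \<Phi> \<Delta> I h = card {r \<in> L. ht r = h}" for h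
  proof -
    have "{\<alpha> \<in> ideal_compl \<Phi> \<Delta> I. height \<Delta> \<alpha> = real h} = rv ` {r \<in> L. ht r = h}"
      unfolding compl using height_rv LR by force
    moreover have "inj_on rv {r \<in> L. ht r = h}" by (rule inj_on_subset[OF inj_rv]) (use LR in auto)
    ultimately show ?thesis by (simp add: height_count_def card_image)
  qed
  obtain \<rho> where \<rho>: "ifree UNIV (froot_vec e ` L) (image_mset \<rho> (mset_set {1..DIM('a)}))"
    "\<And>h. 1 \<le> h \<Longrightarrow> card {r \<in> L. ht r = h} = card {i \<in> {1..DIM('a)}. h \<le> \<rho> i}"
    using ifree_sum_closed[OF L] by blast
  have arr: "ideal_arrangement \<Phi> \<Delta> I = hyp UNIV ` froot_vec e ` L"
  proof -
    have "{x. rv r \<bullet> x = 0} = hyp UNIV (froot_vec e r)" for r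
      using hyp_rv[of UNIV r] by (auto simp: hyp_def)
    then show ?thesis unfolding ideal_arrangement_def compl by (simp add: image_image)
  qed
  \<comment> \<open>The exponents \<open>\<rho>\<close> found by adding rows and the height counts
    are conjugate. Exactly \<open>s\<close> of the \<open>\<rho> i\<close> are positive, which
    accounts for the number of zeros.\<close>
  have "replicate_mset (card {1..DIM('a)} - s) 0 + mset (map (ideal_exponent \<Phi> \<Delta> I) [1..<s + 1]) =
      image_mset \<rho> (mset_set {1..DIM('a)})"
    using conjugate_partition[of "{1..DIM('a)}" "height_count \<Phi> \<Delta> I" \<rho> s] \<rho>(2) assms(5)
    by (simp only: hc ideal_exponent_def[abs_def] finite_atLeastAtMost)
  then show ?thesis
    using ifreeD(4)[OF \<rho>(1)] ifree_free_with_exponents[OF \<rho>(1)] unfolding arr by simp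
qed

end
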